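(* Let $X\in\mathbb R^{p_1\times\cdots\times p_K\times n}$, $p=\prod_{k=1}^Kp_k$, and let $(\sigma,\Psi_1,\dots,\Psi_K)$, with $\sigma>0$ and $\Psi_k\in\mathcal G_{p_k}^+$, have the posterior density $$p(\sigma,\Psi_1,\dots,\Psi_K\mid X)\propto\sigma^{-np}\exp\left\{-\frac1{2\sigma^2}\bigl\|X\times\{\Psi_1^{-1},\dots,\Psi_K^{-1},I_n\}\bigr\|^2\right\}\frac1\sigma\prod_{k=1}^K\prod_{i=2}^{p_k}\Psi_{k[i,i]}^{\,i-2}.$$ Let $\Sigma_k=\Psi_k\Psi_k^T$. Then for each $k\in\{1,\dots,K\}$, the full conditional distribution of $(\sigma^2\Sigma_k)^{-1}$ given $X$ and $\{\Psi_j:j\ne k\}$ is $$(\sigma^2\Sigma_k)^{-1}\ \sim\ \text{mirror-Wishart}_{p_k}\Bigl(np/p_k,\ \bigl(X_{(k)}\Psi_{-k}^{-T}\Psi_{-k}^{-1}X_{(k)}^T\bigr)^{-1}\Bigr),$$ where $\Psi_{-k}=I_n\otimes\Psi_K\otimes\cdots\otimes\Psi_{k+1}\otimes\Psi_{k-1}\otimes\cdots\otimes\Psi_1$.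
   Context: $\mathcal G_q^+$ is the group of $q\times q$ real lower triangular matrices with positive diagonal entries and determinant $1$; $\Psi_{k[i,j]}$ is the $(i,j)$ entry of $\Psi_k$. The posterior density is with respect to Lebesgue measure in the coordinates $\sigma>0$ and $\{\Psi_{k[i,j]}:2\le i\le p_k,1\le j\le i\}$ (with $\Psi_{k[i,i]}>0$), where $\Psi_{k[1,1]}=\prod_{i=2}^{p_k}\Psi_{k[i,i]}^{-1}$. The Tucker product is defined by $\mathrm{vec}(Z\times\{A_1,\dots,A_m\})=(A_m\otimes\cdots\otimes A_1)\mathrm{vec}(Z)$; $\|\cdot\|$ is the Frobenius norm of an array. $X_{(k)}\in\mathbb R^{p_k\times np/p_k}$ is the mode-$k$ matricization of $X$: its rows are the vectorizations of the slices of $X$ along the $k$th index, so that $Y=Z\times\{A_1,\dots,A_m\}$ implies $Y_{(k)}=A_kZ_{(k)}(A_m^T\otimes\cdots\otimes A_{k+1}^T\otimes A_{k-1}^T\otimes\cdots\otimes A_1^T)$. A random $q\times q$ positive definite matrix $S$ has the $\text{mirror-Wishart}_q(\nu,\Phi)$ distribution, with $\nu>0$ and $\Phi$ positive definite, if $S\overset{d}{=}UV^TVU^T$, where $VV^T$ is the lower triangular Cholesky decomposition of a $\text{Wishart}_q(\nu,I_q)$ random matrix ($V$ lower triangular with positive diagonal) and $UU^T=\Phi$ is the upper triangular Cholesky decomposition of $\Phi$ ($U$ upper triangular with positive diagonal). *)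

theory Defs
  imports
    "HOL-Probability.Probability"
    "Jordan_Normal_Form.Determinant"
    "Jordan_Normal_Form.Gauss_Jordan_Elimination"
begin

text \<open>
  All indices (matrix entries, modes of an array, entries of a multi-index) start at 0, so the
  entry written [i,j] with 1-based indices in the literature is the entry (i - 1, j - 1) here.
\<close>

hide_const (open) Finite_Cartesian_Product.vec Finite_Cartesian_Product.mat
  Finite_Cartesian_Product.transpose Determinants.det


section \<open>Matrices\<close>

text \<open>Only ever applied to invertible matrices.\<close>
definition mat_inv :: "real mat \<Rightarrow> real mat" where
  "mat_inv A = the (mat_inverse A)"

definition mat_trace :: "real mat \<Rightarrow> real" where
  "mat_trace A = (\<Sum>i<dim_row A. A $$ (i, i))"

definition lower_triangular :: "real mat \<Rightarrow> bool" where
  "lower_triangular A \<longleftrightarrow> (\<forall>i<dim_row A. \<forall>j<dim_col A. i < j \<longrightarrow> A $$ (i, j) = 0)"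

definition pos_diag :: "real mat \<Rightarrow> bool" where
  "pos_diag A \<longleftrightarrow> (\<forall>i<dim_row A. A $$ (i, i) > 0)"

definition pos_def_mats :: "nat \<Rightarrow> real mat set" where
  "pos_def_mats q = {S \<in> carrier_mat q q.
     transpose_mat S = S \<and> (\<forall>v \<in> carrier_vec q. v \<noteq> 0\<^sub>v q \<longrightarrow> v \<bullet> (S *\<^sub>v v) > 0)}"

text \<open>The group $\mathcal{G}_q^+$.\<close>
definition Gplus :: "nat \<Rightarrow> real mat set" where
  "Gplus q = {A \<in> carrier_mat q q. lower_triangular A \<and> pos_diag A \<and> det A = 1}"

definition lower_chol :: "real mat \<Rightarrow> real mat" where
  "lower_chol S = (THE V. V \<in> carrier_mat (dim_row S) (dim_row S) \<and>
     lower_triangular V \<and> pos_diag V \<and> V * transpose_mat V = S)"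

definition upper_chol :: "real mat \<Rightarrow> real mat" where
  "upper_chol S = (THE U. U \<in> carrier_mat (dim_row S) (dim_row S) \<and>
     upper_triangular U \<and> pos_diag U \<and> U * transpose_mat U = S)"

definition kronecker :: "real mat \<Rightarrow> real mat \<Rightarrow> real mat" where
  "kronecker A B = mat (dim_row A * dim_row B) (dim_col A * dim_col B)
     (\<lambda>(i, j). A $$ (i div dim_row B, j div dim_col B) * B $$ (i mod dim_row B, j mod dim_col B))"

text \<open>Note the order: the list $A_1, \dots, A_m$ gives $A_m \otimes \cdots \otimes A_1$.\<close>
fun kronecker_rev :: "real mat list \<Rightarrow> real mat" where
  "kronecker_rev [] = 1\<^sub>m 1"
| "kronecker_rev (A # As) = kronecker (kronecker_rev As) A"


section \<open>Arrays\<close>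

text \<open>
  An array with dimensions ds is a function on multi-indices; only its values on
  multi_indices ds matter.  Vectorization lets the first index vary fastest.
\<close>

type_synonym array = "nat list \<Rightarrow> real"

definition multi_indices :: "nat list \<Rightarrow> nat list set" where
  "multi_indices ds = {is. length is = length ds \<and> (\<forall>j<length ds. is ! j < ds ! j)}"

fun flat_index :: "nat list \<Rightarrow> nat list \<Rightarrow> nat" where
  "flat_index (d # ds) (i # is) = i + d * flat_index ds is"
| "flat_index _ _ = 0"

fun multi_index :: "nat list \<Rightarrow> nat \<Rightarrow> nat list" where
  "multi_index [] l = []"
| "multi_index (d # ds) l = (l mod d) # multi_index ds (l div d)"

definition array_vec :: "nat list \<Rightarrow> array \<Rightarrow> real vec" where
  "array_vec ds Z = vec (prod_list ds) (\<lambda>l. Z (multi_index ds l))"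

definition array_norm :: "nat list \<Rightarrow> array \<Rightarrow> real" where
  "array_norm ds Z = sqrt (\<Sum>is \<in> multi_indices ds. (Z is)\<^sup>2)"

text \<open>The array $Y$ with $\mathrm{vec}(Y) = (A_m \otimes \cdots \otimes A_1)\,\mathrm{vec}(Z)$.\<close>
definition tucker :: "array \<Rightarrow> real mat list \<Rightarrow> array" where
  "tucker Z As =
     (\<lambda>is. (kronecker_rev As *\<^sub>v array_vec (map dim_col As) Z) $ flat_index (map dim_row As) is)"

definition matricize :: "nat list \<Rightarrow> nat \<Rightarrow> array \<Rightarrow> real mat" where
  "matricize ds k Z =
     (let es = take k ds @ drop (Suc k) ds
      in mat (ds ! k) (prod_list es)
           (\<lambda>(i, l). let js = multi_index es l in Z (take k js @ i # drop k js)))"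


section \<open>Measures on spaces of matrices\<close>

definition mat_borel :: "nat \<Rightarrow> real mat measure" where
  "mat_borel q = vimage_algebra (carrier_mat q q)
     (\<lambda>A. \<lambda>ij \<in> {..<q} \<times> {..<q}. A $$ ij) (\<Pi>\<^sub>M ij \<in> {..<q} \<times> {..<q}. borel)"

definition pd_borel :: "nat \<Rightarrow> real mat measure" where
  "pd_borel q = restrict_space (mat_borel q) (pos_def_mats q)"

definition Gplus_borel :: "nat \<Rightarrow> real mat measure" where
  "Gplus_borel q = restrict_space (mat_borel q) (Gplus q)"

text \<open>Lebesgue measure on positive definite matrices, in the entries on and below the diagonal.\<close>

definition sym_of_lower :: "nat \<Rightarrow> (nat \<times> nat \<Rightarrow> real) \<Rightarrow> real mat" where
  "sym_of_lower q x = mat q q (\<lambda>(i, j). if j \<le> i then x (i, j) else x (j, i))"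

definition pd_lebesgue :: "nat \<Rightarrow> real mat measure" where
  "pd_lebesgue q =
     distr (restrict_space (\<Pi>\<^sub>M ij \<in> {(i, j). j \<le> i \<and> i < q}. lborel)
              {x. sym_of_lower q x \<in> pos_def_mats q})
       (pd_borel q) (sym_of_lower q)"

text \<open>
  Lebesgue measure on $\mathcal{G}_q^+$ in all entries on and below the diagonal except the
  (0,0) entry, which is determined by the unit determinant.
\<close>

definition Gplus_of_coords :: "nat \<Rightarrow> (nat \<times> nat \<Rightarrow> real) \<Rightarrow> real mat" where
  "Gplus_of_coords q x = mat q q (\<lambda>(i, j).
     if i < j then 0
     else if i = 0 then (\<Prod>l\<in>{1..<q}. inverse (x (l, l)))
     else x (i, j))"

definition Gplus_lebesgue :: "nat \<Rightarrow> real mat measure" where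
  "Gplus_lebesgue q =
     distr (restrict_space (\<Pi>\<^sub>M ij \<in> {(i, j). j \<le> i \<and> 1 \<le> i \<and> i < q}. lborel)
              {x. \<forall>i\<in>{1..<q}. x (i, i) > 0})
       (Gplus_borel q) (Gplus_of_coords q)"


section \<open>Wishart and mirror-Wishart distributions\<close>

text \<open>
  The $\mathrm{Wishart}_q(\nu, I_q)$ distribution for real degrees of freedom $\nu > q - 1$, the
  range in which it lives on positive definite matrices, so that the Cholesky decomposition in
  the mirror-Wishart distribution makes sense.  The normalizing constant is
  $2^{\nu q/2}\,\Gamma_q(\nu/2)$ with the multivariate gamma function $\Gamma_q$.
\<close>

definition multivariate_Gamma :: "nat \<Rightarrow> real \<Rightarrow> real" where
  "multivariate_Gamma q a =
     pi powr (real q * (real q - 1) / 4) * (\<Prod>j<q. Gamma (a - real j / 2))"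

definition wishart :: "nat \<Rightarrow> real \<Rightarrow> real mat measure" where
  "wishart q \<nu> = density (pd_lebesgue q) (\<lambda>S. ennreal (
     det S powr ((\<nu> - real q - 1) / 2) * exp (- mat_trace S / 2) /
     (2 powr (\<nu> * real q / 2) * multivariate_Gamma q (\<nu> / 2))))"

definition mirror_wishart :: "nat \<Rightarrow> real \<Rightarrow> real mat \<Rightarrow> real mat measure" where
  "mirror_wishart q \<nu> \<Phi> = distr (wishart q \<nu>) (pd_borel q)
     (\<lambda>S. let U = upper_chol \<Phi>; V = lower_chol S
          in U * transpose_mat V * V * transpose_mat U)"


section \<open>Conditional distributions\<close>

text \<open>The kernel \<open>\<kappa>\<close> is a regular conditional distribution of \<open>Z\<close> given \<open>Y\<close>.\<close>
definition has_conditional_distribution ::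
    "'w measure \<Rightarrow> 'z measure \<Rightarrow> ('w \<Rightarrow> 'z) \<Rightarrow> 'y measure \<Rightarrow> ('w \<Rightarrow> 'y) \<Rightarrow> ('y \<Rightarrow> 'z measure) \<Rightarrow> bool"
  where
  "has_conditional_distribution M N Z L Y \<kappa> \<longleftrightarrow>
     Z \<in> measurable M N \<and> Y \<in> measurable M L \<and> \<kappa> \<in> measurable L (prob_algebra N) \<and>
     (\<forall>A \<in> sets N. \<forall>B \<in> sets L.
        emeasure M {\<omega> \<in> space M. Z \<omega> \<in> A \<and> Y \<omega> \<in> B} =
        (\<integral>\<^sup>+ \<omega>. emeasure (\<kappa> (Y \<omega>)) A * indicator B (Y \<omega>) \<partial>M))"


section \<open>The posterior\<close>

text \<open>
  There are K covariance modes with dimensions p 0, ..., p (K - 1), followed by a last mode of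
  dimension n.
\<close>

definition data_dims :: "nat \<Rightarrow> (nat \<Rightarrow> nat) \<Rightarrow> nat \<Rightarrow> nat list" where
  "data_dims K p n = map p [0..<K] @ [n]"

definition param_lebesgue :: "nat \<Rightarrow> (nat \<Rightarrow> nat) \<Rightarrow> (real \<times> (nat \<Rightarrow> real mat)) measure" where
  "param_lebesgue K p =
     restrict_space lborel {0<..} \<Otimes>\<^sub>M (\<Pi>\<^sub>M k \<in> {..<K}. Gplus_lebesgue (p k))"

text \<open>
  In 1-based indexing the last factor is the product over $2 \le i \le p_k$ of the (i,i) entry to
  the power i - 2; its 0-based exponent is i - 1.
\<close>
definition posterior_kernel ::
    "nat \<Rightarrow> (nat \<Rightarrow> nat) \<Rightarrow> nat \<Rightarrow> array \<Rightarrow> real \<Rightarrow> (nat \<Rightarrow> real mat) \<Rightarrow> real" where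
  "posterior_kernel K p n X s P =
     inverse (s ^ (n * (\<Prod>k<K. p k))) *
     exp (- (1 / (2 * s\<^sup>2)) *
       (array_norm (data_dims K p n) (tucker X (map (\<lambda>k. mat_inv (P k)) [0..<K] @ [1\<^sub>m n])))\<^sup>2) *
     (1 / s) * (\<Prod>k<K. \<Prod>i\<in>{1..<p k}. P k $$ (i, i) ^ (i - 1))"

definition Psi_minus :: "nat \<Rightarrow> nat \<Rightarrow> nat \<Rightarrow> (nat \<Rightarrow> real mat) \<Rightarrow> real mat" where
  "Psi_minus K n k P = kronecker_rev (map P ([0..<k] @ [Suc k..<K]) @ [1\<^sub>m n])"

end

(*
  Conditionally on the other shapes the exponent of the posterior is
  tr ((s \<Psi>)\<^sup>-\<^sup>1 S (s \<Psi>)\<^sup>-\<^sup>T) with S the scatter matrix of the rows of X_(k), rotated and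
  scaled by the other modes, and the prior is such that W = s \<Psi> has right Haar measure on the group of
  all lower triangular matrices with positive diagonal.  Let R be the Cholesky factor of S and
  V = W\<^sup>-\<^sup>1 R.  The trace is then the squared norm of V, and the measure becomes, up to a
  constant, \<Prod> V_ii powr (\<nu> - i - 1) dV.  So V has the Bartlett distribution, that is, it is the Cholesky
  factor of a Wishart (\<nu>, I) matrix; and (W W\<^sup>T)\<^sup>-\<^sup>1 = U V\<^sup>T V U\<^sup>T, where U = R\<^sup>-\<^sup>T is the
  upper triangular Cholesky factor of S\<^sup>-\<^sup>1.

  All changes of variables are triangular in a suitable order of the matrix entries, so they reduce to
  one-dimensional substitutions.  Since both sides of the disintegration are computed up to the same
  factor, no normalizing constant other than that of the Wishart distribution is needed.

  That X_(k) has full row rank, so that S is positive definite and \<nu> > q - 1, follows from the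
  properness of the posterior: for singular S every conditional mass is 0 or \<infinity>, hence so is the
  total mass, which is 1.
*)

theory Submission
  imports Defs
begin

text \<open>The degrees of freedom come from one identity: det (s \<Psi>) = s^q, because det \<Psi>
  = 1. With \<nu> = np / p_k the likelihood power s^(-np) is therefore det (s \<Psi>)^(-\<nu>), a
  constant times det V^\<nu>. The remaining weight \<Prod> V_ii^(-i-1) is the density of left Haar
  measure, its exponent counting the i + 1 entries of row i; inversion turns right Haar measure in W
  into it, and multiplying by R on the right costs only a constant, a value of the modular function.
  The obstacle is that G+ has one coordinate fewer than the full triangular group. The scale
  occupies the vacant position (0, 0), and W is reached in two substitutions: the other entries are
  multiplied by s, then s is exchanged for the (0, 0) entry of W, which is s^q divided by the rest
  of the diagonal. No single order of the entries serves: scaling wants (0, 0) first, the exchange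
  wants it last, and W^(-1) R wants each row read leftwards from its diagonal. All integrals are of
  nonnegative functions, so a divergent conditional mass is a legitimate value until the total mass
  1 excludes it.\<close>

section \<open>Change of variables on the real line\<close>

text \<open>Proved as an equality of two Borel measures, the image under \<open>g\<close> of the
  weighted measure on \<open>S\<close> and Lebesgue measure on \<open>E\<close>. This removes every
  integrability condition: \<open>h\<close> may be any nonnegative measurable function, with a
  finite integral or not.\<close>

lemma nn_integral_change_of_variables_real:
  fixes g g' :: "real \<Rightarrow> real" and h :: "real \<Rightarrow> ennreal"
  assumes S[measurable]: "S \<in> sets borel"
    and deriv: "\<And>x. x \<in> S \<Longrightarrow> (g has_real_derivative g' x) (at x within S)"
    and inj: "inj_on g S"
    and g[measurable]: "g \<in> borel_measurable borel"
    and g'[measurable]: "g' \<in> borel_measurable borel"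
    and E: "g ` S = E" and E_m[measurable]: "E \<in> sets borel"
    and h: "h \<in> borel_measurable borel"
  shows "(\<integral>\<^sup>+x. h (g x) * (ennreal \<bar>g' x\<bar> * indicator S x) \<partial>lborel) = (\<integral>\<^sup>+y. h y * indicator E y \<partial>lborel)"
proof -
  define \<mu> where "\<mu> = distr (density lborel (\<lambda>x. ennreal \<bar>g' x\<bar> * indicator S x)) borel g"
  define \<nu> where "\<nu> = density lborel (indicator E :: real \<Rightarrow> ennreal)"
  \<comment> \<open>On a bounded set the indicator of \<open>A \<inter> E\<close> is absolutely
    integrable, so the substitution rule for absolutely integrable functions applies; general Borel
    sets are then exhausted by bounded ones.\<close>
  have fin: "emeasure \<mu> A = emeasure \<nu> A" if A[measurable]: "A \<in> sets borel" and bd: "bounded A" for A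
  proof -
    let ?f = "indicator (A \<inter> E) :: real \<Rightarrow> real"
    have AE: "A \<inter> E \<in> lmeasurable"
      by (rule bounded_set_imp_lmeasurable) (use bd in \<open>auto intro: bounded_subset\<close>)
    have "?f absolutely_integrable_on E"
    proof -
      have "?f absolutely_integrable_on UNIV"
        using AE by (simp add: set_integrable_def fmeasurable_def)
      then show ?thesis
        by (rule set_integrable_subset) auto
    qed
    moreover have "integral E ?f = measure lebesgue (A \<inter> E)"
      using AE lmeasure_integral[of "A \<inter> E"]
      by (metis (no_types, lifting) Int_commute inf.right_idem integral_restrict_Int indicator_inter_arith
          indicator_simps integral_indicator)
    ultimately have *: "(\<lambda>x. \<bar>g' x\<bar> *\<^sub>R ?f (g x)) absolutely_integrable_on S \<and>
        integral S (\<lambda>x. \<bar>g' x\<bar> *\<^sub>R ?f (g x)) = measure lebesgue (A \<inter> E)"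
      using has_absolute_integral_change_of_variables_real[of S g g' ?f "measure lebesgue (A \<inter> E)"] deriv inj E S
      by (auto)
    have "emeasure \<mu> A = (\<integral>\<^sup>+x. ennreal \<bar>g' x\<bar> * indicator S x * indicator A (g x) \<partial>lborel)"
      unfolding \<mu>_def by (simp add: emeasure_distr emeasure_density indicator_vimage[symmetric] vimage_def)
    also have "\<dots> = (\<integral>\<^sup>+x. ennreal (indicator S x * (\<bar>g' x\<bar> *\<^sub>R ?f (g x))) \<partial>lborel)"
      using E by (intro nn_integral_cong) (auto split: split_indicator)
    also have "\<dots> = (\<integral>\<^sup>+x. ennreal (indicator S x * (\<bar>g' x\<bar> *\<^sub>R ?f (g x))) \<partial>lebesgue)"
      by (simp add: nn_integral_completion)
    also have "\<dots> = ennreal (integral S (\<lambda>x. \<bar>g' x\<bar> *\<^sub>R ?f (g x)))"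
    proof -
      have i: "set_integrable lebesgue S (\<lambda>x. \<bar>g' x\<bar> *\<^sub>R ?f (g x))" using * by simp
      then have "(\<integral>\<^sup>+x. ennreal (indicator S x * (\<bar>g' x\<bar> *\<^sub>R ?f (g x))) \<partial>lebesgue)
         = ennreal (\<integral>x. indicator S x * (\<bar>g' x\<bar> *\<^sub>R ?f (g x)) \<partial>lebesgue)"
        by (intro nn_integral_eq_integral) (auto simp: set_integrable_def)
      also have "(\<integral>x. indicator S x * (\<bar>g' x\<bar> *\<^sub>R ?f (g x)) \<partial>lebesgue) = (LINT x:S|lebesgue. \<bar>g' x\<bar> *\<^sub>R ?f (g x))"
        by (simp add: set_lebesgue_integral_def)
      also have "\<dots> = integral S (\<lambda>x. \<bar>g' x\<bar> *\<^sub>R ?f (g x))"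
        by (rule set_lebesgue_integral_eq_integral(2)[OF i])
      finally show ?thesis .
    qed
    also have "\<dots> = ennreal (measure lebesgue (A \<inter> E))" using * by simp
    also have "\<dots> = emeasure lebesgue (A \<inter> E)"
      using AE by (metis emeasure_eq_ennreal_measure fmeasurableD2 top.not_eq_extremum top_neq_ennreal)
    also have "\<dots> = emeasure \<nu> A"
    proof -
      have "emeasure \<nu> A = (\<integral>\<^sup>+x. indicator E x * indicator A x \<partial>lborel)"
        unfolding \<nu>_def by (rule emeasure_density) auto
      also have "\<dots> = (\<integral>\<^sup>+x. indicator (A \<inter> E) x \<partial>lborel)"
        by (rule nn_integral_cong) (auto split: split_indicator)
      finally show ?thesis by simp
    qed
    finally show ?thesis .
  qed
  have "\<mu> = \<nu>"
  proof (rule measure_eqI)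
    show s: "sets \<mu> = sets \<nu>" by (simp add: \<mu>_def \<nu>_def)
    fix A assume "A \<in> sets \<mu>"
    then have [measurable]: "A \<in> sets borel" by (simp add: \<mu>_def)
    let ?A = "\<lambda>n. A \<inter> cball 0 (real n)"
    have U: "A = (\<Union>n. ?A n)"
      by (auto simp: dist_real_def) (meson real_arch_simple)
    have inc: "incseq ?A" by (auto simp: incseq_def)
    have "(SUP n. emeasure \<mu> (?A n)) = emeasure \<mu> (\<Union>n. ?A n)"
      by (rule SUP_emeasure_incseq[OF _ inc]) (auto simp: \<mu>_def)
    moreover have "(SUP n. emeasure \<nu> (?A n)) = emeasure \<nu> (\<Union>n. ?A n)"
      by (rule SUP_emeasure_incseq[OF _ inc]) (auto simp: \<nu>_def)
    moreover have "emeasure \<mu> (?A n) = emeasure \<nu> (?A n)" for n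
      by (rule fin) auto
    ultimately show "emeasure \<mu> A = emeasure \<nu> A" using U by simp
  qed
  then have "(\<integral>\<^sup>+y. h y \<partial>\<mu>) = (\<integral>\<^sup>+y. h y \<partial>\<nu>)" by simp
  then show ?thesis
    using h unfolding \<mu>_def \<nu>_def
    by (simp add: nn_integral_distr nn_integral_density mult_ac)
qed

section \<open>Triangular substitutions in several variables\<close>

text \<open>A function on the product over \<open>I\<close> that sees only the coordinates in
  \<open>J\<close> is its own composite with this padding by 0, and so is measurable on the product
  over \<open>J\<close>.\<close>

lemma measurable_PiM_extend:
  assumes "J \<subseteq> I"
  shows "(\<lambda>x. \<lambda>i\<in>I. if i \<in> J then x i else 0) \<in> measurable (PiM J (\<lambda>_. lborel)) (PiM I (\<lambda>_. lborel :: real measure))"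
proof (rule measurable_restrict)
  fix i assume "i \<in> I"
  show "(\<lambda>x. if i \<in> J then x i else 0) \<in> measurable (PiM J (\<lambda>_. lborel)) (lborel :: real measure)"
    by (cases "i \<in> J") (simp_all add: measurable_component_singleton)
qed

text \<open>
  The coordinate map \<open>g i\<close> and its partial derivative \<open>J i\<close> in the \<open>i\<close>-th variable see
  only the coordinates of rank at most \<open>r i\<close>, so Jacobian determinants are products of
  one-dimensional derivatives.  Using ranks instead of a matrix type keeps the dimension a
  natural number, which the library's change of variables theorem does not allow.
\<close>
locale triangular_substitution =
  fixes I :: "'i set" and r :: "'i \<Rightarrow> nat" and g :: "'i \<Rightarrow> ('i \<Rightarrow> real) \<Rightarrow> real"
    and J :: "'i \<Rightarrow> ('i \<Rightarrow> real) \<Rightarrow> ennreal" and D :: "'i \<Rightarrow> ('i \<Rightarrow> real) \<Rightarrow> bool"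
    and E :: "'i \<Rightarrow> real set"
  assumes fin: "finite I" and rank: "inj_on r I"
    and cong_g: "\<And>i x y. i \<in> I \<Longrightarrow> (\<And>a. a \<in> I \<Longrightarrow> r a \<le> r i \<Longrightarrow> x a = y a) \<Longrightarrow> g i x = g i y"
    and cong_J: "\<And>i x y. i \<in> I \<Longrightarrow> (\<And>a. a \<in> I \<Longrightarrow> r a \<le> r i \<Longrightarrow> x a = y a) \<Longrightarrow> J i x = J i y"
    and cong_D: "\<And>i x y. i \<in> I \<Longrightarrow> (\<And>a. a \<in> I \<Longrightarrow> r a \<le> r i \<Longrightarrow> x a = y a) \<Longrightarrow> D i x = D i y"
    and meas_g: "\<And>i. i \<in> I \<Longrightarrow> g i \<in> borel_measurable (PiM I (\<lambda>_. lborel))"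
    and meas_J: "\<And>i. i \<in> I \<Longrightarrow> J i \<in> borel_measurable (PiM I (\<lambda>_. lborel))"
    and meas_D: "\<And>i. i \<in> I \<Longrightarrow> Measurable.pred (PiM I (\<lambda>_. lborel)) (D i)"
    and meas_E: "\<And>i. i \<in> I \<Longrightarrow> E i \<in> sets borel"
    and sub1: "\<And>i x (h :: real \<Rightarrow> ennreal). i \<in> I \<Longrightarrow> (\<And>a. a \<in> I \<Longrightarrow> r a < r i \<Longrightarrow> D a x) \<Longrightarrow> h \<in> borel_measurable borel \<Longrightarrow>
       (\<integral>\<^sup>+t. h (g i (x(i := t))) * (J i (x(i := t)) * of_bool (D i (x(i := t)))) \<partial>lborel) =
       (\<integral>\<^sup>+s. h s * indicator (E i) s \<partial>lborel)"

text \<open>Induction that removes the coordinate \<open>m\<close> of largest rank. None of the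
  other \<open>g\<close>, \<open>J\<close>, \<open>D\<close> sees it, so by Tonelli the innermost
  integral is the one-dimensional substitution \<open>sub1\<close> and the outer one is an instance
  of the induction hypothesis.\<close>

theorem nn_integral_triangular_substitution:
  assumes "triangular_substitution I r g J D E"
    and "F \<in> borel_measurable (PiM I (\<lambda>_. lborel))"
  shows "(\<integral>\<^sup>+x. F (\<lambda>i\<in>I. g i x) * (\<Prod>i\<in>I. J i x * of_bool (D i x)) \<partial>PiM I (\<lambda>_. lborel)) =
         (\<integral>\<^sup>+y. F y * (\<Prod>i\<in>I. indicator (E i) (y i)) \<partial>PiM I (\<lambda>_. lborel))"
  using assms
proof (induction "card I" arbitrary: I F)
  case 0
  then have "I = {}" using triangular_substitution.fin by fastforce
  then show ?case by (simp add: PiM_empty nn_integral_count_space_finite)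
next
  case (Suc n)
  interpret triangular_substitution I r g J D E by fact
  interpret product_sigma_finite "\<lambda>_. lborel :: real measure" by standard
  note [measurable] = meas_g meas_J meas_D meas_E Suc.prems(2)
  have ne: "I \<noteq> {}" using Suc by auto
  define m where "m = (ARG_MAX r i. i \<in> I)"
  have m: "m \<in> I" "\<And>a. a \<in> I \<Longrightarrow> r a \<le> r m"
    using ne fin arg_max_nat_lemma[of "\<lambda>i. i \<in> I" _ r "Suc (Max (r ` I))"]
    by (auto simp: m_def less_Suc_eq_le)
  define K where "K = I - {m}"
  have I: "I = insert m K" "m \<notin> K" "finite K" "K \<subseteq> I" using m fin by (auto simp: K_def)
  have lt: "r a < r m" if "a \<in> K" for a
    using that m inj_onD[OF rank, of a m] by (force simp: K_def less_le)
  have dg: "g i x = g i y" "J i x = J i y" "D i x = D i y" if "i \<in> K" "\<And>a. a \<in> K \<Longrightarrow> r a \<le> r i \<Longrightarrow> x a = y a" for i x y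
  proof -
    have "a \<in> K" if "a \<in> I" "r a \<le> r i" for a using that lt[OF \<open>i \<in> K\<close>] I by auto
    then show "g i x = g i y" "J i x = J i y" "D i x = D i y"
      using that I by (auto intro!: cong_g cong_J cong_D)
  qed
  \<comment> \<open>The value 0 put at \<open>m\<close> is never read by a function attached to an
    index in \<open>K\<close>.\<close>
  let ?e = "\<lambda>x. \<lambda>i\<in>I. if i \<in> K then x i else (0::real)"
  have e[measurable]: "?e \<in> measurable (PiM K (\<lambda>_. lborel)) (PiM I (\<lambda>_. lborel))"
    using I by (intro measurable_PiM_extend)
  have eq: "g i = g i \<circ> ?e" "J i = J i \<circ> ?e" "D i = D i \<circ> ?e" if "i \<in> K" for i
  proof -
    have e': "x a = ?e x a" if "a \<in> K" for x a using that I by auto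
    show "g i = g i \<circ> ?e" "J i = J i \<circ> ?e" "D i = D i \<circ> ?e"
      by (rule ext, subst o_apply, rule dg[OF that], erule e')+
  qed
  have gm[measurable]: "g i \<in> borel_measurable (PiM K (\<lambda>_. lborel))"
     "J i \<in> borel_measurable (PiM K (\<lambda>_. lborel))" "Measurable.pred (PiM K (\<lambda>_. lborel)) (D i)"
    if "i \<in> K" for i
    using that I by (subst eq, simp, intro measurable_comp[OF e] meas_g meas_J meas_D, auto)+
  \<comment> \<open>What remains of the right-hand side once the last variable is integrated out;
    the induction hypothesis is applied to this function.\<close>
  define F' where "F' y = (\<integral>\<^sup>+s. F (y(m := s)) * indicator (E m) s \<partial>lborel)" for y
  have upd[measurable]: "(\<lambda>(y,s). y(m := s)) \<in> measurable (PiM K (\<lambda>_. lborel) \<Otimes>\<^sub>M lborel) (PiM I (\<lambda>_. lborel))"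
    unfolding I(1) by (rule measurable_add_dim)
  have Em[measurable]: "E m \<in> sets borel" using meas_E m by auto
  have F'm: "F' \<in> borel_measurable (PiM K (\<lambda>_. lborel))"
    unfolding F'_def by measurable
  have P: "PiM I (\<lambda>_. lborel :: real measure) = PiM (insert m K) (\<lambda>_. lborel)" using I by simp
  have Tm[measurable]: "(\<lambda>x. \<lambda>i\<in>I. g i x) \<in> measurable (PiM I (\<lambda>_. lborel)) (PiM I (\<lambda>_. lborel))"
    by (rule measurable_restrict) (use meas_g in auto)
  have s1: "(\<integral>\<^sup>+x. F (\<lambda>i\<in>I. g i x) * (\<Prod>i\<in>I. J i x * of_bool (D i x)) \<partial>PiM I (\<lambda>_. lborel)) =
    (\<integral>\<^sup>+x. \<integral>\<^sup>+t. F (\<lambda>i\<in>I. g i (x(m:=t))) * (\<Prod>i\<in>I. J i (x(m:=t)) * of_bool (D i (x(m:=t)))) \<partial>lborel \<partial>PiM K (\<lambda>_. lborel))" (is "_ = ?R1")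
  proof -
    have "(\<lambda>x. J i x * of_bool (D i x)) \<in> borel_measurable (PiM I (\<lambda>_. lborel))" if "i \<in> I" for i
      unfolding of_bool_def
      by (intro borel_measurable_times_ennreal meas_J[OF that] measurable_If measurable_const)
        (use meas_D[OF that] in \<open>simp_all add: pred_def\<close>)
    then have "(\<lambda>x. F (\<lambda>i\<in>I. g i x) * (\<Prod>i\<in>I. J i x * of_bool (D i x))) \<in> borel_measurable (PiM (insert m K) (\<lambda>_. lborel))"
      unfolding P[symmetric]
      by (intro borel_measurable_times_ennreal[OF measurable_compose[OF Tm Suc.prems(2)] borel_measurable_prod_ennreal])
    note 1 = product_nn_integral_insert[OF I(3,2) this]
    show ?thesis using 1 by (simp only: P)
  qed
  have s2: "?R1 = (\<integral>\<^sup>+x. F' (\<lambda>i\<in>K. g i x) * (\<Prod>i\<in>K. J i x * of_bool (D i x)) \<partial>PiM K (\<lambda>_. lborel))" (is "_ = ?R2")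
  proof (rule nn_integral_cong)
    fix x assume x: "x \<in> space (PiM K (\<lambda>_. lborel :: real measure))"
    have K: "g i (x(m:=t)) = g i x" "J i (x(m:=t)) = J i x" "D i (x(m:=t)) = D i x" if "i \<in> K" for i t
    proof -
      have "a \<noteq> m" if "a \<in> K" for a using that I by auto
      then have e: "(x(m:=t)) a = x a" if "a \<in> K" for a using that by simp
      show "g i (x(m:=t)) = g i x" "J i (x(m:=t)) = J i x" "D i (x(m:=t)) = D i x"
        by (rule dg[OF that], erule e)+
    qed
    have T: "(\<lambda>i\<in>I. g i (x(m:=t))) = (\<lambda>i\<in>K. g i x)(m := g m (x(m:=t)))" for t
      using I K by (auto simp: fun_eq_iff restrict_def)
    have Pr: "(\<Prod>i\<in>I. J i (x(m:=t)) * of_bool (D i (x(m:=t)))) =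
        (\<Prod>i\<in>K. J i x * of_bool (D i x)) * (J m (x(m:=t)) * of_bool (D m (x(m:=t))))" for t
    proof -
      have "(\<Prod>i\<in>K. J i (x(m:=t)) * of_bool (D i (x(m:=t)))) = (\<Prod>i\<in>K. J i x * of_bool (D i x))"
        by (intro prod.cong refl) (simp add: K)
      then show ?thesis using I by (simp add: mult.commute)
    qed
    show "(\<integral>\<^sup>+t. F (\<lambda>i\<in>I. g i (x(m:=t))) * (\<Prod>i\<in>I. J i (x(m:=t)) * of_bool (D i (x(m:=t)))) \<partial>lborel) =
       F' (\<lambda>i\<in>K. g i x) * (\<Prod>i\<in>K. J i x * of_bool (D i x))"
    \<comment> \<open>\<open>sub1\<close> presupposes the conditions at all lower ranks. Where one
      of them fails, its factor makes both sides 0.\<close>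
    proof (cases "\<forall>i\<in>K. D i x")
      case False
      then have "(\<Prod>i\<in>K. J i x * of_bool (D i x)) = 0" using I by (auto intro!: prod_zero)
      then show ?thesis by (simp only: Pr mult_zero_left mult_zero_right nn_integral_const)
    next
      case True
      let ?c = "(\<Prod>i\<in>K. J i x * of_bool (D i x))"
      let ?y = "\<lambda>i\<in>K. g i x"
      have y: "?y \<in> space (PiM K (\<lambda>_. lborel :: real measure))" by (auto simp: space_PiM)
      have hm: "(\<lambda>s. F (?y(m := s)) * ?c) \<in> borel_measurable borel"
        using measurable_compose[OF measurable_Pair1'[OF y, of lborel] upd] by simp
      have hm': "(\<lambda>s. F (?y(m := s)) * indicator (E m) s) \<in> borel_measurable lborel"
        using measurable_compose[OF measurable_Pair1'[OF y, of lborel] upd] by simp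
      have "(\<integral>\<^sup>+t. F (\<lambda>i\<in>I. g i (x(m:=t))) * (\<Prod>i\<in>I. J i (x(m:=t)) * of_bool (D i (x(m:=t)))) \<partial>lborel) =
        (\<integral>\<^sup>+t. (\<lambda>s. F (?y(m := s)) * ?c) (g m (x(m:=t))) * (J m (x(m:=t)) * of_bool (D m (x(m:=t)))) \<partial>lborel)"
        by (intro nn_integral_cong) (simp add: T Pr mult_ac)
      also have "\<dots> = (\<integral>\<^sup>+s. (\<lambda>s. F (?y(m := s)) * ?c) s * indicator (E m) s \<partial>lborel)"
      proof (rule sub1[OF m(1) _ hm])
        fix a assume "a \<in> I" "r a < r m"
        then show "D a x" using True I by auto
      qed
      also have "\<dots> = (\<integral>\<^sup>+s. (F (?y(m := s)) * indicator (E m) s) * ?c \<partial>lborel)"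
        by (simp add: mult_ac)
      also have "\<dots> = F' ?y * ?c"
        unfolding F'_def by (rule nn_integral_multc[OF hm'])
      finally show ?thesis .
    qed
  qed
  have s3: "?R2 = (\<integral>\<^sup>+y. F' y * (\<Prod>i\<in>K. indicator (E i) (y i)) \<partial>PiM K (\<lambda>_. lborel))" (is "_ = ?R3")
  proof (rule Suc.hyps(1)[OF _ _ F'm])
    show "n = card K" using Suc.hyps(2) I by simp
    show "triangular_substitution K r g J D E"
    proof
    show "finite K" by fact
    show "inj_on r K" using rank I by (auto intro: inj_on_subset)
    show "E i \<in> sets borel" if "i \<in> K" for i using that I meas_E by auto
    fix i x and h :: "real \<Rightarrow> ennreal" assume i: "i \<in> K" and D: "\<And>a. a \<in> K \<Longrightarrow> r a < r i \<Longrightarrow> D a x" and h: "h \<in> borel_measurable borel"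
    have "D a x" if "a \<in> I" "r a < r i" for a using that lt[OF i] I D by auto
    then show "(\<integral>\<^sup>+t. h (g i (x(i := t))) * (J i (x(i := t)) * of_bool (D i (x(i := t)))) \<partial>lborel) =
       (\<integral>\<^sup>+s. h s * indicator (E i) s \<partial>lborel)"
      using i I h by (intro sub1) auto
  qed ((rule gm, assumption) | (rule dg, assumption, blast))+
  qed
  have s4: "?R3 = (\<integral>\<^sup>+y. \<integral>\<^sup>+s. F (y(m:=s)) * (\<Prod>i\<in>I. indicator (E i) ((y(m:=s)) i)) \<partial>lborel \<partial>PiM K (\<lambda>_. lborel))" (is "_ = ?R4")
  proof (rule nn_integral_cong)
    fix y assume y: "y \<in> space (PiM K (\<lambda>_. lborel :: real measure))"
    have hm': "(\<lambda>s. F (y(m := s)) * indicator (E m) s) \<in> borel_measurable lborel"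
        using measurable_compose[OF measurable_Pair1'[OF y, of lborel] upd] by simp
    have Pr: "(\<Prod>i\<in>I. indicator (E i) ((y(m:=s)) i) :: ennreal) = (\<Prod>i\<in>K. indicator (E i) (y i)) * indicator (E m) s" for s
    proof -
      have "(\<Prod>i\<in>K. indicator (E i) ((y(m:=s)) i) :: ennreal) = (\<Prod>i\<in>K. indicator (E i) (y i))"
        by (intro prod.cong refl) (use I in auto)
      then show ?thesis using I by (simp add: mult.commute)
    qed
    show "F' y * (\<Prod>i\<in>K. indicator (E i) (y i)) =
       (\<integral>\<^sup>+s. F (y(m:=s)) * (\<Prod>i\<in>I. indicator (E i) ((y(m:=s)) i)) \<partial>lborel)"
      unfolding F'_def Pr by (subst nn_integral_multc[OF hm', symmetric]) (simp add: mult_ac)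
  qed
  have s5: "?R4 = (\<integral>\<^sup>+y. F y * (\<Prod>i\<in>I. indicator (E i) (y i)) \<partial>PiM I (\<lambda>_. lborel))" (is "_ = ?R5")
  proof -
    have "(\<lambda>y. F y * (\<Prod>i\<in>I. indicator (E i) (y i))) \<in> borel_measurable (PiM I (\<lambda>_. lborel))"
      by (intro borel_measurable_times_ennreal borel_measurable_prod_ennreal Suc.prems(2)
          measurable_compose[OF measurable_component_singleton borel_measurable_indicator])
        (simp_all add: meas_E)
    then have 1: "(\<lambda>y. F y * (\<Prod>i\<in>I. indicator (E i) (y i))) \<in> borel_measurable (PiM (insert m K) (\<lambda>_. lborel))"
      by (simp only: P)
    note 2 = product_nn_integral_insert[OF I(3,2) 1]
    show ?thesis
      apply (subst P)
      apply (subst 2)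
      apply (rule refl)
      done
  qed
  show ?case
    by (rule trans[OF s1 trans[OF s2 trans[OF s3 trans[OF s4 s5]]]])
qed

section \<open>The one-dimensional substitutions that occur\<close>

lemma nn_integral_subst_affine:
  fixes h :: "real \<Rightarrow> ennreal"
  assumes "a \<noteq> 0" "h \<in> borel_measurable borel"
  shows "(\<integral>\<^sup>+t. h (b + a * t) * ennreal \<bar>a\<bar> \<partial>lborel) = (\<integral>\<^sup>+s. h s \<partial>lborel)"
  using nn_integral_real_affine[OF assms(2,1), of b] assms
  by (simp add: nn_integral_multc, simp add: mult.commute)

lemma nn_integral_subst_scale:
  fixes h :: "real \<Rightarrow> ennreal"
  assumes "a > 0" "h \<in> borel_measurable borel"
  shows "(\<integral>\<^sup>+t. h (a * t) * (ennreal a * of_bool (t > 0)) \<partial>lborel) = (\<integral>\<^sup>+s. h s * indicator {0<..} s \<partial>lborel)"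
proof -
  have "(\<integral>\<^sup>+t. h (a * t) * (ennreal a * of_bool (t > 0)) \<partial>lborel) =
     (\<integral>\<^sup>+t. h (a * t) * (ennreal \<bar>a\<bar> * indicator {0<..} t) \<partial>lborel)"
    using assms by (intro nn_integral_cong) (auto split: split_indicator)
  also have "\<dots> = (\<integral>\<^sup>+s. h s * indicator {0<..} s \<partial>lborel)"
  proof (rule nn_integral_change_of_variables_real)
    show "(*) a ` {0<..} = {0<..}"
    proof (intro equalityI subsetI)
      fix y :: real assume "y \<in> {0<..}"
      then show "y \<in> (*) a ` {0<..}" using assms by (intro image_eqI[of _ _ "y / a"]) auto
    qed (use assms in auto)
    show "inj_on ((*) a) {0<..}" using assms by (auto simp: inj_on_def)
    show "((*) a has_real_derivative a) (at x within {0<..})" for x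
      by (auto intro!: derivative_eq_intros)
  qed (use assms in auto)
  finally show ?thesis .
qed

lemma nn_integral_subst_inverse:
  fixes h :: "real \<Rightarrow> ennreal"
  assumes "a > 0" "h \<in> borel_measurable borel"
  shows "(\<integral>\<^sup>+t. h (a / t) * (ennreal (a / t\<^sup>2) * of_bool (t > 0)) \<partial>lborel) = (\<integral>\<^sup>+s. h s * indicator {0<..} s \<partial>lborel)"
proof -
  have "(\<integral>\<^sup>+t. h (a / t) * (ennreal (a / t\<^sup>2) * of_bool (t > 0)) \<partial>lborel) =
     (\<integral>\<^sup>+t. h (a / t) * (ennreal \<bar>- (a / t\<^sup>2)\<bar> * indicator {0<..} t) \<partial>lborel)"
    using assms by (intro nn_integral_cong) (auto split: split_indicator)
  also have "\<dots> = (\<integral>\<^sup>+s. h s * indicator {0<..} s \<partial>lborel)"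
  proof (rule nn_integral_change_of_variables_real)
    show "(/) a ` {0<..} = {0<..}"
    proof (intro equalityI subsetI)
      fix y :: real assume "y \<in> {0<..}"
      then show "y \<in> (/) a ` {0<..}" using assms by (intro image_eqI[of _ _ "a / y"]) auto
    qed (use assms in auto)
    show "inj_on ((/) a) {0<..}" using assms by (auto simp: inj_on_def)
    show "((/) a has_real_derivative - (a / x\<^sup>2)) (at x within {0<..})" if "x \<in> {0<..}" for x
      using that by (auto intro!: derivative_eq_intros simp: power2_eq_square)
  qed (use assms in auto)
  finally show ?thesis .
qed

text \<open>Serves the determinant, in which the scale enters as a \<open>q\<close>-th power, and
  with exponent 2 the chi integral.\<close>

lemma nn_integral_subst_power:
  fixes h :: "real \<Rightarrow> ennreal"
  assumes "a > 0" "q \<ge> 1" "h \<in> borel_measurable borel"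
  shows "(\<integral>\<^sup>+t. h (a * t ^ q) * (ennreal (a * (real q * t ^ (q - 1))) * of_bool (t > 0)) \<partial>lborel) =
    (\<integral>\<^sup>+s. h s * indicator {0<..} s \<partial>lborel)"
proof -
  have "(\<integral>\<^sup>+t. h (a * t ^ q) * (ennreal (a * (real q * t ^ (q - 1))) * of_bool (t > 0)) \<partial>lborel) =
     (\<integral>\<^sup>+t. h (a * t ^ q) * (ennreal \<bar>a * (real q * t ^ (q - 1))\<bar> * indicator {0<..} t) \<partial>lborel)"
    using assms by (intro nn_integral_cong) (auto split: split_indicator simp: abs_mult)
  also have "\<dots> = (\<integral>\<^sup>+s. h s * indicator {0<..} s \<partial>lborel)"
  proof (rule nn_integral_change_of_variables_real)
    show "(\<lambda>t. a * t ^ q) ` {0<..} = {0<..}"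
    proof (intro equalityI subsetI)
      fix y :: real assume "y \<in> {0<..}"
      then show "y \<in> (\<lambda>t. a * t ^ q) ` {0<..}" using assms
        by (intro image_eqI[of _ _ "root q (y / a)"]) auto
    qed (use assms in auto)
    show "inj_on (\<lambda>t. a * t ^ q) {0<..}"
      using assms by (auto simp: inj_on_def intro: power_eq_imp_eq_base)
    show "((\<lambda>t. a * t ^ q) has_real_derivative a * (real q * x ^ (q - 1))) (at x within {0<..})" for x
      by (auto intro!: derivative_eq_intros)
  qed (use assms in auto)
  finally show ?thesis .
qed

text \<open>The diagonal step of the Cholesky map, where \<open>c\<close> is the sum of squares of
  the entries already found in the row.\<close>

lemma nn_integral_subst_sqrt:
  fixes h :: "real \<Rightarrow> ennreal"
  assumes "h \<in> borel_measurable borel"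
  shows "(\<integral>\<^sup>+t. h (sqrt (t - c)) * (ennreal (1 / (2 * sqrt (t - c))) * of_bool (t - c > 0)) \<partial>lborel) =
    (\<integral>\<^sup>+s. h s * indicator {0<..} s \<partial>lborel)"
proof -
  have "(\<integral>\<^sup>+t. h (sqrt (t - c)) * (ennreal (1 / (2 * sqrt (t - c))) * of_bool (t - c > 0)) \<partial>lborel) =
     (\<integral>\<^sup>+t. h (sqrt (t - c)) * (ennreal \<bar>1 / (2 * sqrt (t - c))\<bar> * indicator {c<..} t) \<partial>lborel)"
    using assms by (intro nn_integral_cong) (auto split: split_indicator)
  also have "\<dots> = (\<integral>\<^sup>+s. h s * indicator {0<..} s \<partial>lborel)"
  proof (rule nn_integral_change_of_variables_real)
    show "(\<lambda>t. sqrt (t - c)) ` {c<..} = {0<..}"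
    proof (intro equalityI subsetI)
      fix y :: real assume "y \<in> {0<..}"
      then show "y \<in> (\<lambda>t. sqrt (t - c)) ` {c<..}" using assms
        by (intro image_eqI[of _ _ "y\<^sup>2 + c"]) auto
    qed (use assms in auto)
    show "inj_on (\<lambda>t. sqrt (t - c)) {c<..}" by (auto simp: inj_on_def)
    show "((\<lambda>t. sqrt (t - c)) has_real_derivative (1 / (2 * sqrt (x - c)))) (at x within {c<..})" if "x \<in> {c<..}" for x
      using that by (auto intro!: derivative_eq_intros simp: divide_simps)
  qed (use assms in auto)
  finally show ?thesis .
qed

section \<open>Matrices\<close>

lemma mat_inv:
  assumes "A \<in> carrier_mat n n" "det A \<noteq> 0"
  shows "mat_inv A \<in> carrier_mat n n" "A * mat_inv A = 1\<^sub>m n" "mat_inv A * A = 1\<^sub>m n"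
proof -
  obtain B where "mat_inverse A = Some B"
    using mat_inverse(1)[OF assms(1), where b = "()"] det_non_zero_imp_unit[OF assms, where b = "()"]
    by (cases "mat_inverse A") auto
  then show "mat_inv A \<in> carrier_mat n n" "A * mat_inv A = 1\<^sub>m n" "mat_inv A * A = 1\<^sub>m n"
    using mat_inverse(2)[OF assms(1)] by (auto simp: mat_inv_def)
qed

text \<open>\<open>det A * det B = 1\<close> already gives invertibility, so for square matrices a
  one-sided inverse suffices.\<close>

lemma mat_inv_unique:
  assumes A: "A \<in> carrier_mat n n" and B: "B \<in> carrier_mat n n" and AB: "A * B = 1\<^sub>m n"
  shows "mat_inv A = B" "det A \<noteq> 0"
proof -
  show d: "det A \<noteq> 0" using det_mult[OF A B] AB by auto
  have "mat_inv A = mat_inv A * (A * B)" using mat_inv[OF A d] AB by auto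
  also have "\<dots> = B" using mat_inv[OF A d] A B by (simp flip: assoc_mult_mat)
  finally show "mat_inv A = B" .
qed

text \<open>Cramer's rule makes the entries of the inverse rational in the entries of
  \<open>A\<close>; measurability of inversion is read off from this formula.\<close>

lemma mat_inv_adj:
  assumes A: "A \<in> carrier_mat n n" and d: "det A \<noteq> 0"
  shows "mat_inv A = inverse (det A) \<cdot>\<^sub>m adj_mat A"
proof (rule mat_inv_unique(1)[OF A])
  show "inverse (det A) \<cdot>\<^sub>m adj_mat A \<in> carrier_mat n n" using adj_mat[OF A] by auto
  show "A * (inverse (det A) \<cdot>\<^sub>m adj_mat A) = 1\<^sub>m n"
    using adj_mat[OF A] A d by (subst mult_smult_distrib[OF A]) (auto simp: intro!: eq_matI)
qed

lemma mat_inv_mult: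
  assumes A: "A \<in> carrier_mat n n" "det A \<noteq> 0" and B: "B \<in> carrier_mat n n" "det B \<noteq> 0"
  shows "mat_inv (A * B) = mat_inv B * mat_inv A"
proof (rule mat_inv_unique(1))
  note a = mat_inv[OF A] and b = mat_inv[OF B]
  show "A * B * (mat_inv B * mat_inv A) = 1\<^sub>m n"
  proof -
    have "A * B * (mat_inv B * mat_inv A) = A * (B * mat_inv B) * mat_inv A"
      using A(1) B(1) a(1) b(1) by (simp add: assoc_mult_mat[of _ n n _ n _ n])
    then show ?thesis using a b A by simp
  qed
qed (use A B mat_inv[OF A] mat_inv[OF B] in auto)

lemma mat_inv_transpose:
  assumes A: "A \<in> carrier_mat n n" "det A \<noteq> 0"
  shows "mat_inv (transpose_mat A) = transpose_mat (mat_inv A)"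
proof (rule mat_inv_unique(1))
  note a = mat_inv[OF A]
  show "transpose_mat A * transpose_mat (mat_inv A) = 1\<^sub>m n"
    using a A by (simp flip: transpose_mult)
qed (use A mat_inv[OF A] in auto)

lemma det_mat_inv:
  assumes A: "A \<in> carrier_mat n n" "det A \<noteq> 0"
  shows "det (mat_inv A) \<noteq> 0"
  using mat_inv_unique(2)[OF mat_inv(1)[OF A] A(1) mat_inv(3)[OF A]] .

lemma mat_inv_mat_inv:
  assumes A: "A \<in> carrier_mat n n" "det A \<noteq> 0"
  shows "mat_inv (mat_inv A) = A"
  using mat_inv_unique(1)[OF mat_inv(1)[OF A] A(1) mat_inv(3)[OF A]] .

lemma det_lower:
  assumes "A \<in> carrier_mat n n" "lower_triangular A"
  shows "det A = (\<Prod>i<n. A $$ (i, i))"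
proof -
  have "det A = prod_list (diag_mat A)"
    using assms by (intro det_lower_triangular[of n]) (auto simp: lower_triangular_def)
  then show ?thesis using assms by (simp add: prod_list_diag_prod lessThan_atLeast0)
qed

lemma det_lower_pos:
  assumes "A \<in> carrier_mat n n" "lower_triangular A" "pos_diag A"
  shows "det A > 0"
  using assms by (auto simp: det_lower[of _ n] pos_diag_def intro!: prod_pos)

lemma quadratic_form_eq_norm:
  fixes B :: "real mat"
  assumes B: "B \<in> carrier_mat r q" and v: "v \<in> carrier_vec q"
  shows "scalar_prod v ((transpose_mat B * B) *\<^sub>v v) = scalar_prod (B *\<^sub>v v) (B *\<^sub>v v)"
proof -
  have "(transpose_mat B * B) *\<^sub>v v = transpose_mat B *\<^sub>v (B *\<^sub>v v)"
    using assms by (intro assoc_mult_mat_vec[of _ q r _ q]) auto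
  then show ?thesis
    using transpose_vec_mult_scalar[of "B" r q v "B *\<^sub>v v"] assms
    by (metis comm_scalar_prod mult_mat_vec_carrier transpose_carrier_mat)
qed

text \<open>The quadratic form at \<open>v\<close> is the squared norm of \<open>B v\<close>. The
  matrix \<open>B\<close> may be rectangular, as it is for the scatter matrix of the data.\<close>

lemma pos_def_gram:
  fixes B :: "real mat"
  assumes B: "B \<in> carrier_mat r q" and inj: "\<And>v. v \<in> carrier_vec q \<Longrightarrow> B *\<^sub>v v = 0\<^sub>v r \<Longrightarrow> v = 0\<^sub>v q"
  shows "transpose_mat B * B \<in> pos_def_mats q"
  unfolding pos_def_mats_def
proof (intro CollectI conjI ballI impI)
  show "transpose_mat B * B \<in> carrier_mat q q" using B by auto
  show "transpose_mat (transpose_mat B * B) = transpose_mat B * B"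
    using B by (subst transpose_mult[of _ q r _ q]) auto
  fix v :: "real Matrix.vec" assume v: "v \<in> carrier_vec q" "v \<noteq> 0\<^sub>v q"
  have "B *\<^sub>v v \<noteq> 0\<^sub>v r" using inj v by auto
  then have "scalar_prod (B *\<^sub>v v) (B *\<^sub>v v) > 0"
  proof -
    let ?w = "B *\<^sub>v v"
    have w: "?w \<in> carrier_vec r" using B v by auto
    with \<open>?w \<noteq> 0\<^sub>v r\<close> obtain i where "i < r" "vec_index ?w i \<noteq> 0"
      by (metis eq_vecI carrier_vecD index_zero_vec)
    then have "0 < (\<Sum>i<r. vec_index ?w i * vec_index ?w i)"
      by (intro sum_pos2[of _ i]) (auto simp: not_le zero_less_mult_iff)
    then show ?thesis using w by (simp only: scalar_prod_def lessThan_atLeast0 carrier_vecD)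
  qed
  then show "scalar_prod v ((transpose_mat B * B) *\<^sub>v v) > 0"
    using quadratic_form_eq_norm[OF B v(1)] by simp
qed

lemma nonsingular_mult_vec:
  fixes A :: "real mat"
  assumes A: "A \<in> carrier_mat n n" "det A \<noteq> 0" and v: "v \<in> carrier_vec n" "A *\<^sub>v v = 0\<^sub>v n"
  shows "v = 0\<^sub>v n"
proof -
  have "v = (mat_inv A * A) *\<^sub>v v" using mat_inv[OF A] v by simp
  also have "\<dots> = mat_inv A *\<^sub>v (A *\<^sub>v v)" using mat_inv[OF A] A v by (intro assoc_mult_mat_vec) auto
  also have "\<dots> = 0\<^sub>v n" using mat_inv[OF A] v by (auto intro!: eq_vecI)
  finally show ?thesis .
qed

lemma pos_def_det:
  assumes "S \<in> pos_def_mats q"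
  shows "det S \<noteq> 0"
proof
  assume "det S = 0"
  then obtain v where "v \<in> carrier_vec q" "v \<noteq> 0\<^sub>v q" "S *\<^sub>v v = 0\<^sub>v q"
    using det_0_iff_vec_prod_zero_field[of S q] assms by (auto simp: pos_def_mats_def)
  then show False using assms by (auto simp: pos_def_mats_def)
qed

section \<open>Cholesky decomposition\<close>

abbreviation low :: "nat \<Rightarrow> (nat \<times> nat) set" where
  "low q \<equiv> {(i, j). j \<le> i \<and> i < q}"

definition low_mat :: "nat \<Rightarrow> (nat \<times> nat \<Rightarrow> real) \<Rightarrow> real mat" where
  "low_mat q x = mat q q (\<lambda>(i, j). if j \<le> i then x (i, j) else 0)"

definition low_coords :: "nat \<Rightarrow> real mat \<Rightarrow> nat \<times> nat \<Rightarrow> real" where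
  "low_coords q A = (\<lambda>ij\<in>low q. A $$ ij)"

lemma finite_low: "finite (low q)"
  by (rule finite_subset[of _ "{..<q} \<times> {..<q}"]) auto

lemma low_mat_carrier[simp]: "low_mat q x \<in> carrier_mat q q" "dim_row (low_mat q x) = q" "dim_col (low_mat q x) = q"
  by (auto simp: low_mat_def)

lemma low_mat_index[simp]: "i < q \<Longrightarrow> j < q \<Longrightarrow> low_mat q x $$ (i, j) = (if j \<le> i then x (i, j) else 0)"
  by (simp add: low_mat_def)

lemma lower_triangular_low_mat[simp]: "lower_triangular (low_mat q x)"
  by (simp add: lower_triangular_def)

lemma pos_diag_low_mat: "pos_diag (low_mat q x) \<longleftrightarrow> (\<forall>i<q. x (i, i) > 0)"
  by (simp add: pos_diag_def)

lemma low_mat_low_coords: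
  "A \<in> carrier_mat q q \<Longrightarrow> lower_triangular A \<Longrightarrow> low_mat q (low_coords q A) = A"
  by (intro eq_matI) (auto simp: low_coords_def lower_triangular_def)

lemma low_mat_cong: "(\<And>i j. j \<le> i \<Longrightarrow> i < q \<Longrightarrow> x (i, j) = y (i, j)) \<Longrightarrow> low_mat q x = low_mat q y"
  by (intro eq_matI) auto

text \<open>The Cholesky recursion as a total function of the coordinates, meaningless but defined
  where a pivot is not positive. Being explicit, it lets measurability and the dependence on earlier
  entries be proved by induction. Every call with \<open>j \<ge> i\<close> returns the diagonal
  entry of row \<open>i\<close>.\<close>

function (sequential) chol :: "(nat \<times> nat \<Rightarrow> real) \<Rightarrow> nat \<Rightarrow> nat \<Rightarrow> real" where
  "chol x i j = (if j < i then (x (i, j) - (\<Sum>l<j. chol x i l * chol x j l)) / chol x j j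
     else sqrt (x (i, i) - (\<Sum>l<i. (chol x i l)\<^sup>2)))"
  by pat_completeness auto
termination
  by (relation "measures [\<lambda>(x, i, j). i, \<lambda>(x, i, j). j]") auto

declare chol.simps[simp del]

text \<open>When the earlier pivots are positive, this is the Schur complement of the leading
  \<open>i\<close> by \<open>i\<close> block at position \<open>(i, i)\<close>, that is, the squared
  diagonal entry before the root is taken.\<close>

definition pivot :: "(nat \<times> nat \<Rightarrow> real) \<Rightarrow> nat \<Rightarrow> real" where
  "pivot x i = x (i, i) - (\<Sum>l<i. (chol x i l)\<^sup>2)"

lemma chol_diag: "chol x i i = sqrt (pivot x i)"
  by (subst chol.simps) (simp add: pivot_def)

lemma chol_below: "j < i \<Longrightarrow> chol x i j = (x (i, j) - (\<Sum>l<j. chol x i l * chol x j l)) / chol x j j"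
  by (subst chol.simps) simp

lemma low_mat_gram_index:
  assumes "i < q" "j \<le> i"
  shows "(low_mat q y * transpose_mat (low_mat q y)) $$ (i, j) = (\<Sum>l\<le>j. y (i, l) * y (j, l))"
proof -
  have "(low_mat q y * transpose_mat (low_mat q y)) $$ (i, j) =
     (\<Sum>l=0..<q. (if l \<le> i then y (i, l) else 0) * (if l \<le> j then y (j, l) else 0))"
    using assms by (auto simp: scalar_prod_def)
  also have "\<dots> = (\<Sum>l\<le>j. y (i, l) * y (j, l))"
    using assms by (intro sum.mono_neutral_cong_right) auto
  finally show ?thesis .
qed

lemma chol_gram:
  assumes "j \<le> i" "pivot x j > 0"
  shows "(\<Sum>l\<le>j. chol x i l * chol x j l) = x (i, j)"
proof (cases "j < i")
  case True
  then show ?thesis using assms chol_below[OF True, of x]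
    by (simp add: chol_diag lessThan_Suc_atMost[symmetric] field_simps)
next
  case False
  then have "j = i" using assms by simp
  then show ?thesis using assms
    by (simp add: chol_diag lessThan_Suc_atMost[symmetric] pivot_def power2_eq_square)
qed

lemma chol_mult_transpose:
  assumes "\<And>i. i < q \<Longrightarrow> pivot x i > 0"
  shows "low_mat q (\<lambda>(i, j). chol x i j) * transpose_mat (low_mat q (\<lambda>(i, j). chol x i j)) = sym_of_lower q x"
proof (rule eq_matI)
  let ?V = "low_mat q (\<lambda>(i, j). chol x i j)"
  have sym: "(?V * transpose_mat ?V) $$ (i, j) = (?V * transpose_mat ?V) $$ (j, i)" if "i < q" "j < q" for i j
    using that by (auto simp: comm_scalar_prod[of _ q])
  fix i j assume "i < dim_row (sym_of_lower q x)" "j < dim_col (sym_of_lower q x)"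
  then have ij: "i < q" "j < q" by (auto simp: sym_of_lower_def)
  show "(?V * transpose_mat ?V) $$ (i, j) = sym_of_lower q x $$ (i, j)"
  proof (cases "j \<le> i")
    case True
    then show ?thesis using ij assms chol_gram[OF True] low_mat_gram_index[OF ij(1) True]
      by (simp add: sym_of_lower_def)
  next
    case False
    then have "i \<le> j" by simp
    then show ?thesis
      using ij assms chol_gram[of i j] low_mat_gram_index[OF ij(2), of i] sym[OF ij] False
      by (simp add: sym_of_lower_def)
  qed
qed (auto simp: sym_of_lower_def)

text \<open>Read in row-major order, the equations of the factorization determine each entry from
  earlier ones; positivity of the diagonal permits the division and selects the root.\<close>

lemma chol_unique:
  assumes pos: "\<And>i. i < q \<Longrightarrow> y (i, i) > 0"
    and eq: "low_mat q y * transpose_mat (low_mat q y) = sym_of_lower q x"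
    and "i < q" "j \<le> i"
  shows "y (i, j) = chol x i j"
proof -
  have g: "(\<Sum>l<j. y (i, l) * y (j, l)) + y (i, j) * y (j, j) = x (i, j)" if "i < q" "j \<le> i" for i j
    using low_mat_gram_index[OF that, of y] that
    by (simp add: eq sym_of_lower_def lessThan_Suc_atMost[symmetric])
  show ?thesis using assms(3,4)
  proof (induction i arbitrary: j rule: less_induct)
    case (less i)
    note outer = less.IH and i_less = less.prems(1)
    show ?case using less.prems(2)
    proof (induction j rule: less_induct)
      case (less j)
      show ?case
      proof (cases "j < i")
        case True
        have s: "(\<Sum>l<j. chol x i l * chol x j l) = (\<Sum>l<j. y (i, l) * y (j, l))"
          using less outer i_less True by (intro sum.cong arg_cong2[where f="(*)"]) auto
        have jj: "chol x j j = y (j, j)" using outer i_less True by auto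
        have "(\<Sum>l<j. y (i, l) * y (j, l)) + y (i, j) * y (j, j) = x (i, j)"
          using i_less True by (intro g) auto
        then have "x (i, j) - (\<Sum>l<j. y (i, l) * y (j, l)) = y (i, j) * y (j, j)" by simp
        moreover have "y (j, j) > 0" using i_less True by (intro pos) auto
        ultimately show ?thesis by (simp only: chol_below[OF True] s jj) simp
      next
        case False
        have s: "(\<Sum>l<i. (chol x i l)\<^sup>2) = (\<Sum>l<i. (y (i, l))\<^sup>2)"
          using less False by (intro sum.cong) auto
        have "pivot x i = (y (i, i))\<^sup>2"
          using g[of i i] i_less unfolding pivot_def s by (simp add: power2_eq_square)
        then show ?thesis using pos[of i] less.prems i_less False by (simp add: chol_diag)
      qed
    qed
  qed
qed

text \<open>
  Completing the square: the \<open>i\<close>-th pivot is the value of the quadratic form at the solution \<open>v\<close>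
  of \<open>L\<^sup>T v = e\<^sub>i\<close>, where \<open>L\<close> is the unit lower triangular factor built from the first \<open>i\<close> rows.
\<close>
lemma pos_def_imp_pivot_pos:
  assumes pd: "sym_of_lower q x \<in> pos_def_mats q" and "i < q"
  shows "pivot x i > 0"
  using assms(2)
proof (induction i rule: less_induct)
  case (less i)
  \<comment> \<open>The rows above \<open>i\<close> are Cholesky rows, row \<open>i\<close> carries
    1 where the root of the pivot would stand, and the rest is the identity. On indices up to
    \<open>i\<close> the matrix is then L D L^T with \<open>D\<close> the identity except for the
    pivot at \<open>i\<close>, whose sign is still unknown.\<close>
  define l where "l = (\<lambda>(a, b). if a < i then chol x a b
     else if a = i then (if b < i then chol x i b else 1) else if a = b then 1 else (0::real))"
  define L where "L = low_mat q l"
  let ?S = "sym_of_lower q x"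
  have "det L \<noteq> 0"
  proof -
    have "l (a, a) > 0" if "a < q" for a
      using less.IH that less.prems by (auto simp: l_def chol_diag)
    then show ?thesis using det_lower_pos[of L q] by (simp add: L_def pos_diag_low_mat)
  qed
  then have d: "det (transpose_mat L) \<noteq> 0" using det_transpose[of L q] by (simp add: L_def)
  define v where "v = mat_inv (transpose_mat L) *\<^sub>v unit_vec q i"
  have LT: "transpose_mat L \<in> carrier_mat q q" by (simp add: L_def)
  have v: "v \<in> carrier_vec q" using mat_inv[OF LT d] by (auto simp: v_def)
  have "transpose_mat L *\<^sub>v v = (transpose_mat L * mat_inv (transpose_mat L)) *\<^sub>v unit_vec q i"
    unfolding v_def using mat_inv[OF LT d] LT by (intro assoc_mult_mat_vec[symmetric]) auto
  then have Lv: "transpose_mat L *\<^sub>v v = unit_vec q i" using mat_inv[OF LT d] by simp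
  have Lv': "(\<Sum>a<q. L $$ (a, b) * vec_index v a) = (if b = i then 1 else 0)" if "b < q" for b
  proof -
    have "vec_index (transpose_mat L *\<^sub>v v) b = (\<Sum>a<q. L $$ (a, b) * vec_index v a)"
      using that v by (simp add: L_def scalar_prod_def lessThan_atLeast0)
    then show ?thesis using that Lv less.prems by simp
  qed
  \<comment> \<open>Beyond \<open>i\<close> the columns of \<open>L\<close> are unit vectors, so
    \<open>v\<close> vanishes there and the later rows and columns of the matrix do not enter the
    quadratic form.\<close>
  have v0: "vec_index v b = 0" if "b < q" "b > i" for b
  proof -
    have "(\<Sum>a<q. L $$ (a, b) * vec_index v a) = (\<Sum>a<q. if a = b then vec_index v a else 0)"
      using that by (intro sum.cong) (auto simp: L_def l_def)
    then show ?thesis using Lv'[of b] that by simp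
  qed
  have S: "?S $$ (a, b) = (\<Sum>m<q. (if m = i then pivot x i else 1) * L $$ (a, m) * L $$ (b, m))"
    if "a \<le> i" "b \<le> a" for a b
  proof -
    have aq: "a < q" "b < q" using that less.prems by auto
    have "(\<Sum>m<q. (if m = i then pivot x i else 1) * L $$ (a, m) * L $$ (b, m))
       = (\<Sum>m\<le>b. (if m = i then pivot x i else 1) * l (a, m) * l (b, m))"
      using that aq by (intro sum.mono_neutral_cong_right) (auto simp: L_def)
    also have "\<dots> = x (a, b)"
    proof (cases "b = i")
      case True
      then show ?thesis using that
        by (simp add: l_def lessThan_Suc_atMost[symmetric] pivot_def power2_eq_square)
    next
      case False
      then have "b < i" using that by auto
      then have "(\<Sum>m\<le>b. (if m = i then pivot x i else 1) * l (a, m) * l (b, m)) = (\<Sum>m\<le>b. chol x a m * chol x b m)"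
        using that by (intro sum.cong) (auto simp: l_def)
      also have "\<dots> = x (a, b)" using \<open>b < i\<close> that aq less by (intro chol_gram) auto
      finally show ?thesis .
    qed
    finally show ?thesis using that aq by (simp add: sym_of_lower_def)
  qed
  have S': "?S $$ (a, b) = (\<Sum>m<q. (if m = i then pivot x i else 1) * L $$ (a, m) * L $$ (b, m))"
    if "a \<le> i" "b \<le> i" for a b
  proof (cases "b \<le> a")
    case True then show ?thesis using S that by auto
  next
    case False
    then have "a \<le> b" by simp
    moreover have "?S $$ (a, b) = ?S $$ (b, a)" using that less.prems False by (simp add: sym_of_lower_def)
    ultimately show ?thesis using S[of b a] that by (simp add: mult_ac)
  qed
  have "scalar_prod v (?S *\<^sub>v v) = (\<Sum>a<q. vec_index v a * (\<Sum>b<q. ?S $$ (a, b) * vec_index v b))"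
    using v by (simp add: scalar_prod_def sym_of_lower_def lessThan_atLeast0)
  also have "\<dots> = (\<Sum>a<q. \<Sum>b<q. \<Sum>m<q. (if m = i then pivot x i else 1) * ((L $$ (a, m) * vec_index v a) * (L $$ (b, m) * vec_index v b)))"
    unfolding sum_distrib_left
  proof (intro sum.cong refl)
    fix a b assume ab: "a \<in> {..<q}" "b \<in> {..<q}"
    show "vec_index v a * (?S $$ (a, b) * vec_index v b) = (\<Sum>m<q. (if m = i then pivot x i else 1) * ((L $$ (a, m) * vec_index v a) * (L $$ (b, m) * vec_index v b)))"
    proof (cases "a \<le> i \<and> b \<le> i")
      case True
      then show ?thesis by (simp add: S' sum_distrib_left sum_distrib_right mult_ac)
    next
      case False
      then have "vec_index v a = 0 \<or> vec_index v b = 0" using v0 ab by auto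
      then show ?thesis by auto
    qed
  qed
  also have "\<dots> = (\<Sum>m<q. (if m = i then pivot x i else 1) * ((\<Sum>a<q. L $$ (a, m) * vec_index v a) * (\<Sum>b<q. L $$ (b, m) * vec_index v b)))"
  proof -
    have swap: "(\<Sum>a<q. \<Sum>b<q. \<Sum>m<q. f a b m) = (\<Sum>m<q. \<Sum>a<q. \<Sum>b<q. f a b m)" for f :: "nat \<Rightarrow> nat \<Rightarrow> nat \<Rightarrow> real"
    proof -
      have "(\<Sum>a<q. \<Sum>b<q. \<Sum>m<q. f a b m) = (\<Sum>a<q. \<Sum>m<q. \<Sum>b<q. f a b m)"
        by (intro sum.cong refl sum.swap)
      also have "\<dots> = (\<Sum>m<q. \<Sum>a<q. \<Sum>b<q. f a b m)" by (rule sum.swap)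
      finally show ?thesis .
    qed
    show ?thesis by (subst swap) (simp only: sum_product, simp only: sum_distrib_left)
  qed
  also have "\<dots> = (\<Sum>m<q. if m = i then pivot x i else 0)"
    by (intro sum.cong) (auto simp: Lv')
  also have "\<dots> = pivot x i" using less.prems by simp
  finally have "scalar_prod v (?S *\<^sub>v v) = pivot x i" .
  moreover have "v \<noteq> 0\<^sub>v q"
  proof
    assume "v = 0\<^sub>v q"
    then have "(\<Sum>a<q. L $$ (a, i) * vec_index v a) = 0" by simp
    then show False using Lv'[of i] less.prems by simp
  qed
  ultimately show ?case using pd v by (auto simp: pos_def_mats_def)
qed

lemma low_mat_gram_pos_def:
  assumes "\<And>i. i < q \<Longrightarrow> y (i, i) > 0"
  shows "low_mat q y * transpose_mat (low_mat q y) \<in> pos_def_mats q"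
proof -
  have "det (low_mat q y) \<noteq> 0" using det_lower_pos[of "low_mat q y" q] assms by (simp add: pos_diag_low_mat)
  then have "det (transpose_mat (low_mat q y)) \<noteq> 0" using det_transpose[of "low_mat q y" q] by simp
  then have "transpose_mat (transpose_mat (low_mat q y)) * transpose_mat (low_mat q y) \<in> pos_def_mats q"
    by (intro pos_def_gram[where r=q]) (auto intro: nonsingular_mult_vec[where A = "transpose_mat (low_mat q y)"])
  then show ?thesis by simp
qed

text \<open>Describes positive definiteness by finitely many measurable inequalities, which are
  exactly the conditions \<open>D\<close> of the Cholesky substitution.\<close>

lemma pos_def_iff_pivot:
  "sym_of_lower q x \<in> pos_def_mats q \<longleftrightarrow> (\<forall>i<q. pivot x i > 0)"
proof
  assume "\<forall>i<q. pivot x i > 0"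
  then show "sym_of_lower q x \<in> pos_def_mats q"
    using low_mat_gram_pos_def[of q "\<lambda>(i, j). chol x i j"] chol_mult_transpose[of q x]
    by (simp add: chol_diag)
qed (auto intro: pos_def_imp_pivot_pos)

lemma sym_of_lower_low_coords:
  assumes "S \<in> carrier_mat q q" "transpose_mat S = S"
  shows "sym_of_lower q (low_coords q S) = S"
proof (rule eq_matI)
  fix i j assume "i < dim_row S" "j < dim_col S"
  moreover have "S $$ (j, i) = S $$ (i, j)" if "i < q" "j < q" for i j
    using assms that by (metis index_transpose_mat(1) carrier_matD)
  ultimately show "sym_of_lower q (low_coords q S) $$ (i, j) = S $$ (i, j)"
    using assms by (auto simp: sym_of_lower_def low_coords_def)
qed (use assms in \<open>auto simp: sym_of_lower_def\<close>)

lemma lower_chol_unique: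
  assumes "V \<in> carrier_mat q q" "lower_triangular V" "pos_diag V"
    and "V' \<in> carrier_mat q q" "lower_triangular V'" "pos_diag V'"
    and eq: "V * transpose_mat V = V' * transpose_mat V'"
  shows "V = V'"
proof -
  let ?S = "V * transpose_mat V"
  define x where "x = low_coords q ?S"
  have S: "?S \<in> carrier_mat q q" "transpose_mat ?S = ?S" using assms by (auto simp: transpose_mult[of _ q q])
  have "W = low_mat q (\<lambda>(i, j). chol x i j)"
    if W: "W \<in> carrier_mat q q" "lower_triangular W" "pos_diag W" "W * transpose_mat W = ?S" for W
  proof -
    define y where "y = low_coords q W"
    have Wy: "low_mat q y = W" unfolding y_def by (rule low_mat_low_coords) (use W in auto)
    have "y (i, j) = chol x i j" if "j \<le> i" "i < q" for i j
    proof (rule chol_unique[of q])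
      show "y (i, i) > 0" if "i < q" for i using W that Wy by (metis pos_diag_low_mat)
      show "low_mat q y * transpose_mat (low_mat q y) = sym_of_lower q x"
        using W Wy S by (simp add: x_def sym_of_lower_low_coords)
    qed (use that in auto)
    then have "low_mat q y = low_mat q (\<lambda>(i, j). chol x i j)" by (intro low_mat_cong) auto
    then show ?thesis using Wy by simp
  qed
  from this[of V] this[of V'] show ?thesis using assms by simp
qed

lemma lower_chol_eqI:
  assumes "V \<in> carrier_mat q q" "lower_triangular V" "pos_diag V" "V * transpose_mat V = S"
  shows "lower_chol S = V"
  unfolding lower_chol_def
proof (rule the_equality)
  have q: "dim_row S = q" using assms by auto
  show "V \<in> carrier_mat (dim_row S) (dim_row S) \<and> lower_triangular V \<and> pos_diag V \<and> V * transpose_mat V = S"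
    using assms q by simp
  fix W assume "W \<in> carrier_mat (dim_row S) (dim_row S) \<and> lower_triangular W \<and> pos_diag W \<and> W * transpose_mat W = S"
  then show "W = V" using assms q by (intro lower_chol_unique[of W q V]) auto
qed

lemma lower_chol:
  assumes "S \<in> pos_def_mats q"
  shows "lower_chol S = low_mat q (\<lambda>(i, j). chol (low_coords q S) i j)"
    and "lower_chol S \<in> carrier_mat q q" "lower_triangular (lower_chol S)" "pos_diag (lower_chol S)"
    and "lower_chol S * transpose_mat (lower_chol S) = S"
proof -
  let ?x = "low_coords q S" and ?V = "low_mat q (\<lambda>(i, j). chol (low_coords q S) i j)"
  have S: "sym_of_lower q ?x = S" using assms by (auto simp: pos_def_mats_def intro!: sym_of_lower_low_coords)
  then have p: "\<And>i. i < q \<Longrightarrow> pivot ?x i > 0" using pos_def_iff_pivot[of q ?x] assms by simp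
  then have V: "?V \<in> carrier_mat q q" "lower_triangular ?V" "pos_diag ?V" "?V * transpose_mat ?V = S"
    using chol_mult_transpose[of q ?x] S by (auto simp: pos_diag_low_mat chol_diag)
  then show "lower_chol S = ?V" by (rule lower_chol_eqI)
  with V show "lower_chol S \<in> carrier_mat q q" "lower_triangular (lower_chol S)" "pos_diag (lower_chol S)"
    "lower_chol S * transpose_mat (lower_chol S) = S" by auto
qed

text \<open>Forward substitution in \<open>R * L = 1\<close>: going down a column, the entries above
  the diagonal vanish one after the other, and the diagonal equation becomes
  \<open>R_ii L_ii = 1\<close>.\<close>

lemma lower_triangular_mat_inv:
  assumes R: "R \<in> carrier_mat q q" "lower_triangular R" "pos_diag R"
  shows "lower_triangular (mat_inv R)" "pos_diag (mat_inv R)"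
proof -
  have dR: "det R \<noteq> 0" using det_lower_pos[OF R] by simp
  define L where "L = mat_inv R"
  note L = mat_inv[OF R(1) dR, folded L_def]
  have RL: "(\<Sum>l\<le>i. R $$ (i, l) * L $$ (l, j)) = (if i = j then 1 else 0)" if "i < q" "j < q" for i j
  proof -
    have "(\<Sum>l\<le>i. R $$ (i, l) * L $$ (l, j)) = (\<Sum>l=0..<q. R $$ (i, l) * L $$ (l, j))"
      using that R by (intro sum.mono_neutral_cong_left) (auto simp: lower_triangular_def)
    also have "\<dots> = (R * L) $$ (i, j)" using that R L(1) by (simp add: scalar_prod_def)
    finally show ?thesis using that L by simp
  qed
  have Rpos: "R $$ (i, i) > 0" if "i < q" for i using R that by (auto simp: pos_diag_def)
  have up: "L $$ (i, j) = 0" if "i < j" "j < q" for i j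
    using that(1)
  proof (induction i rule: less_induct)
    case (less i)
    have "(\<Sum>l<i. R $$ (i, l) * L $$ (l, j)) = 0"
      using less by (intro sum.neutral) auto
    then show ?case using RL[of i j] Rpos[of i] less.prems that
      by (auto simp: lessThan_Suc_atMost[symmetric])
  qed
  show "lower_triangular (mat_inv R)" using up L by (auto simp: lower_triangular_def L_def)
  have "L $$ (i, i) > 0" if "i < q" for i
  proof -
    have "(\<Sum>l<i. R $$ (i, l) * L $$ (l, i)) = 0"
      using up that by (intro sum.neutral) auto
    then have "R $$ (i, i) * L $$ (i, i) = 1" using RL[of i i] that by (auto simp: lessThan_Suc_atMost[symmetric])
    then show ?thesis using Rpos[OF that] zero_less_mult_pos[of "R $$ (i, i)" "L $$ (i, i)"] by simp
  qed
  then show "pos_diag (mat_inv R)" using L by (auto simp: pos_diag_def L_def)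
qed

text \<open>If S = R R^T, then S^(-1) = R^(-T) R^(-1), and R^(-T) is upper triangular with positive
  diagonal. Uniqueness is inherited from the lower factorization: an upper factor \<open>W\<close>
  of the inverse yields the lower factor W^(-T) of \<open>S\<close>.\<close>

lemma upper_chol_mat_inv:
  assumes S: "S \<in> pos_def_mats q"
  shows "upper_chol (mat_inv S) = mat_inv (transpose_mat (lower_chol S))"
proof -
  define R where "R = lower_chol S"
  note R = lower_chol[OF S, folded R_def]
  have dR: "det R \<noteq> 0" using det_lower_pos[OF R(2-4)] by simp
  have RT: "transpose_mat R \<in> carrier_mat q q" "det (transpose_mat R) \<noteq> 0"
    using R dR det_transpose[of R q] by auto
  define U where "U = mat_inv (transpose_mat R)"
  note U = mat_inv[OF RT, folded U_def]
  have UT: "transpose_mat U = mat_inv R"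
    using mat_inv_transpose[OF R(2) dR] mat_inv[OF R(2) dR] by (simp add: U_def)
  have Sc: "S \<in> carrier_mat q q" "det S \<noteq> 0" using S pos_def_det by (auto simp: pos_def_mats_def)
  note Si = mat_inv[OF Sc]
  have q: "dim_row (mat_inv S) = q" using Si by auto
  have SR: "mat_inv S = mat_inv (transpose_mat R) * mat_inv R"
    using mat_inv_mult[OF R(2) dR RT] R by simp
  have UU: "U * transpose_mat U = mat_inv S"
    using SR UT by (simp add: U_def)
  note RL = lower_triangular_mat_inv[OF R(2-4), folded UT]
  have tri: "upper_triangular A \<longleftrightarrow> lower_triangular (transpose_mat A)" if "A \<in> carrier_mat q q" for A
    using that by (auto simp: lower_triangular_def upper_triangular_def)
  have dia: "pos_diag A \<longleftrightarrow> pos_diag (transpose_mat A)" if "A \<in> carrier_mat q q" for A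
    using that by (auto simp: pos_diag_def)
  show ?thesis
    unfolding upper_chol_def q R_def[symmetric] U_def[symmetric]
  proof (rule the_equality)
    show "U \<in> carrier_mat q q \<and> upper_triangular U \<and> pos_diag U \<and> U * transpose_mat U = mat_inv S"
      using U RL UU tri[of U] dia[of U] by auto
    fix W assume W: "W \<in> carrier_mat q q \<and> upper_triangular W \<and> pos_diag W \<and> W * transpose_mat W = mat_inv S"
    define T where "T = transpose_mat W"
    have T: "T \<in> carrier_mat q q" "lower_triangular T" "pos_diag T" and TW: "transpose_mat T = W"
      using W tri[of W] dia[of W] by (auto simp: T_def)
    have dT: "det T \<noteq> 0" using det_lower_pos[OF T] by simp
    have dW: "det W \<noteq> 0" using det_transpose[OF T(1)] dT TW by simp
    note Ti = mat_inv[OF T(1) dT] lower_triangular_mat_inv[OF T]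
    have "mat_inv T * transpose_mat (mat_inv T) = S"
    proof -
      have "transpose_mat (mat_inv T) = mat_inv W" using mat_inv_transpose[OF T(1) dT] TW by simp
      moreover have "mat_inv (W * T) = mat_inv T * mat_inv W" by (rule mat_inv_mult) (use W dW T dT in auto)
      moreover have "mat_inv (W * T) = S" using W mat_inv_mat_inv[OF Sc] by (simp add: T_def)
      ultimately show ?thesis by simp
    qed
    then have "R = mat_inv T" unfolding R_def by (rule lower_chol_eqI[OF Ti(1,4,5)])
    then have "mat_inv R = T" using mat_inv_mat_inv[OF T(1) dT] by simp
    with UT have "transpose_mat U = T" by simp
    then have "transpose_mat (transpose_mat U) = W" using TW by simp
    then show "W = U" by simp
  qed
qed

section \<open>Lebesgue measure on lower triangular matrices\<close>

definition low_pos :: "nat \<Rightarrow> (nat \<times> nat \<Rightarrow> real) set" where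
  "low_pos q = {x. \<forall>i<q. x (i, i) > 0}"

abbreviation coord_lebesgue :: "nat \<Rightarrow> (nat \<times> nat \<Rightarrow> real) measure" where
  "coord_lebesgue q \<equiv> (\<Pi>\<^sub>M ij \<in> low q. lborel)"

text \<open>A density on the full coordinate space instead of a restricted space, so that
  integration over product measures applies without change.\<close>

definition low_lebesgue :: "nat \<Rightarrow> (nat \<times> nat \<Rightarrow> real) measure" where
  "low_lebesgue q = density (coord_lebesgue q) (indicator (low_pos q))"

text \<open>The range of a single coordinate of \<open>low_pos\<close>, in the form in which a
  triangular substitution wants its \<open>E\<close>.\<close>

definition low_dom :: "nat \<times> nat \<Rightarrow> real set" where
  "low_dom = (\<lambda>(i, j). if i = j then {0<..} else UNIV)"

lemma low_dom_borel[measurable]: "low_dom ij \<in> sets borel"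
  by (auto simp: low_dom_def split: prod.split)

lemma prod_indicator_low_dom:
  "(\<Prod>ij\<in>low q. indicator (low_dom ij) (x ij)) = (indicator (low_pos q) x :: ennreal)"
proof (cases "x \<in> low_pos q")
  case True
  then show ?thesis by (auto simp: low_pos_def low_dom_def intro!: prod.neutral)
next
  case False
  then obtain i where "i < q" "\<not> x (i, i) > 0" by (auto simp: low_pos_def)
  then have "\<exists>ij\<in>low q. (indicator (low_dom ij) (x ij) :: ennreal) = 0"
    by (intro bexI[of _ "(i, i)"]) (auto simp: low_dom_def)
  then show ?thesis using False finite_low by (auto simp: prod_zero_iff)
qed

lemma measurable_coord:
  "ij \<in> low q \<Longrightarrow> (\<lambda>x. x ij) \<in> borel_measurable (coord_lebesgue q)"
  using measurable_component_singleton[of ij "low q" "\<lambda>_. lborel :: real measure"] by simp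

lemma low_pos_sets[measurable]: "{x \<in> space (coord_lebesgue q). x \<in> low_pos q} \<in> sets (coord_lebesgue q)"
  unfolding low_pos_def mem_Collect_eq
proof -
  have "{x \<in> space (coord_lebesgue q). \<forall>i\<in>{..<q}. x (i, i) > 0} \<in> sets (coord_lebesgue q)"
    by (intro sets.sets_Collect_finite_All borel_measurable_less measurable_coord) auto
  then show "{x \<in> space (coord_lebesgue q). \<forall>i<q. x (i, i) > 0} \<in> sets (coord_lebesgue q)" by simp
qed

lemma indicator_low_pos_measurable[measurable]:
  "(indicator (low_pos q) :: _ \<Rightarrow> ennreal) \<in> borel_measurable (coord_lebesgue q)"
  by (subst borel_measurable_indicator_iff) (use low_pos_sets[of q] in \<open>simp add: Int_def conj_commute\<close>)

lemma nn_integral_low_lebesgue: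
  assumes "f \<in> borel_measurable (coord_lebesgue q)"
  shows "(\<integral>\<^sup>+x. f x \<partial>low_lebesgue q) = (\<integral>\<^sup>+x. f x * indicator (low_pos q) x \<partial>coord_lebesgue q)"
  unfolding low_lebesgue_def
  by (subst nn_integral_density) (use assms in \<open>auto simp: mult.commute\<close>)

lemma sets_low_lebesgue[measurable_cong]: "sets (low_lebesgue q) = sets (coord_lebesgue q)"
  by (simp add: low_lebesgue_def)

lemma space_low_lebesgue: "space (low_lebesgue q) = space (coord_lebesgue q)"
  by (simp add: low_lebesgue_def)

lemma AE_low_lebesgue: "AE x in low_lebesgue q. x \<in> low_pos q"
  unfolding low_lebesgue_def by (subst AE_density) (auto intro!: AE_I2 split: split_indicator_asm)

lemma nn_integral_low_lebesgue_cong: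
  assumes "\<And>x. x \<in> low_pos q \<Longrightarrow> x \<in> space (coord_lebesgue q) \<Longrightarrow> f x = g x"
  shows "(\<integral>\<^sup>+x. f x \<partial>low_lebesgue q) = (\<integral>\<^sup>+x. g x \<partial>low_lebesgue q)"
proof (rule nn_integral_cong_AE)
  show "AE x in low_lebesgue q. f x = g x"
    using AE_low_lebesgue[of q] AE_space by eventually_elim (simp add: assms space_low_lebesgue)
qed

lemma nn_integral_low_substitution:
  assumes "triangular_substitution (low q) r g J D low_dom"
    and "F \<in> borel_measurable (coord_lebesgue q)"
  shows "(\<integral>\<^sup>+x. F (\<lambda>i\<in>low q. g i x) * (\<Prod>i\<in>low q. J i x * of_bool (D i x)) \<partial>coord_lebesgue q) =
    (\<integral>\<^sup>+x. F x \<partial>low_lebesgue q)"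
  unfolding nn_integral_triangular_substitution[OF assms] nn_integral_low_lebesgue[OF assms(2)]
    prod_indicator_low_dom ..

lemma low_pos_of_bool:
  "(\<Prod>ij\<in>low q. of_bool (x ij \<in> low_dom ij)) = (indicator (low_pos q) x :: ennreal)"
  unfolding prod_indicator_low_dom[symmetric] by (simp add: indicator_def of_bool_def)

lemma rank_rows_inj: "inj_on (\<lambda>(i, j). i * q + j) (low q)"
proof (rule inj_onI, clarsimp)
  fix a b c d assume h: "b \<le> a" "a < q" "d \<le> c" "c < q" "a * q + b = c * q + d"
  then have "b < q" "d < q" by auto
  then have "(a * q + b) div q = a" "(c * q + d) div q = c" "(a * q + b) mod q = b" "(c * q + d) mod q = d" by auto
  then show "a = c \<and> b = d" using h by metis
qed

lemma rank_rows_less: "a < c \<Longrightarrow> b < q \<Longrightarrow> a * q + b < c * q + (d::nat)"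
  using mult_le_mono1[of "Suc a" c q] by simp

section \<open>The Cholesky substitution\<close>

text \<open>Makes the Cholesky map triangular for the row-major order: the recursion at
  \<open>(a, b)\<close> calls only row \<open>a\<close> to the left of \<open>b\<close> and row
  \<open>b\<close>, which comes earlier when \<open>b < a\<close>.\<close>

lemma chol_cong:
  assumes "a < q" "b \<le> a" "\<And>c d. d \<le> c \<Longrightarrow> c < q \<Longrightarrow> c * q + d \<le> a * q + b \<Longrightarrow> x (c, d) = y (c, d)"
  shows "chol x a b = chol y a b"
  using assms
proof (induction a arbitrary: b rule: less_induct)
  case (less a)
  note outer = less.IH and aq = less.prems(1)
  show ?case using less.prems(2,3)
  proof (induction b rule: less_induct)
    case (less b)
    have row: "chol x a l = chol y a l" if "l < b" for l
      using that less.prems by (intro less.IH) auto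
    have up: "chol x b l = chol y b l" if "l \<le> b" "b < a" for l
    proof (rule outer)
      fix c d assume cd: "d \<le> c" "c < q" "c * q + d \<le> b * q + l"
      have "b * q + l < a * q + b" using that aq by (intro rank_rows_less) auto
      then show "x (c, d) = y (c, d)" using cd by (intro less.prems(2)) auto
    qed (use that aq in auto)
    show ?case
    proof (cases "b < a")
      case True
      have "(\<Sum>l<b. chol x a l * chol x b l) = (\<Sum>l<b. chol y a l * chol y b l)"
        using row up True by (intro sum.cong arg_cong2[where f="(*)"]) auto
      moreover have "x (a, b) = y (a, b)" using aq less.prems by auto
      ultimately show ?thesis using up[of b] True by (simp only: chol_below[OF True])
    next
      case False
      then have ab: "a = b" using less.prems by auto
      have "(\<Sum>l<a. (chol x a l)\<^sup>2) = (\<Sum>l<a. (chol y a l)\<^sup>2)"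
        using row ab by (intro sum.cong arg_cong[where f="\<lambda>x. x\<^sup>2"]) auto
      moreover have "x (a, a) = y (a, a)" using aq less.prems ab by auto
      ultimately show ?thesis using ab by (simp only: chol_diag pivot_def)
    qed
  qed
qed

lemma pivot_cong:
  assumes "a < q" "\<And>c d. d \<le> c \<Longrightarrow> c < q \<Longrightarrow> c * q + d \<le> a * q + a \<Longrightarrow> x (c, d) = y (c, d)"
  shows "pivot x a = pivot y a"
proof -
  have "(\<Sum>l<a. (chol x a l)\<^sup>2) = (\<Sum>l<a. (chol y a l)\<^sup>2)"
    using assms by (intro sum.cong arg_cong[where f="\<lambda>x. x\<^sup>2"] chol_cong[of a q]) auto
  then show ?thesis using assms by (simp add: pivot_def)
qed

lemma chol_measurable:
  assumes "a < q" "b \<le> a"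
  shows "(\<lambda>x. chol x a b) \<in> borel_measurable (coord_lebesgue q)"
  using assms
proof (induction a arbitrary: b rule: less_induct)
  case (less a)
  note outer = less.IH and aq = less.prems(1)
  show ?case using less.prems(2)
  proof (induction b rule: less_induct)
    case (less b)
    show ?case
    proof (cases "b < a")
      case True
      have m: "(\<lambda>x. chol x a l) \<in> borel_measurable (coord_lebesgue q)" if "l < b" for l
        using that less by auto
      have m': "(\<lambda>x. chol x b l) \<in> borel_measurable (coord_lebesgue q)" if "l \<le> b" for l
        using that True outer aq by auto
      have x: "(\<lambda>x. x (a, b)) \<in> borel_measurable (coord_lebesgue q)" using aq less.prems by (intro measurable_coord) auto
      show ?thesis
        unfolding chol_below[OF True]
        by (intro borel_measurable_divide borel_measurable_diff borel_measurable_sum borel_measurable_times m m' x) auto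
    next
      case False
      then have ab: "a = b" using less.prems by auto
      have m: "(\<lambda>x. chol x b l) \<in> borel_measurable (coord_lebesgue q)" if "l < b" for l
        using that less ab by auto
      have x: "(\<lambda>x. x (b, b)) \<in> borel_measurable (coord_lebesgue q)" using aq less.prems ab by (intro measurable_coord) auto
      show ?thesis
        unfolding ab chol_diag pivot_def
        by (intro measurable_compose[OF _ borel_measurable_sqrt] borel_measurable_diff borel_measurable_sum borel_measurable_power m x) auto
    qed
  qed
qed

lemma pivot_measurable:
  assumes "a < q"
  shows "(\<lambda>x. pivot x a) \<in> borel_measurable (coord_lebesgue q)"
  unfolding pivot_def using assms
  by (intro borel_measurable_diff borel_measurable_sum borel_measurable_power measurable_coord chol_measurable) auto

text \<open>With the earlier entries fixed, an entry below the diagonal is affine in the matrix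
  entry at its position, with slope \<open>1 / chol x j j\<close>, and a diagonal entry is the root
  of a translate of it. The pivots are the only source of constraints.\<close>

lemma triangular_chol:
  "triangular_substitution (low q) (\<lambda>(i, j). i * q + j) (\<lambda>(i, j) x. chol x i j)
     (\<lambda>(i, j) x. ennreal (if j < i then 1 / chol x j j else 1 / (2 * chol x i i)))
     (\<lambda>(i, j) x. i = j \<longrightarrow> pivot x i > 0) low_dom"
proof
  show "finite (low q)" by (rule finite_low)
  show "inj_on (\<lambda>(i, j). i * q + j) (low q)" by (rule rank_rows_inj)
  fix ij :: "nat \<times> nat" assume "ij \<in> low q"
  then obtain a b where ab: "ij = (a, b)" "b \<le> a" "a < q" by auto
  {
    fix x y :: "nat \<times> nat \<Rightarrow> real"
    assume eq: "\<And>cd. cd \<in> low q \<Longrightarrow> (case cd of (i, j) \<Rightarrow> i * q + j) \<le> (case ij of (i, j) \<Rightarrow> i * q + j) \<Longrightarrow> x cd = y cd"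
    then have eq': "x (c, d) = y (c, d)" if "d \<le> c" "c < q" "c * q + d \<le> a * q + b" for c d
      using that ab by auto
    have 1: "chol x a b = chol y a b" by (rule chol_cong[OF ab(3,2)]) (rule eq')
    have 2: "chol x b b = chol y b b"
    proof (rule chol_cong[of b q])
      fix c d assume cd: "d \<le> c" "c < q" "c * q + d \<le> b * q + b"
      have "b * q \<le> a * q" using ab by simp
      with cd(3) have "c * q + d \<le> a * q + b" by linarith
      then show "x (c, d) = y (c, d)" by (rule eq'[OF cd(1,2)])
    qed (use ab in auto)
    show "(case ij of (i, j) \<Rightarrow> \<lambda>x. chol x i j) x = (case ij of (i, j) \<Rightarrow> \<lambda>x. chol x i j) y"
      using 1 ab by simp
    show "(case ij of (i, j) \<Rightarrow> \<lambda>x. ennreal (if j < i then 1 / chol x j j else 1 / (2 * chol x i i))) x =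
        (case ij of (i, j) \<Rightarrow> \<lambda>x. ennreal (if j < i then 1 / chol x j j else 1 / (2 * chol x i i))) y"
      using 1 2 ab by (cases "b = a") auto
    have 3: "a = b \<longrightarrow> pivot x a = pivot y a" using pivot_cong[OF ab(3), of x y] eq' by auto
    show "(case ij of (i, j) \<Rightarrow> \<lambda>x. i = j \<longrightarrow> 0 < pivot x i) x = (case ij of (i, j) \<Rightarrow> \<lambda>x. i = j \<longrightarrow> 0 < pivot x i) y"
      using 3 ab by auto
  }
  have m: "(\<lambda>x. chol x a b) \<in> borel_measurable (coord_lebesgue q)" "(\<lambda>x. chol x a a) \<in> borel_measurable (coord_lebesgue q)"
      "(\<lambda>x. chol x b b) \<in> borel_measurable (coord_lebesgue q)" "(\<lambda>x. pivot x a) \<in> borel_measurable (coord_lebesgue q)"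
    using ab by (auto intro!: chol_measurable pivot_measurable)
  show "(case ij of (i, j) \<Rightarrow> \<lambda>x. chol x i j) \<in> borel_measurable (coord_lebesgue q)" using m ab by simp
  show "(case ij of (i, j) \<Rightarrow> \<lambda>x. ennreal (if j < i then 1 / chol x j j else 1 / (2 * chol x i i))) \<in> borel_measurable (coord_lebesgue q)"
    unfolding ab(1) prod.case
    by (cases "b < a") (simp_all only: if_True if_False, auto intro!: measurable_compose[OF _ measurable_ennreal] borel_measurable_divide borel_measurable_times borel_measurable_const m)
  have "{x \<in> space (coord_lebesgue q). 0 < pivot x a} \<in> sets (coord_lebesgue q)"
    by (intro borel_measurable_less borel_measurable_const m(4))
  then show "Measurable.pred (coord_lebesgue q) (case ij of (i, j) \<Rightarrow> \<lambda>x. i = j \<longrightarrow> 0 < pivot x i)"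
    unfolding ab(1) prod.case pred_def by (cases "a = b") simp_all
  show "low_dom ij \<in> sets borel" by (rule low_dom_borel)
  fix x :: "nat \<times> nat \<Rightarrow> real" and h :: "real \<Rightarrow> ennreal"
  assume D: "\<And>cd. cd \<in> low q \<Longrightarrow> (case cd of (i, j) \<Rightarrow> i * q + j) < (case ij of (i, j) \<Rightarrow> i * q + j) \<Longrightarrow>
        (case cd of (i, j) \<Rightarrow> \<lambda>x. i = j \<longrightarrow> 0 < pivot x i) x"
    and h: "h \<in> borel_measurable borel"
  have old: "chol (x((a, b) := t)) c d = chol x c d" if "c * q + d < a * q + b" "d \<le> c" "c < q" for t c d
    using that by (intro chol_cong[of c q d]) auto
  have row: "chol (x((a, b) := t)) a l = chol x a l" if "l < b" for l t using that ab by (intro old) auto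
  show "(\<integral>\<^sup>+t. h ((case ij of (i, j) \<Rightarrow> \<lambda>x. chol x i j) (x(ij := t))) *
      ((case ij of (i, j) \<Rightarrow> \<lambda>x. ennreal (if j < i then 1 / chol x j j else 1 / (2 * chol x i i))) (x(ij := t)) *
        of_bool ((case ij of (i, j) \<Rightarrow> \<lambda>x. i = j \<longrightarrow> 0 < pivot x i) (x(ij := t)))) \<partial>lborel) =
      (\<integral>\<^sup>+s. h s * indicator (low_dom ij) s \<partial>lborel)"
  proof (cases "b < a")
    case True
    define d where "d = chol x b b"
    define s where "s = (\<Sum>l<b. chol x a l * chol x b l)"
    have lt: "b * q + l < a * q + b" if "l \<le> b" for l using that True ab by (intro rank_rows_less) auto
    have up: "chol (x((a, b) := t)) b l = chol x b l" if "l \<le> b" for l t using that True ab lt by (intro old) auto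
    \<comment> \<open>The condition \<open>D\<close> at \<open>(b, b)\<close>, a position of smaller
      rank because \<open>b < a\<close>; it makes the slope \<open>1 / d\<close> positive.\<close>
    have "pivot x b > 0" using D[of "(b, b)"] ab lt[of b] by auto
    then have d: "d > 0" by (simp add: d_def chol_diag)
    have c: "chol (x((a, b) := t)) a b = - (s / d) + (1 / d) * t" for t
    proof -
      have "(\<Sum>l<b. chol (x((a, b) := t)) a l * chol (x((a, b) := t)) b l) = s"
        unfolding s_def using row up by (intro sum.cong arg_cong2[where f="(*)"]) auto
      then have "chol (x((a, b) := t)) a b = (t - s) / d"
        by (simp only: chol_below[OF True] up[OF order_refl] d_def) simp
      then show ?thesis by (simp add: diff_divide_distrib)
    qed
    have "(\<integral>\<^sup>+t. h (- (s / d) + (1 / d) * t) * ennreal \<bar>1 / d\<bar> \<partial>lborel) = (\<integral>\<^sup>+s. h s \<partial>lborel)"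
      by (rule nn_integral_subst_affine) (use d h in auto)
    then show ?thesis using True d
      by (simp add: ab c up[OF order_refl] d_def[symmetric] low_dom_def)
  next
    case False
    then have ba: "b = a" using ab by simp
    define c where "c = (\<Sum>l<a. (chol x a l)\<^sup>2)"
    have p: "pivot (x((a, a) := t)) a = t - c" for t
    proof -
      have "(\<Sum>l<a. (chol (x((a, a) := t)) a l)\<^sup>2) = c"
        unfolding c_def using row ba by (intro sum.cong arg_cong[where f="\<lambda>x. x\<^sup>2"]) auto
      then show ?thesis by (simp only: pivot_def) simp
    qed
    show ?thesis using nn_integral_subst_sqrt[OF h, of c]
      by (simp add: ab ba chol_diag p low_dom_def)
  qed
qed

lemma pd_coords_sets: "{x \<in> space (coord_lebesgue q). sym_of_lower q x \<in> pos_def_mats q} \<in> sets (coord_lebesgue q)"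
proof -
  have "{x \<in> space (coord_lebesgue q). \<forall>i\<in>{..<q}. pivot x i > 0} \<in> sets (coord_lebesgue q)"
    by (intro sets.sets_Collect_finite_All borel_measurable_less borel_measurable_const pivot_measurable) simp_all
  then show ?thesis unfolding pos_def_iff_pivot Ball_def lessThan_iff .
qed

text \<open>The weight on the right is the Jacobian of V \<mapsto> V V^T, entry by entry. It is
  included in the integrand of the substitution, where it cancels the derivatives of the Cholesky
  map.\<close>

lemma nn_integral_chol:
  assumes H: "H \<in> borel_measurable (coord_lebesgue q)"
  shows "(\<integral>\<^sup>+x. H (\<lambda>ij\<in>low q. chol x (fst ij) (snd ij)) * indicator {x. sym_of_lower q x \<in> pos_def_mats q} x \<partial>coord_lebesgue q) =
    (\<integral>\<^sup>+y. H y * ennreal (\<Prod>(i, j)\<in>low q. if j < i then y (j, j) else 2 * y (i, i)) \<partial>low_lebesgue q)"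
proof -
  let ?w = "\<lambda>y. \<Prod>(i, j)\<in>low q. if j < i then y (j, j) else 2 * y (i, i)"
  let ?F = "\<lambda>y. H y * ennreal (?w y)"
  let ?T = "\<lambda>x. \<lambda>ij\<in>low q. chol x (fst ij) (snd ij)"
  have "(\<lambda>y. case ij of (i, j) \<Rightarrow> if j < i then y (j, j) else 2 * y (i, i)) \<in> borel_measurable (coord_lebesgue q)"
    if "ij \<in> low q" for ij
  proof -
    from that obtain a b where "ij = (a, b)" "b \<le> a" "a < q" by auto
    then have "(\<lambda>y. y (b, b)) \<in> borel_measurable (coord_lebesgue q)" "(\<lambda>y. 2 * y (a, a)) \<in> borel_measurable (coord_lebesgue q)"
      by (auto intro!: measurable_coord borel_measurable_times)
    then show ?thesis unfolding \<open>ij = (a, b)\<close> prod.case by (cases "b < a") (simp_all only: if_True if_False)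
  qed
  then have F: "?F \<in> borel_measurable (coord_lebesgue q)"
    by (intro borel_measurable_times_ennreal H measurable_compose[OF _ measurable_ennreal] borel_measurable_prod) auto
  have "H (?T x) * indicator {x. sym_of_lower q x \<in> pos_def_mats q} x =
     ?F (\<lambda>ij\<in>low q. (case ij of (i, j) \<Rightarrow> \<lambda>x. chol x i j) x) *
      (\<Prod>ij\<in>low q. (case ij of (i, j) \<Rightarrow> \<lambda>x. ennreal (if j < i then 1 / chol x j j else 1 / (2 * chol x i i))) x *
        of_bool ((case ij of (i, j) \<Rightarrow> \<lambda>x. i = j \<longrightarrow> 0 < pivot x i) x))" for x
  proof (cases "\<forall>i<q. pivot x i > 0")
    case True
    have T: "(\<lambda>ij\<in>low q. (case ij of (i, j) \<Rightarrow> \<lambda>x. chol x i j) x) = ?T x" by (auto simp: restrict_def)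
    let ?j = "\<lambda>(i, j). if j < i then 1 / chol x j j else 1 / (2 * chol x i i)"
    have pos: "chol x i i > 0" if "i < q" for i using True that by (simp add: chol_diag)
    have "(\<Prod>ij\<in>low q. (case ij of (i, j) \<Rightarrow> \<lambda>x. ennreal (if j < i then 1 / chol x j j else 1 / (2 * chol x i i))) x *
        of_bool ((case ij of (i, j) \<Rightarrow> \<lambda>x. i = j \<longrightarrow> 0 < pivot x i) x)) = (\<Prod>ij\<in>low q. ennreal (?j ij))"
      using True by (intro prod.cong) auto
    also have "\<dots> = ennreal (\<Prod>ij\<in>low q. ?j ij)"
      using pos by (intro prod_ennreal) (auto simp: less_imp_le)
    finally have P: "(\<Prod>ij\<in>low q. (case ij of (i, j) \<Rightarrow> \<lambda>x. ennreal (if j < i then 1 / chol x j j else 1 / (2 * chol x i i))) x *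
        of_bool ((case ij of (i, j) \<Rightarrow> \<lambda>x. i = j \<longrightarrow> 0 < pivot x i) x)) = ennreal (\<Prod>ij\<in>low q. ?j ij)" .
    have "?w (?T x) * (\<Prod>ij\<in>low q. ?j ij) = 1"
      unfolding prod.distrib[symmetric] using pos
      by (intro prod.neutral) (auto simp: less_imp_neq[OF pos, symmetric])
    moreover have "?w (?T x) \<ge> 0" "(\<Prod>ij\<in>low q. ?j ij) \<ge> 0"
      using pos by (auto intro!: prod_nonneg simp: less_imp_le)
    ultimately have E: "ennreal (?w (?T x)) * ennreal (\<Prod>ij\<in>low q. ?j ij) = 1"
      by (simp only: ennreal_mult[symmetric] ennreal_1)
    have I: "indicator {x. sym_of_lower q x \<in> pos_def_mats q} x = (1 :: ennreal)"
      using True by (simp add: pos_def_iff_pivot)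
    show ?thesis by (simp only: T P I mult.assoc E)
  next
    case False
    then obtain i where "i < q" "\<not> pivot x i > 0" by auto
    then have "(\<Prod>ij\<in>low q. (case ij of (i, j) \<Rightarrow> \<lambda>x. ennreal (if j < i then 1 / chol x j j else 1 / (2 * chol x i i))) x *
        of_bool ((case ij of (i, j) \<Rightarrow> \<lambda>x. i = j \<longrightarrow> 0 < pivot x i) x)) = 0"
      by (intro prod_zero finite_low bexI[of _ "(i, i)"]) auto
    then show ?thesis using False by (simp only: mult_zero_right) (auto simp: pos_def_iff_pivot)
  qed
  then show ?thesis
    using nn_integral_low_substitution[OF triangular_chol F] by simp
qed

section \<open>Measurability on spaces of matrices\<close>

lemma space_mat_borel: "space (mat_borel q) = carrier_mat q q"
  by (simp add: mat_borel_def)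

lemma measurable_mat_borelI:
  assumes "\<And>w. w \<in> space M \<Longrightarrow> f w \<in> carrier_mat q q"
    and "\<And>i j. i < q \<Longrightarrow> j < q \<Longrightarrow> (\<lambda>w. f w $$ (i, j)) \<in> borel_measurable M"
  shows "f \<in> measurable M (mat_borel q)"
  unfolding mat_borel_def
proof (rule measurable_vimage_algebra2)
  show "f \<in> space M \<rightarrow> carrier_mat q q" using assms by auto
  show "(\<lambda>x. \<lambda>ij\<in>{..<q} \<times> {..<q}. f x $$ ij) \<in> measurable M (\<Pi>\<^sub>M ij\<in>{..<q} \<times> {..<q}. borel)"
    using assms(2) by (intro measurable_restrict) auto
qed

lemma measurable_mat_index:
  assumes "i < q" "j < q"
  shows "(\<lambda>A. A $$ (i, j)) \<in> borel_measurable (mat_borel q)"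
proof -
  have 1: "(\<lambda>A. \<lambda>ij\<in>{..<q} \<times> {..<q}. A $$ ij) \<in> measurable (mat_borel q) (\<Pi>\<^sub>M ij\<in>{..<q} \<times> {..<q}. borel)"
    unfolding mat_borel_def by (rule measurable_vimage_algebra1) (auto simp: space_PiM)
  have 2: "(\<lambda>x. x (i, j)) \<in> borel_measurable (\<Pi>\<^sub>M ij\<in>{..<q} \<times> {..<q}. (borel :: real measure))"
    using assms by (intro measurable_component_singleton) auto
  show ?thesis using measurable_compose[OF 1 2] assms by simp
qed

lemma measurable_pd_borelI:
  assumes "\<And>w. w \<in> space M \<Longrightarrow> f w \<in> pos_def_mats q"
    and "\<And>i j. i < q \<Longrightarrow> j < q \<Longrightarrow> (\<lambda>w. f w $$ (i, j)) \<in> borel_measurable M"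
  shows "f \<in> measurable M (pd_borel q)"
  unfolding pd_borel_def
  using assms by (intro measurable_restrict_space2 measurable_mat_borelI) (auto simp: pos_def_mats_def)

lemma space_pd_borel: "space (pd_borel q) = pos_def_mats q"
  by (auto simp: pd_borel_def space_restrict_space space_mat_borel pos_def_mats_def)

lemma measurable_pd_index:
  "i < q \<Longrightarrow> j < q \<Longrightarrow> (\<lambda>A. A $$ (i, j)) \<in> borel_measurable (pd_borel q)"
  unfolding pd_borel_def by (intro measurable_restrict_space1 measurable_mat_index)

lemma measurable_Gplus_borelI:
  assumes "\<And>w. w \<in> space M \<Longrightarrow> f w \<in> Gplus q"
    and "\<And>i j. i < q \<Longrightarrow> j < q \<Longrightarrow> (\<lambda>w. f w $$ (i, j)) \<in> borel_measurable M"
  shows "f \<in> measurable M (Gplus_borel q)"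
  unfolding Gplus_borel_def
  using assms by (intro measurable_restrict_space2 measurable_mat_borelI) (auto simp: Gplus_def)

lemma space_Gplus_borel: "space (Gplus_borel q) = Gplus q"
  by (auto simp: Gplus_borel_def space_restrict_space space_mat_borel Gplus_def)

lemma measurable_Gplus_index:
  "i < q \<Longrightarrow> j < q \<Longrightarrow> (\<lambda>A. A $$ (i, j)) \<in> borel_measurable (Gplus_borel q)"
  unfolding Gplus_borel_def by (intro measurable_restrict_space1 measurable_mat_index)

text \<open>An entrywise notion for all shapes: \<open>mat_borel\<close> concerns square matrices
  only, while minors, matricizations and Kronecker products come in every size, also varying along
  an induction.\<close>

definition mat_meas :: "'w measure \<Rightarrow> nat \<Rightarrow> nat \<Rightarrow> ('w \<Rightarrow> real mat) \<Rightarrow> bool" where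
  "mat_meas M r c f \<longleftrightarrow> (\<forall>w\<in>space M. f w \<in> carrier_mat r c) \<and>
     (\<forall>i<r. \<forall>j<c. (\<lambda>w. f w $$ (i, j)) \<in> borel_measurable M)"

lemma mat_measD:
  assumes "mat_meas M r c f"
  shows "\<And>w. w \<in> space M \<Longrightarrow> f w \<in> carrier_mat r c"
    and "\<And>i j. i < r \<Longrightarrow> j < c \<Longrightarrow> (\<lambda>w. f w $$ (i, j)) \<in> borel_measurable M"
  using assms by (auto simp: mat_meas_def)

lemma mat_measI:
  assumes "\<And>w. w \<in> space M \<Longrightarrow> f w \<in> carrier_mat r c"
    and "\<And>i j. i < r \<Longrightarrow> j < c \<Longrightarrow> (\<lambda>w. f w $$ (i, j)) \<in> borel_measurable M"
  shows "mat_meas M r c f"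
  using assms by (auto simp: mat_meas_def)

lemma mat_meas_cong:
  assumes "mat_meas M r c f" "\<And>w. w \<in> space M \<Longrightarrow> f w = g w"
  shows "mat_meas M r c g"
  using assms measurable_cong[of M "\<lambda>w. f w $$ _" "\<lambda>w. g w $$ _"]
  by (auto simp: mat_meas_def cong: measurable_cong)

lemma mat_meas_const: "A \<in> carrier_mat r c \<Longrightarrow> mat_meas M r c (\<lambda>_. A)"
  by (auto simp: mat_meas_def)

lemma mat_meas_transpose:
  assumes "mat_meas M r c f"
  shows "mat_meas M c r (\<lambda>w. transpose_mat (f w))"
proof (rule mat_measI)
  fix i j assume ij: "i < c" "j < r"
  have "(\<lambda>w. f w $$ (j, i)) \<in> borel_measurable M \<longleftrightarrow> (\<lambda>w. transpose_mat (f w) $$ (i, j)) \<in> borel_measurable M"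
    by (rule measurable_cong) (use mat_measD(1)[OF assms] ij in fastforce)
  then show "(\<lambda>w. transpose_mat (f w) $$ (i, j)) \<in> borel_measurable M"
    using mat_measD(2)[OF assms] ij by simp
qed (use mat_measD(1)[OF assms] in auto)

lemma mat_meas_mult:
  assumes f: "mat_meas M r n f" and g: "mat_meas M n c g"
  shows "mat_meas M r c (\<lambda>w. f w * g w)"
proof (rule mat_measI)
  fix i j assume ij: "i < r" "j < c"
  have "(\<lambda>w. (f w * g w) $$ (i, j)) \<in> borel_measurable M \<longleftrightarrow>
      (\<lambda>w. \<Sum>l<n. f w $$ (i, l) * g w $$ (l, j)) \<in> borel_measurable M"
  proof (rule measurable_cong)
    fix w assume w: "w \<in> space M"
    show "(f w * g w) $$ (i, j) = (\<Sum>l<n. f w $$ (i, l) * g w $$ (l, j))"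
      using mat_measD(1)[OF f w] mat_measD(1)[OF g w] ij by (simp add: scalar_prod_def lessThan_atLeast0)
  qed
  then show "(\<lambda>w. (f w * g w) $$ (i, j)) \<in> borel_measurable M"
    using mat_measD(2)[OF f] mat_measD(2)[OF g] ij by (auto intro!: borel_measurable_sum borel_measurable_times)
qed (rule mult_carrier_mat[OF mat_measD(1)[OF f] mat_measD(1)[OF g]])

lemma mat_meas_smult:
  assumes f: "mat_meas M r c f" and a: "a \<in> borel_measurable M"
  shows "mat_meas M r c (\<lambda>w. a w \<cdot>\<^sub>m f w)"
proof (rule mat_measI)
  fix i j assume ij: "i < r" "j < c"
  have "(\<lambda>w. (a w \<cdot>\<^sub>m f w) $$ (i, j)) \<in> borel_measurable M \<longleftrightarrow>
      (\<lambda>w. a w * f w $$ (i, j)) \<in> borel_measurable M"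
    by (rule measurable_cong) (use mat_measD(1)[OF f] ij in fastforce)
  then show "(\<lambda>w. (a w \<cdot>\<^sub>m f w) $$ (i, j)) \<in> borel_measurable M"
    using mat_measD(2)[OF f ij] a by (auto intro!: borel_measurable_times)
qed (use mat_measD(1)[OF f] in auto)

lemma mat_meas_det:
  assumes f: "mat_meas M n n f"
  shows "(\<lambda>w. det (f w)) \<in> borel_measurable M"
proof -
  have "(\<lambda>w. det (f w)) \<in> borel_measurable M \<longleftrightarrow>
    (\<lambda>w. \<Sum>p\<in>{p. p permutes {0..<n}}. signof p * (\<Prod>i=0..<n. f w $$ (i, p i))) \<in> borel_measurable M"
    by (rule measurable_cong) (use mat_measD(1)[OF f] det_def' in blast)
  moreover have "(\<lambda>w. \<Sum>p\<in>{p. p permutes {0..<n}}. signof p * (\<Prod>i=0..<n. f w $$ (i, p i))) \<in> borel_measurable M"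
  proof (intro borel_measurable_sum borel_measurable_times borel_measurable_prod borel_measurable_const)
    fix p i assume "p \<in> {p. p permutes {0..<n}}" "i \<in> {0..<n}"
    then have "p i < n" "i < n" using permutes_in_image[of p "{0..<n}" i] by auto
    then show "(\<lambda>w. f w $$ (i, p i)) \<in> borel_measurable M" using mat_measD(2)[OF f] by auto
  qed
  ultimately show ?thesis by simp
qed

lemma mat_meas_mat_inv:
  assumes f: "mat_meas M n n f" and d: "\<And>w. w \<in> space M \<Longrightarrow> det (f w) \<noteq> 0"
  shows "mat_meas M n n (\<lambda>w. mat_inv (f w))"
proof (rule mat_measI)
  fix i j assume ij: "i < n" "j < n"
  have del: "mat_meas M (n - 1) (n - 1) (\<lambda>w. mat_delete (f w) j i)"
  proof (rule mat_measI)
    fix a b assume ab: "a < n - 1" "b < n - 1"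
    have "(\<lambda>w. mat_delete (f w) j i $$ (a, b)) \<in> borel_measurable M \<longleftrightarrow>
       (\<lambda>w. f w $$ (if a < j then a else Suc a, if b < i then b else Suc b)) \<in> borel_measurable M"
      by (rule measurable_cong) (use mat_measD(1)[OF f] ab in \<open>fastforce simp: mat_delete_def\<close>)
    then show "(\<lambda>w. mat_delete (f w) j i $$ (a, b)) \<in> borel_measurable M"
      using mat_measD(2)[OF f] ab by auto
  qed (auto intro!: carrier_matI simp: mat_delete_def dest!: mat_measD(1)[OF f])
  have "(\<lambda>w. mat_inv (f w) $$ (i, j)) \<in> borel_measurable M \<longleftrightarrow>
      (\<lambda>w. inverse (det (f w)) * ((-1) ^ (j + i) * det (mat_delete (f w) j i))) \<in> borel_measurable M"
  proof (rule measurable_cong)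
    fix w assume w: "w \<in> space M"
    show "mat_inv (f w) $$ (i, j) = inverse (det (f w)) * ((-1) ^ (j + i) * det (mat_delete (f w) j i))"
      unfolding mat_inv_adj[OF mat_measD(1)[OF f w] d[OF w]]
      using mat_measD(1)[OF f w] ij by (simp add: adj_mat_def cofactor_def)
  qed
  then show "(\<lambda>w. mat_inv (f w) $$ (i, j)) \<in> borel_measurable M"
    using mat_meas_det[OF f] mat_meas_det[OF del] by (auto intro!: borel_measurable_times)
qed (use mat_inv(1)[OF mat_measD(1)[OF f] d] in auto)

lemma mat_meas_low_mat:
  assumes "\<And>i j. j \<le> i \<Longrightarrow> i < q \<Longrightarrow> (\<lambda>w. x w (i, j)) \<in> borel_measurable M"
  shows "mat_meas M q q (\<lambda>w. low_mat q (x w))"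
proof (rule mat_measI)
  fix i j assume "i < q" "j < q"
  then show "(\<lambda>w. low_mat q (x w) $$ (i, j)) \<in> borel_measurable M"
    using assms[of j i] by (cases "j \<le> i") simp_all
qed simp

lemma mat_meas_lower_chol:
  assumes f: "mat_meas M q q f" and pd: "\<And>w. w \<in> space M \<Longrightarrow> f w \<in> pos_def_mats q"
  shows "mat_meas M q q (\<lambda>w. lower_chol (f w))"
proof (rule mat_meas_cong)
  have "(\<lambda>w. low_coords q (f w)) \<in> measurable M (coord_lebesgue q)"
    unfolding low_coords_def
    by (rule measurable_restrict) (use mat_measD(2)[OF f] in auto)
  then show "mat_meas M q q (\<lambda>w. low_mat q (\<lambda>(i, j). chol (low_coords q (f w)) i j))"
    by (intro mat_meas_low_mat) (auto intro!: measurable_compose[OF _ chol_measurable])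
  fix w assume "w \<in> space M"
  then show "low_mat q (\<lambda>(i, j). chol (low_coords q (f w)) i j) = lower_chol (f w)"
    using lower_chol(1)[OF pd] by simp
qed

lemma mat_meas_pd_id: "mat_meas (pd_borel q) q q (\<lambda>S. S)"
  by (rule mat_measI) (auto simp: space_pd_borel pos_def_mats_def intro: measurable_pd_index)

lemma mat_meas_Gplus_id: "mat_meas (Gplus_borel q) q q (\<lambda>S. S)"
  by (rule mat_measI) (auto simp: space_Gplus_borel Gplus_def intro: measurable_Gplus_index)

lemma mat_meas_compose:
  assumes "mat_meas N r c f" "g \<in> measurable M N"
  shows "mat_meas M r c (\<lambda>w. f (g w))"
  using assms by (intro mat_measI) (auto simp: mat_meas_def dest: measurable_space intro: measurable_compose[OF assms(2)])

lemma power2_powr: "t > 0 \<Longrightarrow> (t\<^sup>2) powr b = t powr (2 * b)" for t b :: real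
  using powr_powr[of t 2 b] by simp

section \<open>The Wishart distribution in Cholesky coordinates\<close>

lemma sym_of_lower_measurable:
  "sym_of_lower q \<in> measurable (restrict_space (coord_lebesgue q) {x. sym_of_lower q x \<in> pos_def_mats q}) (pd_borel q)"
proof (rule measurable_pd_borelI)
  fix i j assume ij: "i < q" "j < q"
  then have "(if j \<le> i then (i, j) else (j, i)) \<in> low q" by auto
  then have "(\<lambda>x. x (if j \<le> i then (i, j) else (j, i))) \<in> borel_measurable (coord_lebesgue q)" by (rule measurable_coord)
  moreover have "sym_of_lower q x $$ (i, j) = x (if j \<le> i then (i, j) else (j, i))" for x using ij by (simp add: sym_of_lower_def)
  ultimately show "(\<lambda>x. sym_of_lower q x $$ (i, j)) \<in>
      borel_measurable (restrict_space (coord_lebesgue q) {x. sym_of_lower q x \<in> pos_def_mats q})"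
    by (intro measurable_restrict_space1) (simp only:)
qed (auto simp: space_restrict_space)

lemma sets_pd_lebesgue[measurable_cong]: "sets (pd_lebesgue q) = sets (pd_borel q)"
  by (simp add: pd_lebesgue_def)

lemma nn_integral_pd_lebesgue:
  assumes "f \<in> borel_measurable (pd_borel q)"
  shows "(\<integral>\<^sup>+S. f S \<partial>pd_lebesgue q) =
    (\<integral>\<^sup>+x. f (sym_of_lower q x) * indicator {x. sym_of_lower q x \<in> pos_def_mats q} x \<partial>coord_lebesgue q)"
  unfolding pd_lebesgue_def
  using pd_coords_sets[of q] assms
  by (subst nn_integral_distr[OF sym_of_lower_measurable])
     (auto simp: nn_integral_restrict_space Int_def conj_commute)

text \<open>From here on integrals over positive definite matrices are handled through the
  coordinates of the Cholesky factor.\<close>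

lemma nn_integral_pd_lebesgue_chol:
  assumes H: "H \<in> borel_measurable (coord_lebesgue q)"
  shows "(\<integral>\<^sup>+S. H (low_coords q (lower_chol S)) \<partial>pd_lebesgue q) =
    (\<integral>\<^sup>+y. H y * ennreal (\<Prod>(i, j)\<in>low q. if j < i then y (j, j) else 2 * y (i, i)) \<partial>low_lebesgue q)"
proof -
  have "(\<lambda>S. low_coords q (lower_chol S)) \<in> measurable (pd_borel q) (coord_lebesgue q)"
    unfolding low_coords_def
    by (rule measurable_restrict)
       (use mat_measD(2)[OF mat_meas_lower_chol[OF mat_meas_pd_id]] in \<open>auto simp: space_pd_borel\<close>)
  then have "(\<integral>\<^sup>+S. H (low_coords q (lower_chol S)) \<partial>pd_lebesgue q) =
    (\<integral>\<^sup>+x. H (low_coords q (lower_chol (sym_of_lower q x))) * indicator {x. sym_of_lower q x \<in> pos_def_mats q} x \<partial>coord_lebesgue q)"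
    by (rule nn_integral_pd_lebesgue[OF measurable_compose[OF _ H]])
  also have "\<dots> = (\<integral>\<^sup>+x. H (\<lambda>ij\<in>low q. chol x (fst ij) (snd ij)) * indicator {x. sym_of_lower q x \<in> pos_def_mats q} x \<partial>coord_lebesgue q)"
  proof (rule nn_integral_cong)
    fix x assume x: "x \<in> space (coord_lebesgue q)"
    show "H (low_coords q (lower_chol (sym_of_lower q x))) * indicator {x. sym_of_lower q x \<in> pos_def_mats q} x =
      H (\<lambda>ij\<in>low q. chol x (fst ij) (snd ij)) * indicator {x. sym_of_lower q x \<in> pos_def_mats q} x"
    proof (cases "sym_of_lower q x \<in> pos_def_mats q")
      case True
      have "low_coords q (sym_of_lower q x) = x"
        using x by (auto simp: low_coords_def sym_of_lower_def fun_eq_iff space_PiM extensional_def PiE_def)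
      then have "low_coords q (lower_chol (sym_of_lower q x)) = (\<lambda>ij\<in>low q. chol x (fst ij) (snd ij))"
        by (simp only: lower_chol(1)[OF True]) (auto simp: low_coords_def fun_eq_iff)
      then show ?thesis by simp
    qed simp
  qed
  also have "\<dots> = (\<integral>\<^sup>+y. H y * ennreal (\<Prod>(i, j)\<in>low q. if j < i then y (j, j) else 2 * y (i, i)) \<partial>low_lebesgue q)"
    by (rule nn_integral_chol[OF H])
  finally show ?thesis .
qed

lemma low_eq_Sigma: "low q = Sigma {..<q} (\<lambda>i. {..i})"
  by auto

lemma sum_low: "(\<Sum>ij\<in>low q. f ij) = (\<Sum>i<q. \<Sum>j\<le>i. f (i, j))"
  unfolding low_eq_Sigma by (subst sum.Sigma) auto

lemma prod_low: "(\<Prod>ij\<in>low q. f ij) = (\<Prod>i<q. \<Prod>j\<le>i. f (i, j))"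
  unfolding low_eq_Sigma by (subst prod.Sigma) auto

text \<open>Column \<open>j\<close> has \<open>q - 1 - j\<close> entries strictly below the
  diagonal.\<close>

lemma prod_low_columns:
  fixes d :: "nat \<Rightarrow> 'a::comm_monoid_mult"
  shows "(\<Prod>i<q. \<Prod>j<i. d j) = (\<Prod>j<q. d j ^ (q - 1 - j))"
proof (induction q)
  case (Suc q)
  have "(\<Prod>j<q. d j ^ (q - j)) = (\<Prod>j<q. d j ^ (q - 1 - j) * d j)"
  proof (rule prod.cong)
    fix j assume "j \<in> {..<q}"
    then have "q - j = Suc (q - 1 - j)" by auto
    then show "d j ^ (q - j) = d j ^ (q - 1 - j) * d j" by (simp add: mult.commute)
  qed simp
  then show ?case using Suc by (simp add: prod.distrib)
qed simp

lemma trace_gram_low: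
  "mat_trace (low_mat q y * transpose_mat (low_mat q y)) = (\<Sum>ij\<in>low q. (y ij)\<^sup>2)"
proof -
  have "mat_trace (low_mat q y * transpose_mat (low_mat q y)) = (\<Sum>i<q. \<Sum>j\<le>i. y (i, j) * y (i, j))"
    unfolding mat_trace_def by (intro sum.cong) (use low_mat_gram_index in auto)
  then show ?thesis by (simp add: sum_low power2_eq_square)
qed

lemma det_gram_low:
  "det (low_mat q y * transpose_mat (low_mat q y)) = (\<Prod>i<q. y (i, i))\<^sup>2"
  using det_transpose[of "low_mat q y" q]
  by (subst det_mult[of _ q]) (auto simp: det_lower[of "low_mat q y" q] power2_eq_square)

definition wishart_const :: "nat \<Rightarrow> real \<Rightarrow> real" where
  "wishart_const q \<nu> = 2 powr (\<nu> * real q / 2) * multivariate_Gamma q (\<nu> / 2)"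

lemma wishart_const_pos:
  assumes "\<nu> > real q - 1"
  shows "wishart_const q \<nu> > 0"
  unfolding wishart_const_def multivariate_Gamma_def
  using assms by (intro mult_pos_pos prod_pos Gamma_real_pos) auto

text \<open>The unnormalized Bartlett density: independent entries, standard normal below the
  diagonal and, counting from 0, chi with \<open>\<nu> - i\<close> degrees of freedom at
  \<open>(i, i)\<close>.\<close>

definition bartlett :: "nat \<Rightarrow> real \<Rightarrow> (nat \<times> nat \<Rightarrow> real) \<Rightarrow> real" where
  "bartlett q \<nu> y = (\<Prod>i<q. y (i, i) powr (\<nu> - real i - 1)) * exp (- (\<Sum>ij\<in>low q. (y ij)\<^sup>2) / 2)"

lemma bartlett_measurable[measurable]: "bartlett q \<nu> \<in> borel_measurable (coord_lebesgue q)"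
  unfolding bartlett_def
  by (intro borel_measurable_times borel_measurable_prod powr_real_measurable borel_measurable_exp
      measurable_compose[OF _ borel_measurable_exp] borel_measurable_divide borel_measurable_uminus
      borel_measurable_sum borel_measurable_power measurable_coord borel_measurable_const) auto

lemma bartlett_nonneg: "bartlett q \<nu> y \<ge> 0"
  unfolding bartlett_def by (intro mult_nonneg_nonneg prod_nonneg) auto

text \<open>The determinant contributes the power \<nu> - q - 1 of each diagonal entry and the
  Jacobian the power q - i, together \<nu> - i - 1 as in Bartlett's density. The factor
  \<open>2 ^ q\<close> comes from the derivatives 2 y_ii of the squares on the diagonal.\<close>

lemma nn_integral_wishart:
  assumes \<nu>: "\<nu> > real q - 1"
    and f: "f \<in> borel_measurable (pd_borel q)" and H: "H \<in> borel_measurable (coord_lebesgue q)"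
    and fH: "\<And>S. S \<in> pos_def_mats q \<Longrightarrow> f S = H (low_coords q (lower_chol S))"
  shows "(\<integral>\<^sup>+S. f S \<partial>wishart q \<nu>) = (\<integral>\<^sup>+y. H y * ennreal (2 ^ q / wishart_const q \<nu> * bartlett q \<nu> y) \<partial>low_lebesgue q)"
proof -
  let ?d = "\<lambda>S. det S powr ((\<nu> - real q - 1) / 2) * exp (- mat_trace S / 2) / (2 powr (\<nu> * real q / 2) * multivariate_Gamma q (\<nu> / 2))"
  let ?d' = "\<lambda>y. (\<Prod>i<q. y (i, i))\<^sup>2 powr ((\<nu> - real q - 1) / 2) * exp (- (\<Sum>ij\<in>low q. (y ij)\<^sup>2) / 2) / wishart_const q \<nu>"
  have tr: "(\<lambda>S. mat_trace S) \<in> borel_measurable (pd_borel q)"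
  proof -
    have "(\<lambda>S. \<Sum>i<q. S $$ (i, i)) \<in> borel_measurable (pd_borel q)"
      by (intro borel_measurable_sum measurable_pd_index) auto
    moreover have "mat_trace S = (\<Sum>i<q. S $$ (i, i))" if "S \<in> space (pd_borel q)" for S
      using that by (auto simp: mat_trace_def space_pd_borel pos_def_mats_def)
    ultimately show ?thesis by (subst measurable_cong) auto
  qed
  have d: "?d \<in> borel_measurable (pd_borel q)"
    using mat_meas_det[OF mat_meas_pd_id, of q] tr by measurable
  have d': "?d' \<in> borel_measurable (coord_lebesgue q)"
    by (intro borel_measurable_times borel_measurable_prod powr_real_measurable
      measurable_compose[OF _ borel_measurable_exp] borel_measurable_divide borel_measurable_uminus
      borel_measurable_sum borel_measurable_power measurable_coord borel_measurable_const) auto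
  have "(\<integral>\<^sup>+S. f S \<partial>wishart q \<nu>) = (\<integral>\<^sup>+S. ennreal (?d S) * f S \<partial>pd_lebesgue q)"
    unfolding wishart_def using d f by (intro nn_integral_density) (auto cong: measurable_cong_sets sets_pd_lebesgue simp: measurable_cong_sets[OF sets_pd_lebesgue refl])
  also have "\<dots> = (\<integral>\<^sup>+S. (\<lambda>y. ennreal (?d' y) * H y) (low_coords q (lower_chol S)) \<partial>pd_lebesgue q)"
  proof (rule nn_integral_cong)
    fix S assume "S \<in> space (pd_lebesgue q)"
    then have S: "S \<in> pos_def_mats q" by (simp add: pd_lebesgue_def space_pd_borel)
    note V = lower_chol(2-5)[OF S]
    define y where "y = low_coords q (lower_chol S)"
    have "low_mat q y = lower_chol S" using V by (simp add: y_def low_mat_low_coords)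
    then have "S = low_mat q y * transpose_mat (low_mat q y)" using V by simp
    then have "?d S = ?d' y" by (simp only: det_gram_low trace_gram_low wishart_const_def)
    then show "ennreal (?d S) * f S = (\<lambda>y. ennreal (?d' y) * H y) (low_coords q (lower_chol S))"
      using fH[OF S] by (simp add: y_def)
  qed
  also have "\<dots> = (\<integral>\<^sup>+y. (ennreal (?d' y) * H y) * ennreal (\<Prod>(i, j)\<in>low q. if j < i then y (j, j) else 2 * y (i, i)) \<partial>low_lebesgue q)"
    by (rule nn_integral_pd_lebesgue_chol) (intro borel_measurable_times_ennreal measurable_compose[OF d' measurable_ennreal] H)
  also have "\<dots> = (\<integral>\<^sup>+y. H y * ennreal (2 ^ q / wishart_const q \<nu> * bartlett q \<nu> y) \<partial>low_lebesgue q)"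
  proof (rule nn_integral_low_lebesgue_cong)
    fix y assume "y \<in> low_pos q"
    then have pos: "y (i, i) > 0" if "i < q" for i using that by (auto simp: low_pos_def)
    have P: "(\<Prod>(i, j)\<in>low q. if j < i then y (j, j) else 2 * y (i, i)) = 2 ^ q * (\<Prod>i<q. y (i, i) ^ (q - i))"
    proof -
      have "(\<Prod>(i, j)\<in>low q. if j < i then y (j, j) else 2 * y (i, i)) = (\<Prod>i<q. (\<Prod>j<i. y (j, j)) * (2 * y (i, i)))"
        unfolding prod_low by (intro prod.cong) (auto simp: lessThan_Suc_atMost[symmetric])
      also have "\<dots> = 2 ^ q * (\<Prod>i<q. y (i, i) ^ (q - 1 - i) * y (i, i))"
        by (simp add: prod.distrib prod_low_columns)
      also have "(\<Prod>i<q. y (i, i) ^ (q - 1 - i) * y (i, i)) = (\<Prod>i<q. y (i, i) ^ (q - i))"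
      proof (rule prod.cong)
        fix i assume "i \<in> {..<q}"
        then have "q - i = Suc (q - 1 - i)" by auto
        then show "y (i, i) ^ (q - 1 - i) * y (i, i) = y (i, i) ^ (q - i)" by (simp add: mult.commute)
      qed simp
      finally show ?thesis .
    qed
    have Q: "(\<Prod>i<q. y (i, i))\<^sup>2 powr ((\<nu> - real q - 1) / 2) * (\<Prod>i<q. y (i, i) ^ (q - i)) = (\<Prod>i<q. y (i, i) powr (\<nu> - real i - 1))"
    proof -
      have "(\<Prod>i<q. y (i, i))\<^sup>2 powr ((\<nu> - real q - 1) / 2) = (\<Prod>i<q. y (i, i)) powr (\<nu> - real q - 1)"
      proof -
        have "(\<Prod>i<q. y (i, i)) > 0" using pos by (auto intro!: prod_pos)
        moreover have "2 * ((\<nu> - real q - 1) / 2) = \<nu> - real q - 1" by simp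
        ultimately show ?thesis using power2_powr[of "\<Prod>i<q. y (i, i)" "(\<nu> - real q - 1) / 2"] by (simp only:)
      qed
      also have "\<dots> = (\<Prod>i<q. y (i, i) powr (\<nu> - real q - 1))"
        using pos by (intro prod_powr_distrib)
      finally show ?thesis
        unfolding prod.distrib[symmetric]
        by (simp only: prod.distrib[symmetric], intro prod.cong refl)
           (use pos in \<open>auto simp: powr_realpow[symmetric] powr_add[symmetric] of_nat_diff algebra_simps\<close>)
    qed
    have c: "wishart_const q \<nu> > 0" by (rule wishart_const_pos[OF \<nu>])
    have "?d' y * (2 ^ q * (\<Prod>i<q. y (i, i) ^ (q - i))) = 2 ^ q / wishart_const q \<nu> * bartlett q \<nu> y"
      unfolding bartlett_def Q[symmetric] by simp
    moreover have "?d' y \<ge> 0" using c by (intro divide_nonneg_pos mult_nonneg_nonneg) auto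
    moreover have "2 ^ q * (\<Prod>i<q. y (i, i) ^ (q - i)) \<ge> 0"
      using pos by (intro mult_nonneg_nonneg prod_nonneg) (auto simp: less_imp_le)
    ultimately have E: "ennreal (?d' y) * ennreal (2 ^ q * (\<Prod>i<q. y (i, i) ^ (q - i))) = ennreal (2 ^ q / wishart_const q \<nu> * bartlett q \<nu> y)"
      by (simp only: ennreal_mult[symmetric])
    have "(a * h) * b = h * c" if "a * b = c" for a b c h :: ennreal
      unfolding that[symmetric] by (simp only: mult_ac)
    from this[OF E] show "(ennreal (?d' y) * H y) * ennreal (\<Prod>(i, j)\<in>low q. if j < i then y (j, j) else 2 * y (i, i)) =
      H y * ennreal (2 ^ q / wishart_const q \<nu> * bartlett q \<nu> y)"
      unfolding P .
  qed
  finally show ?thesis .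
qed

section \<open>Normalization of the Wishart density\<close>

lemma nn_integral_gaussian: "(\<integral>\<^sup>+t. ennreal (exp (- t\<^sup>2 / 2)) \<partial>lborel) = ennreal (sqrt (2 * pi))"
proof -
  interpret prob_space "density lborel (normal_density 0 1)" by (rule prob_space_normal_density) simp
  have "1 = emeasure (density lborel (normal_density 0 1)) UNIV" using emeasure_space_1 by simp
  also have "\<dots> = (\<integral>\<^sup>+t. ennreal (1 / sqrt (2 * pi)) * ennreal (exp (- t\<^sup>2 / 2)) \<partial>lborel)"
    by (simp add: emeasure_density normal_density_def ennreal_mult[symmetric])
  also have "\<dots> = ennreal (1 / sqrt (2 * pi)) * (\<integral>\<^sup>+t. ennreal (exp (- t\<^sup>2 / 2)) \<partial>lborel)"
    by (rule nn_integral_cmult) auto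
  finally have "ennreal (sqrt (2 * pi)) * 1 = (ennreal (sqrt (2 * pi)) * ennreal (1 / sqrt (2 * pi))) * (\<integral>\<^sup>+t. ennreal (exp (- t\<^sup>2 / 2)) \<partial>lborel)"
    by (simp add: mult.assoc)
  then show ?thesis by (simp add: ennreal_mult[symmetric])
qed

text \<open>The substitution s = t^2 / 2 gives the Gamma integral at \<open>a / 2\<close>.\<close>

lemma nn_integral_chi:
  assumes "a > 0"
  shows "(\<integral>\<^sup>+t. ennreal (t powr (a - 1) * exp (- t\<^sup>2 / 2)) * indicator {0<..} t \<partial>lborel) = ennreal (2 powr (a / 2 - 1) * Gamma (a / 2))"
proof -
  let ?h = "\<lambda>s. ennreal ((2 * s) powr (a / 2 - 1) * exp (- s))"
  have "(\<integral>\<^sup>+t. ennreal (t powr (a - 1) * exp (- t\<^sup>2 / 2)) * indicator {0<..} t \<partial>lborel) =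
     (\<integral>\<^sup>+t. ?h (1 / 2 * t ^ 2) * (ennreal (1 / 2 * (real 2 * t ^ (2 - 1))) * of_bool (t > 0)) \<partial>lborel)"
  proof (rule nn_integral_cong)
    fix t :: real
    show "ennreal (t powr (a - 1) * exp (- t\<^sup>2 / 2)) * indicator {0<..} t = ?h (1 / 2 * t ^ 2) * (ennreal (1 / 2 * (real 2 * t ^ (2 - 1))) * of_bool (t > 0))"
    proof (cases "t > 0")
      case True
      have "(t ^ 2) powr (a / 2 - 1) * t = t powr (a - 1)"
      proof -
        have "(t ^ 2) powr (a / 2 - 1) = t powr (2 * (a / 2 - 1))"
          using True by (rule power2_powr)
        then have "(t ^ 2) powr (a / 2 - 1) * t = t powr (a - 2) * t powr 1" using True by (simp add: right_diff_distrib)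
        also have "\<dots> = t powr (a - 1)" by (subst powr_add[symmetric]) simp
        finally show ?thesis .
      qed
      then show ?thesis using True by (simp add: ennreal_mult[symmetric] mult_ac)
    qed simp
  qed
  also have "\<dots> = (\<integral>\<^sup>+s. ?h s * indicator {0<..} s \<partial>lborel)"
    by (rule nn_integral_subst_power) auto
  also have "\<dots> = (\<integral>\<^sup>+s. ennreal (2 powr (a / 2 - 1)) * (ennreal (s powr (a / 2 - 1) / exp s) * indicator {0..} s) \<partial>lborel)"
  proof (rule nn_integral_cong_AE)
    show "AE s in lborel. ?h s * indicator {0<..} s = ennreal (2 powr (a / 2 - 1)) * (ennreal (s powr (a / 2 - 1) / exp s) * indicator {0..} s)"
      using AE_lborel_singleton[of "0::real"]
      by eventually_elim (auto split: split_indicator simp: ennreal_mult[symmetric] powr_mult exp_minus field_simps)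
  qed
  also have "\<dots> = ennreal (2 powr (a / 2 - 1)) * (\<integral>\<^sup>+s. ennreal (s powr (a / 2 - 1) / exp s) * indicator {0..} s \<partial>lborel)"
    by (rule nn_integral_cmult) auto
  also have "(\<integral>\<^sup>+s. ennreal (s powr (a / 2 - 1) / exp s) * indicator {0..} s \<partial>lborel) = ennreal (Gamma (a / 2))"
    by (rule nn_integral_has_integral_lebesgue') (use Gamma_integral_real[of "a / 2"] assms in auto)
  finally show ?thesis using Gamma_real_pos[of "a / 2"] assms by (simp add: ennreal_mult)
qed

text \<open>By independence row \<open>i\<close> contributes one chi integral and \<open>i\<close>
  Gaussian ones. The dependence of the powers of 2 on \<open>i\<close> cancels within a row, the
  powers of pi add up to q (q - 1) / 4, and the Gamma values form the multivariate Gamma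
  function.\<close>

lemma nn_integral_bartlett:
  assumes \<nu>: "\<nu> > real q - 1"
  shows "(\<integral>\<^sup>+y. ennreal (bartlett q \<nu> y) \<partial>low_lebesgue q) = ennreal (wishart_const q \<nu> / 2 ^ q)"
proof -
  interpret product_sigma_finite "\<lambda>_ :: nat \<times> nat. lborel :: real measure" by standard
  let ?b = "\<lambda>(i, j) t. if i = j then ennreal (t powr (\<nu> - real i - 1) * exp (- t\<^sup>2 / 2)) * indicator {0<..} t
     else ennreal (exp (- t\<^sup>2 / 2))"
  have "(\<integral>\<^sup>+y. ennreal (bartlett q \<nu> y) \<partial>low_lebesgue q) = (\<integral>\<^sup>+y. ennreal (bartlett q \<nu> y) * indicator (low_pos q) y \<partial>coord_lebesgue q)"
    by (rule nn_integral_low_lebesgue) simp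
  also have "\<dots> = (\<integral>\<^sup>+y. (\<Prod>ij\<in>low q. ?b ij (y ij)) \<partial>coord_lebesgue q)"
  proof (rule nn_integral_cong)
    fix y :: "nat \<times> nat \<Rightarrow> real"
    have "bartlett q \<nu> y = (\<Prod>ij\<in>low q. (if fst ij = snd ij then y ij powr (\<nu> - real (fst ij) - 1) else 1) * exp (- (y ij)\<^sup>2 / 2))"
    proof -
      have "(\<Prod>ij\<in>low q. if fst ij = snd ij then y ij powr (\<nu> - real (fst ij) - 1) else 1) = (\<Prod>i<q. y (i, i) powr (\<nu> - real i - 1))"
        unfolding prod_low by (intro prod.cong) (auto simp: lessThan_Suc_atMost[symmetric])
      moreover have "(\<Prod>ij\<in>low q. exp (- (y ij)\<^sup>2 / 2)) = exp (- (\<Sum>ij\<in>low q. (y ij)\<^sup>2) / 2)"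
        by (simp add: exp_sum[OF finite_low, symmetric] sum_negf sum_divide_distrib)
      ultimately show ?thesis by (simp add: bartlett_def prod.distrib)
    qed
    then have "ennreal (bartlett q \<nu> y) * indicator (low_pos q) y =
      (\<Prod>ij\<in>low q. ennreal ((if fst ij = snd ij then y ij powr (\<nu> - real (fst ij) - 1) else 1) * exp (- (y ij)\<^sup>2 / 2)) * indicator (low_dom ij) (y ij))"
      by (simp only: prod.distrib prod_indicator_low_dom) (subst prod_ennreal, auto simp: prod.distrib)
    also have "\<dots> = (\<Prod>ij\<in>low q. ?b ij (y ij))"
      by (intro prod.cong) (auto simp: low_dom_def)
    finally show "ennreal (bartlett q \<nu> y) * indicator (low_pos q) y = (\<Prod>ij\<in>low q. ?b ij (y ij))" .
  qed
  also have "\<dots> = (\<Prod>ij\<in>low q. \<integral>\<^sup>+t. ?b ij t \<partial>lborel)"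
    by (rule product_nn_integral_prod[OF finite_low]) auto
  also have "\<dots> = (\<Prod>ij\<in>low q. ennreal (if fst ij = snd ij then 2 powr ((\<nu> - real (fst ij)) / 2 - 1) * Gamma ((\<nu> - real (fst ij)) / 2) else sqrt (2 * pi)))"
  proof (rule prod.cong)
    fix ij assume "ij \<in> low q"
    then obtain i j where ij: "ij = (i, j)" "j \<le> i" "i < q" by auto
    show "(\<integral>\<^sup>+t. ?b ij t \<partial>lborel) = ennreal (if fst ij = snd ij then 2 powr ((\<nu> - real (fst ij)) / 2 - 1) * Gamma ((\<nu> - real (fst ij)) / 2) else sqrt (2 * pi))"
    proof (cases "i = j")
      case True
      have "\<nu> - real i > 0" using \<nu> ij by linarith
      from nn_integral_chi[OF this] show ?thesis using True ij by simp
    next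
      case False
      then show ?thesis using ij nn_integral_gaussian by simp
    qed
  qed simp
  also have "\<dots> = ennreal (\<Prod>ij\<in>low q. (if fst ij = snd ij then 2 powr ((\<nu> - real (fst ij)) / 2 - 1) * Gamma ((\<nu> - real (fst ij)) / 2) else sqrt (2 * pi)))"
  proof (rule prod_ennreal)
    fix ij assume "ij \<in> low q"
    then have "(\<nu> - real (fst ij)) / 2 > 0" using \<nu> by auto
    from Gamma_real_pos[OF this] show "(if fst ij = snd ij then 2 powr ((\<nu> - real (fst ij)) / 2 - 1) * Gamma ((\<nu> - real (fst ij)) / 2) else sqrt (2 * pi)) \<ge> 0"
      by (auto intro!: mult_nonneg_nonneg dest: less_imp_le)
  qed
  also have "(\<Prod>ij\<in>low q. (if fst ij = snd ij then 2 powr ((\<nu> - real (fst ij)) / 2 - 1) * Gamma ((\<nu> - real (fst ij)) / 2) else sqrt (2 * pi))) =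
     (\<Prod>i<q. 2 powr ((\<nu> - real i) / 2 - 1) * Gamma ((\<nu> - real i) / 2) * sqrt (2 * pi) ^ i)"
    unfolding prod_low by (intro prod.cong) (auto simp: lessThan_Suc_atMost[symmetric])
  also have "\<dots> = (\<Prod>i<q. 2 powr (\<nu> / 2 - 1) * pi powr (real i / 2) * Gamma (\<nu> / 2 - real i / 2))"
  proof (rule prod.cong)
    fix i
    have "sqrt (2 * pi) ^ i = 2 powr (real i / 2) * pi powr (real i / 2)"
      by (simp add: powr_half_sqrt[symmetric] powr_powr powr_realpow[symmetric] powr_mult)
    then have "2 powr ((\<nu> - real i) / 2 - 1) * sqrt (2 * pi) ^ i = 2 powr (\<nu> / 2 - 1) * pi powr (real i / 2)"
      by (simp add: mult.assoc[symmetric] powr_add[symmetric] diff_divide_distrib)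
    then show "2 powr ((\<nu> - real i) / 2 - 1) * Gamma ((\<nu> - real i) / 2) * sqrt (2 * pi) ^ i = 2 powr (\<nu> / 2 - 1) * pi powr (real i / 2) * Gamma (\<nu> / 2 - real i / 2)"
      by (simp add: diff_divide_distrib mult_ac)
  qed simp
  also have "\<dots> = wishart_const q \<nu> / 2 ^ q"
  proof -
    have "(\<Prod>i<q. 2 powr (\<nu> / 2 - 1)) = 2 powr (\<nu> * real q / 2) / (2 ^ q :: real)"
    proof -
      have "(\<Prod>i<q. 2 powr (\<nu> / 2 - 1)) = (2 powr (\<nu> / 2 - 1)) powr real q" by (simp add: powr_realpow)
      also have "\<dots> = 2 powr (\<nu> * real q / 2 - real q)" by (simp add: powr_powr algebra_simps)
      finally show ?thesis by (simp add: powr_diff powr_realpow)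
    qed
    moreover have "(\<Prod>i<q. pi powr (real i / 2)) = pi powr (real q * (real q - 1) / 4)"
    proof -
      have "(\<Sum>i<q. real i) = real q * (real q - 1) / 2" by (induction q) (auto simp: field_simps)
      then have "(\<Sum>i<q. real i / 2) = real q * (real q - 1) / 4" by (simp add: sum_divide_distrib[symmetric])
      then have "pi powr (\<Sum>i<q. real i / 2) = pi powr (real q * (real q - 1) / 4)" by (rule arg_cong)
      then show ?thesis by (subst (asm) powr_sum) auto
    qed
    ultimately show ?thesis by (simp add: prod.distrib wishart_const_def multivariate_Gamma_def)
  qed
  finally show ?thesis .
qed

lemma sets_wishart[measurable_cong]: "sets (wishart q \<nu>) = sets (pd_borel q)"
  by (simp add: wishart_def sets_pd_lebesgue)

text \<open>The point at which the exact constant counts: the conditional law has to be a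
  probability kernel and not merely proportional to one.\<close>

lemma wishart_prob_algebra:
  assumes \<nu>: "\<nu> > real q - 1"
  shows "wishart q \<nu> \<in> space (prob_algebra (pd_borel q))"
proof -
  have c: "wishart_const q \<nu> > 0" by (rule wishart_const_pos[OF \<nu>])
  have "(\<integral>\<^sup>+S. 1 \<partial>wishart q \<nu>) = (\<integral>\<^sup>+y. 1 * ennreal (2 ^ q / wishart_const q \<nu> * bartlett q \<nu> y) \<partial>low_lebesgue q)"
    by (rule nn_integral_wishart[OF \<nu>]) auto
  also have "\<dots> = (\<integral>\<^sup>+y. ennreal (2 ^ q / wishart_const q \<nu>) * ennreal (bartlett q \<nu> y) \<partial>low_lebesgue q)"
    using c by (intro nn_integral_cong) (simp only: mult_1 ennreal_mult[OF divide_nonneg_pos bartlett_nonneg] zero_le_power zero_le_numeral)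
  also have "\<dots> = ennreal (2 ^ q / wishart_const q \<nu>) * ennreal (wishart_const q \<nu> / 2 ^ q)"
    by (subst nn_integral_cmult) (auto simp: nn_integral_bartlett[OF \<nu>] measurable_cong_sets[OF sets_low_lebesgue refl])
  also have "\<dots> = 1" using c by (simp add: ennreal_mult[symmetric])
  finally have "emeasure (wishart q \<nu>) (space (wishart q \<nu>)) = 1" by simp
  then show ?thesis
    by (auto simp: space_prob_algebra sets_wishart intro!: prob_spaceI)
qed

section \<open>The substitutions from scale and shape to the Cholesky factor\<close>

lemma coord_dom_measurable:
  assumes "ij \<in> low q"
  shows "Measurable.pred (coord_lebesgue q) (\<lambda>x. x ij \<in> low_dom ij)"
  using measurable_compose[OF measurable_coord[OF assms], of "\<lambda>t. t \<in> low_dom ij" "count_space UNIV"]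
    low_dom_borel[of ij] by (simp add: pred_def)

text \<open>When positivity of the diagonal is the only constraint before and after the
  substitution, the indicators on both sides are absorbed into \<open>low_lebesgue\<close>.\<close>

lemma nn_integral_low_low:
  assumes T: "triangular_substitution (low q) r g J (\<lambda>ij x. x ij \<in> low_dom ij) low_dom"
    and F: "F \<in> borel_measurable (coord_lebesgue q)"
  shows "(\<integral>\<^sup>+x. F (\<lambda>ij\<in>low q. g ij x) * (\<Prod>ij\<in>low q. J ij x) \<partial>low_lebesgue q) = (\<integral>\<^sup>+x. F x \<partial>low_lebesgue q)"
proof -
  interpret triangular_substitution "low q" r g J "\<lambda>ij x. x ij \<in> low_dom ij" low_dom by (rule T)
  have "(\<lambda>x. \<lambda>ij\<in>low q. g ij x) \<in> measurable (coord_lebesgue q) (coord_lebesgue q)"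
    by (rule measurable_restrict) (use meas_g in simp)
  then have "(\<lambda>x. F (\<lambda>ij\<in>low q. g ij x) * (\<Prod>ij\<in>low q. J ij x)) \<in> borel_measurable (coord_lebesgue q)"
    by (intro borel_measurable_times_ennreal borel_measurable_prod_ennreal meas_J measurable_compose[OF _ F])
  note 1 = nn_integral_low_lebesgue[OF this]
  have "(\<Prod>ij\<in>low q. J ij x * of_bool (x ij \<in> low_dom ij)) = (\<Prod>ij\<in>low q. J ij x) * indicator (low_pos q) x" for x
    unfolding prod.distrib low_pos_of_bool ..
  then show ?thesis
    unfolding 1 using nn_integral_low_substitution[OF T F] by (simp only: mult.assoc)
qed

lemma origin_in_low: "q \<ge> 1 \<Longrightarrow> (0, 0) \<in> low q"
  by auto

text \<open>Position \<open>(0, 0)\<close> holds the scale here. It comes first in row-major order,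
  so multiplying the other entries by it is triangular.\<close>

lemma triangular_scale:
  assumes q: "q \<ge> 1"
  shows "triangular_substitution (low q) (\<lambda>(i, j). i * q + j)
     (\<lambda>ij x. if ij = (0, 0) then x (0, 0) else x (0, 0) * x ij)
     (\<lambda>ij x. if ij = (0, 0) then 1 else ennreal (x (0, 0)))
     (\<lambda>ij x. x ij \<in> low_dom ij) low_dom"
proof
  show "finite (low q)" by (rule finite_low)
  show "inj_on (\<lambda>(i, j). i * q + j) (low q)" by (rule rank_rows_inj)
  fix ij assume ij: "ij \<in> low q"
  note m = measurable_coord[OF ij] measurable_coord[OF origin_in_low[OF q]]
  have rank: "(case (0, 0) of (i, j) \<Rightarrow> i * q + j) \<le> (case ij of (i, j) \<Rightarrow> i * q + j)" by simp
  {
    fix x y :: "nat \<times> nat \<Rightarrow> real"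
    assume "\<And>a. a \<in> low q \<Longrightarrow> (case a of (i, j) \<Rightarrow> i * q + j) \<le> (case ij of (i, j) \<Rightarrow> i * q + j) \<Longrightarrow> x a = y a"
    from this[OF ij order_refl] this[OF origin_in_low[OF q] rank]
    show "(if ij = (0, 0) then x (0, 0) else x (0, 0) * x ij) = (if ij = (0, 0) then y (0, 0) else y (0, 0) * y ij)"
      "(if ij = (0, 0) then 1 else ennreal (x (0, 0))) = (if ij = (0, 0) then 1 else ennreal (y (0, 0)))"
      "(x ij \<in> low_dom ij) = (y ij \<in> low_dom ij)" by auto
  }
  show "(\<lambda>x. if ij = (0, 0) then x (0, 0) else x (0, 0) * x ij) \<in> borel_measurable (coord_lebesgue q)"
    using m by (cases "ij = (0, 0)") simp_all
  show "(\<lambda>x. if ij = (0, 0) then 1 else ennreal (x (0, 0))) \<in> borel_measurable (coord_lebesgue q)"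
    using measurable_compose[OF m(2) measurable_ennreal]
    by (cases "ij = (0, 0)") simp_all
  show "Measurable.pred (coord_lebesgue q) (\<lambda>x. x ij \<in> low_dom ij)" by (rule coord_dom_measurable[OF ij])
  show "low_dom ij \<in> sets borel" by (rule low_dom_borel)
  fix x :: "nat \<times> nat \<Rightarrow> real" and h :: "real \<Rightarrow> ennreal"
  assume D: "\<And>a. a \<in> low q \<Longrightarrow> (case a of (i, j) \<Rightarrow> i * q + j) < (case ij of (i, j) \<Rightarrow> i * q + j) \<Longrightarrow> x a \<in> low_dom a"
    and h: "h \<in> borel_measurable borel"
  show "(\<integral>\<^sup>+t. h (if ij = (0, 0) then (x(ij := t)) (0, 0) else (x(ij := t)) (0, 0) * (x(ij := t)) ij) *
      ((if ij = (0, 0) then 1 else ennreal ((x(ij := t)) (0, 0))) * of_bool ((x(ij := t)) ij \<in> low_dom ij)) \<partial>lborel) =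
    (\<integral>\<^sup>+s. h s * indicator (low_dom ij) s \<partial>lborel)"
  proof (cases "ij = (0, 0)")
    case True
    then show ?thesis by (simp add: indicator_def of_bool_def)
  next
    case False
    then have "(case (0, 0) of (i, j) \<Rightarrow> i * q + j) < (case ij of (i, j) \<Rightarrow> i * q + j)"
      using ij q by (auto split: prod.split)
    from D[OF origin_in_low[OF q] this] have a: "x (0, 0) > 0" by (simp add: low_dom_def)
    show ?thesis
    proof (cases "fst ij = snd ij")
      case True
      then have "low_dom ij = {0<..}" by (cases ij) (auto simp: low_dom_def)
      then show ?thesis using nn_integral_subst_scale[OF a h] False by simp
    next
      case nd: False
      then have "low_dom ij = UNIV" by (cases ij) (auto simp: low_dom_def)
      then show ?thesis using nn_integral_subst_affine[of "x (0, 0)" h 0] a h False by simp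
    qed
  qed
qed

text \<open>Row-major order with \<open>(0, 0)\<close> moved to the end, which works because all
  row-major ranks are below \<open>q * q\<close>.\<close>

definition rank_origin_last :: "nat \<Rightarrow> nat \<times> nat \<Rightarrow> nat" where
  "rank_origin_last q ij = (if ij = (0, 0) then q * q else fst ij * q + snd ij)"

lemma rank_origin_last_less:
  assumes "ij \<in> low q" "ij \<noteq> (0, 0)"
  shows "rank_origin_last q ij < rank_origin_last q (0, 0)"
proof -
  obtain i j where ij: "ij = (i, j)" "j \<le> i" "i < q" using assms by auto
  then have "i * q + j < q * q + 0" by (intro rank_rows_less) auto
  then show ?thesis using ij assms by (auto simp: rank_origin_last_def)
qed

text \<open>The determinant \<open>\<sigma>\<^sup>q\<close> of the scaled matrix replaces \<open>\<sigma>\<close> as the last free coordinate.\<close>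
lemma triangular_det:
  assumes q: "q \<ge> 1"
  shows "triangular_substitution (low q) (rank_origin_last q)
     (\<lambda>ij y. if ij = (0, 0) then inverse (\<Prod>l\<in>{1..<q}. y (l, l)) * y (0, 0) ^ q else y ij)
     (\<lambda>ij y. if ij = (0, 0) then ennreal (inverse (\<Prod>l\<in>{1..<q}. y (l, l)) * (real q * y (0, 0) ^ (q - 1))) else 1)
     (\<lambda>ij x. x ij \<in> low_dom ij) low_dom"
proof
  show "finite (low q)" by (rule finite_low)
  show "inj_on (rank_origin_last q) (low q)"
  proof (rule inj_onI)
    fix a b assume ab: "a \<in> low q" "b \<in> low q" and eq: "rank_origin_last q a = rank_origin_last q b"
    show "a = b"
    proof (cases "a = (0, 0) \<or> b = (0, 0)")
      case True
      then show ?thesis using rank_origin_last_less[OF ab(1)] rank_origin_last_less[OF ab(2)] eq by fastforce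
    next
      case False
      then have "(\<lambda>(i, j). i * q + j) a = (\<lambda>(i, j). i * q + j) b" using eq by (simp add: rank_origin_last_def split_beta)
      then show ?thesis using inj_onD[OF rank_rows_inj] ab by blast
    qed
  qed
  fix ij assume ij: "ij \<in> low q"
  have le: "rank_origin_last q a \<le> rank_origin_last q (0, 0)" if "a \<in> low q" for a
    using rank_origin_last_less[OF that] by (cases "a = (0, 0)") auto
  {
    fix x y :: "nat \<times> nat \<Rightarrow> real"
    assume eq: "\<And>a. a \<in> low q \<Longrightarrow> rank_origin_last q a \<le> rank_origin_last q ij \<Longrightarrow> x a = y a"
    have xy: "x ij = y ij" using eq ij by auto
    have all: "x a = y a" if "ij = (0, 0)" "a \<in> low q" for a using eq le that by auto
    have p: "(\<Prod>l\<in>{1..<q}. x (l, l)) = (\<Prod>l\<in>{1..<q}. y (l, l))" if "ij = (0, 0)"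
      using all[OF that] by (intro prod.cong) auto
    show "(if ij = (0, 0) then inverse (\<Prod>l\<in>{1..<q}. x (l, l)) * x (0, 0) ^ q else x ij) =
       (if ij = (0, 0) then inverse (\<Prod>l\<in>{1..<q}. y (l, l)) * y (0, 0) ^ q else y ij)"
      "(if ij = (0, 0) then ennreal (inverse (\<Prod>l\<in>{1..<q}. x (l, l)) * (real q * x (0, 0) ^ (q - 1))) else 1) =
       (if ij = (0, 0) then ennreal (inverse (\<Prod>l\<in>{1..<q}. y (l, l)) * (real q * y (0, 0) ^ (q - 1))) else 1)"
      "(x ij \<in> low_dom ij) = (y ij \<in> low_dom ij)"
      using xy p by auto
  }
  have pm: "(\<lambda>y. inverse (\<Prod>l\<in>{1..<q}. y (l, l))) \<in> borel_measurable (coord_lebesgue q)"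
    by (intro borel_measurable_inverse borel_measurable_prod measurable_coord) auto
  note m = measurable_coord[OF ij] measurable_coord[OF origin_in_low[OF q]]
  have g: "(\<lambda>y. inverse (\<Prod>l\<in>{1..<q}. y (l, l)) * y (0, 0) ^ q) \<in> borel_measurable (coord_lebesgue q)"
    by (intro borel_measurable_times pm borel_measurable_power m(2))
  have j: "(\<lambda>y. inverse (\<Prod>l\<in>{1..<q}. y (l, l)) * (real q * y (0, 0) ^ (q - 1))) \<in> borel_measurable (coord_lebesgue q)"
    by (intro borel_measurable_times pm borel_measurable_power m(2) borel_measurable_const)
  show "(\<lambda>y. if ij = (0, 0) then inverse (\<Prod>l\<in>{1..<q}. y (l, l)) * y (0, 0) ^ q else y ij) \<in> borel_measurable (coord_lebesgue q)"
    using g m by (cases "ij = (0, 0)") simp_all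
  show "(\<lambda>y. if ij = (0, 0) then ennreal (inverse (\<Prod>l\<in>{1..<q}. y (l, l)) * (real q * y (0, 0) ^ (q - 1))) else 1) \<in> borel_measurable (coord_lebesgue q)"
    using measurable_compose[OF j measurable_ennreal]
    by (cases "ij = (0, 0)") simp_all
  show "Measurable.pred (coord_lebesgue q) (\<lambda>x. x ij \<in> low_dom ij)" by (rule coord_dom_measurable[OF ij])
  show "low_dom ij \<in> sets borel" by (rule low_dom_borel)
  fix x :: "nat \<times> nat \<Rightarrow> real" and h :: "real \<Rightarrow> ennreal"
  assume D: "\<And>a. a \<in> low q \<Longrightarrow> rank_origin_last q a < rank_origin_last q ij \<Longrightarrow> x a \<in> low_dom a"
    and h: "h \<in> borel_measurable borel"
  show "(\<integral>\<^sup>+t. h (if ij = (0, 0) then inverse (\<Prod>l\<in>{1..<q}. (x(ij := t)) (l, l)) * (x(ij := t)) (0, 0) ^ q else (x(ij := t)) ij) *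
      ((if ij = (0, 0) then ennreal (inverse (\<Prod>l\<in>{1..<q}. (x(ij := t)) (l, l)) * (real q * (x(ij := t)) (0, 0) ^ (q - 1))) else 1) *
        of_bool ((x(ij := t)) ij \<in> low_dom ij)) \<partial>lborel) =
    (\<integral>\<^sup>+s. h s * indicator (low_dom ij) s \<partial>lborel)"
  proof (cases "ij = (0, 0)")
    case False
    then show ?thesis by (simp add: indicator_def of_bool_def)
  next
    case True
    define a where "a = inverse (\<Prod>l\<in>{1..<q}. x (l, l))"
    have "x (l, l) > 0" if "l \<in> {1..<q}" for l
      using D[of "(l, l)"] rank_origin_last_less[of "(l, l)" q] that True by (auto simp: low_dom_def)
    then have a: "a > 0" by (auto simp: a_def intro!: prod_pos)
    have "(\<Prod>l\<in>{1..<q}. (x((0, 0) := t)) (l, l)) = (\<Prod>l\<in>{1..<q}. x (l, l))" for t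
      by (intro prod.cong) auto
    then have p: "inverse (\<Prod>l\<in>{1..<q}. (x((0, 0) := t)) (l, l)) = a" for t by (simp only: a_def)
    show ?thesis unfolding True using nn_integral_subst_power[OF a q h]
      by (simp only: p if_True refl) (simp add: low_dom_def)
  qed
qed

text \<open>Forward substitution for the entries of U^(-1) R on and below the diagonal, where
  \<open>u\<close> holds the entries of the lower triangular \<open>U\<close>. The recursion
  displays which entries of \<open>U\<close> each of them needs.\<close>

fun solve_low :: "real mat \<Rightarrow> (nat \<times> nat \<Rightarrow> real) \<Rightarrow> nat \<Rightarrow> nat \<Rightarrow> real" where
  "solve_low R u i j = (R $$ (i, j) - (\<Sum>l\<in>{j..<i}. u (i, l) * solve_low R u l j)) / u (i, i)"

declare solve_low.simps[simp del]

lemma solve_low_diag: "solve_low R u i i = R $$ (i, i) / u (i, i)"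
  by (subst solve_low.simps) simp

text \<open>Isolates \<open>u (i, j)\<close>, which occurs only in the summand \<open>l = j\<close>,
  multiplied by the diagonal entry \<open>R_jj / u_jj\<close> of the solution. The rest involves
  earlier rows and, in row \<open>i\<close>, only columns to the right of \<open>j\<close>.\<close>

lemma solve_low_below:
  assumes "j < i"
  shows "solve_low R u i j = (R $$ (i, j) - (\<Sum>l\<in>{j<..<i}. u (i, l) * solve_low R u l j)) / u (i, i)
     + - (R $$ (j, j) / (u (j, j) * u (i, i))) * u (i, j)"
proof -
  have "{j..<i} = insert j {j<..<i}" using assms by auto
  then show ?thesis
    by (subst solve_low.simps) (simp add: solve_low_diag diff_divide_distrib add_divide_distrib)
qed

lemma solve_low_cong:
  assumes "j \<le> i" "\<And>c d. j \<le> d \<Longrightarrow> d \<le> c \<Longrightarrow> c < i \<or> c = i \<and> j \<le> d \<Longrightarrow> x (c, d) = y (c, d)"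
  shows "solve_low R x i j = solve_low R y i j"
  using assms
proof (induction i rule: less_induct)
  case (less i)
  have "(\<Sum>l\<in>{j..<i}. x (i, l) * solve_low R x l j) = (\<Sum>l\<in>{j..<i}. y (i, l) * solve_low R y l j)"
  proof (rule sum.cong)
    fix l assume l: "l \<in> {j..<i}"
    have "solve_low R x l j = solve_low R y l j" using l by (intro less.IH less.prems(2)) auto
    moreover have "x (i, l) = y (i, l)" using l by (intro less.prems(2)) auto
    ultimately show "x (i, l) * solve_low R x l j = y (i, l) * solve_low R y l j" by simp
  qed simp
  moreover have "x (i, i) = y (i, i)" using less.prems(1) by (intro less.prems(2)) auto
  ultimately show ?case by (simp only: solve_low.simps[of R _ i j])
qed

lemma solve_low_measurable:
  assumes "j \<le> i" "i < q"
  shows "(\<lambda>x. solve_low R x i j) \<in> borel_measurable (coord_lebesgue q)"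
  using assms
proof (induction i rule: less_induct)
  case (less i)
  show ?case
    unfolding solve_low.simps[of R _ i j]
    by (intro borel_measurable_divide borel_measurable_diff borel_measurable_sum borel_measurable_times
        borel_measurable_const measurable_coord less.IH) (use less.prems in auto)
qed

lemma low_mat_solve_low:
  assumes u: "u \<in> low_pos q" and R: "R \<in> carrier_mat q q" "lower_triangular R"
  shows "low_mat q (\<lambda>(i, j). solve_low R u i j) = mat_inv (low_mat q u) * R"
proof -
  let ?U = "low_mat q u" and ?V = "low_mat q (\<lambda>(i, j). solve_low R u i j)"
  have pos: "u (i, i) > 0" if "i < q" for i using u that by (auto simp: low_pos_def)
  then have d: "det ?U \<noteq> 0" using det_lower_pos[of ?U q] by (simp add: pos_diag_low_mat)
  note Ui = mat_inv[OF low_mat_carrier(1) d]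
  have "?U * ?V = R"
  proof (rule eq_matI)
    fix i j assume "i < dim_row R" "j < dim_col R"
    then have ij: "i < q" "j < q" using R by auto
    have "(?U * ?V) $$ (i, j) = (\<Sum>l=0..<q. (if l \<le> i then u (i, l) else 0) * (if j \<le> l then solve_low R u l j else 0))"
      using ij by (simp add: scalar_prod_def cong: if_cong)
    also have "\<dots> = (\<Sum>l\<in>{j..i}. u (i, l) * solve_low R u l j)"
      using ij by (intro sum.mono_neutral_cong_right) auto
    also have "\<dots> = R $$ (i, j)"
    proof (cases "j \<le> i")
      case True
      then have "{j..i} = insert i {j..<i}" by auto
      then show ?thesis using pos[OF ij(1)]
        by simp (subst solve_low.simps, simp)
    next
      case False
      then show ?thesis using R ij by (simp add: lower_triangular_def)
    qed
    finally show "(?U * ?V) $$ (i, j) = R $$ (i, j)" .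
  qed (use R in auto)
  then have "mat_inv ?U * R = mat_inv ?U * (?U * ?V)" by simp
  also have "\<dots> = ?V" using Ui by (simp flip: assoc_mult_mat[of _ q q _ q _ q])
  finally show ?thesis by simp
qed

text \<open>Each row is ordered from the diagonal leftwards, since the entry of U^(-1) R at
  \<open>(i, j)\<close> needs \<open>u (i, l)\<close> for \<open>l\<close> from \<open>j\<close> up
  to \<open>i\<close>.\<close>

lemma rank_rows_rev_inj: "inj_on (\<lambda>(i, j). i * q + (i - j)) (low q)"
proof (rule inj_onI)
  fix x y :: "nat \<times> nat"
  assume xy: "x \<in> low q" "y \<in> low q" and eq: "(case x of (i, j) \<Rightarrow> i * q + (i - j)) = (case y of (i, j) \<Rightarrow> i * q + (i - j))"
  obtain a b c d where x: "x = (a, b)" and y: "y = (c, d)" by (cases x, cases y)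
  have h: "b \<le> a" "a < q" "d \<le> c" "c < q" using xy x y by auto
  have e: "a * q + (a - b) = c * q + (c - d)" using eq unfolding x y prod.case .
  have "a - b < q" "c - d < q" using h by auto
  then have "(a * q + (a - b)) div q = a" "(c * q + (c - d)) div q = c" by auto
  then have ac: "a = c" using e by metis
  then have "a - b = a - d" using e by simp
  then show "x = y" using h ac x y by simp
qed

text \<open>One formula covers both kinds of position: below the diagonal it is the absolute slope
  of an affine map, and for \<open>j = i\<close> it becomes \<open>R_ii / u_ii\<^sup>2\<close>, the
  absolute derivative of \<open>R_ii / u_ii\<close>.\<close>

lemma triangular_solve_low:
  assumes R: "R \<in> carrier_mat q q" "pos_diag R"
  shows "triangular_substitution (low q) (\<lambda>(i, j). i * q + (i - j))
     (\<lambda>ij x. solve_low R x (fst ij) (snd ij))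
     (\<lambda>ij x. ennreal (R $$ (snd ij, snd ij) / (x (snd ij, snd ij) * x (fst ij, fst ij))))
     (\<lambda>ij x. x ij \<in> low_dom ij) low_dom"
proof
  show "finite (low q)" by (rule finite_low)
  show "inj_on (\<lambda>(i, j). i * q + (i - j)) (low q)" by (rule rank_rows_rev_inj)
  fix ij :: "nat \<times> nat" assume "ij \<in> low q"
  then obtain i j where ij: "ij = (i, j)" "j \<le> i" "i < q" by auto
  have R_pos: "R $$ (l, l) > 0" if "l < q" for l using R that by (auto simp: pos_diag_def)
  have row_less: "c * q + (c - d) < i * q + (i - j)" if "c < i" for c d
    using that ij by (intro rank_rows_less) auto
  {
    fix x y :: "nat \<times> nat \<Rightarrow> real"
    assume eq: "\<And>a. a \<in> low q \<Longrightarrow> (case a of (i, j) \<Rightarrow> i * q + (i - j)) \<le> (case ij of (i, j) \<Rightarrow> i * q + (i - j)) \<Longrightarrow> x a = y a"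
    have eq': "x (c, d) = y (c, d)" if "d \<le> c" "c < i \<or> c = i \<and> j \<le> d" for c d
    proof (rule eq)
      show "(case (c, d) of (i, j) \<Rightarrow> i * q + (i - j)) \<le> (case ij of (i, j) \<Rightarrow> i * q + (i - j))"
        using that row_less[of c d] ij by auto
    qed (use that ij in auto)
    have "solve_low R x i j = solve_low R y i j" using ij eq' by (intro solve_low_cong) auto
    then show "solve_low R x (fst ij) (snd ij) = solve_low R y (fst ij) (snd ij)" using ij by simp
    have d: "x (j, j) = y (j, j)" "x (i, i) = y (i, i)" using ij eq'[of j j] eq'[of i i] by (auto simp: le_less)
    then show "ennreal (R $$ (snd ij, snd ij) / (x (snd ij, snd ij) * x (fst ij, fst ij))) =
      ennreal (R $$ (snd ij, snd ij) / (y (snd ij, snd ij) * y (fst ij, fst ij)))" using ij by simp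
    show "(x ij \<in> low_dom ij) = (y ij \<in> low_dom ij)" using ij eq'[of j i] by simp
  }
  show "(\<lambda>x. solve_low R x (fst ij) (snd ij)) \<in> borel_measurable (coord_lebesgue q)"
    using ij solve_low_measurable by simp
  show "(\<lambda>x. ennreal (R $$ (snd ij, snd ij) / (x (snd ij, snd ij) * x (fst ij, fst ij)))) \<in> borel_measurable (coord_lebesgue q)"
    using ij by (intro measurable_compose[OF _ measurable_ennreal] borel_measurable_divide borel_measurable_times borel_measurable_const measurable_coord) auto
  show "Measurable.pred (coord_lebesgue q) (\<lambda>x. x ij \<in> low_dom ij)" by (rule coord_dom_measurable) (use ij in auto)
  show "low_dom ij \<in> sets borel" by (rule low_dom_borel)
  fix x :: "nat \<times> nat \<Rightarrow> real" and h :: "real \<Rightarrow> ennreal"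
  assume D: "\<And>a. a \<in> low q \<Longrightarrow> (case a of (i, j) \<Rightarrow> i * q + (i - j)) < (case ij of (i, j) \<Rightarrow> i * q + (i - j)) \<Longrightarrow> x a \<in> low_dom a"
    and h: "h \<in> borel_measurable borel"
  show "(\<integral>\<^sup>+t. h (solve_low R (x(ij := t)) (fst ij) (snd ij)) *
      (ennreal (R $$ (snd ij, snd ij) / ((x(ij := t)) (snd ij, snd ij) * (x(ij := t)) (fst ij, fst ij))) *
        of_bool ((x(ij := t)) ij \<in> low_dom ij)) \<partial>lborel) = (\<integral>\<^sup>+s. h s * indicator (low_dom ij) s \<partial>lborel)"
  proof (cases "j = i")
    case True
    then show ?thesis using nn_integral_subst_inverse[OF R_pos[OF ij(3)] h]
      by (simp add: ij solve_low_diag low_dom_def power2_eq_square)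
  next
    case False
    then have lt: "j < i" using ij by simp
    have xj: "x (j, j) > 0" using D[of "(j, j)"] row_less[OF lt, of j] lt ij by (auto simp: low_dom_def)
    have xi: "x (i, i) > 0" using D[of "(i, i)"] lt ij by (auto simp: low_dom_def)
    define b where "b = (R $$ (i, j) - (\<Sum>l\<in>{j<..<i}. x (i, l) * solve_low R x l j)) / x (i, i)"
    define a where "a = R $$ (j, j) / (x (j, j) * x (i, i))"
    have a: "a > 0" using xj xi R_pos[of j] ij by (simp add: a_def)
    have g: "solve_low R (x((i, j) := t)) i j = b + (- a) * t" for t
    proof -
      have "(\<Sum>l\<in>{j<..<i}. (x((i, j) := t)) (i, l) * solve_low R (x((i, j) := t)) l j) = (\<Sum>l\<in>{j<..<i}. x (i, l) * solve_low R x l j)"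
      proof (rule sum.cong)
        fix l assume l: "l \<in> {j<..<i}"
        have "solve_low R (x((i, j) := t)) l j = solve_low R x l j" using l by (intro solve_low_cong) auto
        then show "(x((i, j) := t)) (i, l) * solve_low R (x((i, j) := t)) l j = x (i, l) * solve_low R x l j" using l by simp
      qed simp
      then show ?thesis using lt by (simp only: solve_low_below[OF lt]) (simp add: a_def b_def)
    qed
    have "(\<integral>\<^sup>+t. h (b + (- a) * t) * ennreal \<bar>- a\<bar> \<partial>lborel) = (\<integral>\<^sup>+s. h s \<partial>lborel)"
      by (rule nn_integral_subst_affine) (use a h in auto)
    moreover have "R $$ (j, j) / ((x((i, j) := t)) (j, j) * (x((i, j) := t)) (i, i)) = a" for t
      using lt by (simp add: a_def)
    moreover have "low_dom ij = UNIV" using ij lt by (simp add: low_dom_def)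
    ultimately show ?thesis using a by (simp only: ij fst_conv snd_conv g) simp
  qed
qed

section \<open>Lebesgue measure on the unimodular lower triangular group\<close>

abbreviation shape_idx :: "nat \<Rightarrow> (nat \<times> nat) set" where
  "shape_idx q \<equiv> {(i, j). j \<le> i \<and> 1 \<le> i \<and> i < q}"

abbreviation shape_dom :: "nat \<Rightarrow> (nat \<times> nat \<Rightarrow> real) set" where
  "shape_dom q \<equiv> {x. \<forall>i\<in>{1..<q}. x (i, i) > 0}"

abbreviation shape_lebesgue :: "nat \<Rightarrow> (nat \<times> nat \<Rightarrow> real) measure" where
  "shape_lebesgue q \<equiv> (\<Pi>\<^sub>M ij \<in> shape_idx q. lborel)"

lemma finite_shape_idx: "finite (shape_idx q)"
  by (rule finite_subset[OF _ finite_low[of q]]) auto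

lemma low_insert_shape: "q \<ge> 1 \<Longrightarrow> low q = insert (0, 0) (shape_idx q)"
  by auto

lemma measurable_shape_coord:
  "ij \<in> shape_idx q \<Longrightarrow> (\<lambda>x. x ij) \<in> borel_measurable (shape_lebesgue q)"
  using measurable_component_singleton[of ij "shape_idx q" "\<lambda>_. lborel :: real measure"] by simp

lemma shape_dom_sets: "shape_dom q \<inter> space (shape_lebesgue q) \<in> sets (shape_lebesgue q)"
proof -
  have "{x \<in> space (shape_lebesgue q). \<forall>i\<in>{1..<q}. x (i, i) > 0} \<in> sets (shape_lebesgue q)"
    by (intro sets.sets_Collect_finite_All borel_measurable_less borel_measurable_const measurable_shape_coord) auto
  then show ?thesis by (simp only: Int_def mem_Collect_eq conj_commute)
qed

lemma Gplus_of_coords_carrier: "Gplus_of_coords q x \<in> carrier_mat q q"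
  by (simp add: Gplus_of_coords_def)

lemma Gplus_of_coords_in_Gplus:
  assumes "q \<ge> 1" and x: "x \<in> shape_dom q"
  shows "Gplus_of_coords q x \<in> Gplus q"
proof -
  let ?A = "Gplus_of_coords q x"
  have lo: "lower_triangular ?A" by (auto simp: lower_triangular_def Gplus_of_coords_def)
  have pd: "pos_diag ?A" using x by (auto simp: pos_diag_def Gplus_of_coords_def intro!: prod_pos)
  have "det ?A = (\<Prod>i<q. ?A $$ (i, i))" by (rule det_lower[OF Gplus_of_coords_carrier lo])
  also have "{..<q} = insert 0 {1..<q}" using assms by auto
  also have "(\<Prod>i\<in>insert 0 {1..<q}. ?A $$ (i, i)) = (\<Prod>l\<in>{1..<q}. inverse (x (l, l))) * (\<Prod>l\<in>{1..<q}. x (l, l))"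
    using assms by (simp add: Gplus_of_coords_def)
  also have "\<dots> = 1"
    unfolding prod.distrib[symmetric] using x by (intro prod.neutral) (auto simp: less_imp_neq[THEN not_sym])
  finally show ?thesis using lo pd Gplus_of_coords_carrier by (auto simp: Gplus_def)
qed

lemma Gplus_of_coords_measurable:
  assumes q: "q \<ge> 1"
  shows "Gplus_of_coords q \<in> measurable (restrict_space (shape_lebesgue q) (shape_dom q)) (Gplus_borel q)"
proof (rule measurable_Gplus_borelI)
  fix i j assume ij: "i < q" "j < q"
  have "(\<lambda>x. Gplus_of_coords q x $$ (i, j)) \<in> borel_measurable (shape_lebesgue q)"
  proof (cases "i < j")
    case True
    then show ?thesis using ij by (simp add: Gplus_of_coords_def)
  next
    case False
    show ?thesis
    proof (cases "i = 0")
      case True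
      have "(\<lambda>x. \<Prod>l\<in>{1..<q}. inverse (x (l, l))) \<in> borel_measurable (shape_lebesgue q)"
        by (intro borel_measurable_prod borel_measurable_inverse measurable_shape_coord) auto
      then show ?thesis using True False ij by (simp add: Gplus_of_coords_def)
    next
      case i: False
      then have "(\<lambda>x. x (i, j)) \<in> borel_measurable (shape_lebesgue q)"
        using False ij by (intro measurable_shape_coord) auto
      then show ?thesis using i False ij by (simp add: Gplus_of_coords_def)
    qed
  qed
  then show "(\<lambda>x. Gplus_of_coords q x $$ (i, j)) \<in> borel_measurable (restrict_space (shape_lebesgue q) (shape_dom q))"
    by (rule measurable_restrict_space1)
qed (use Gplus_of_coords_in_Gplus[OF q] in \<open>auto simp: space_restrict_space\<close>)

lemma sets_Gplus_lebesgue[measurable_cong]: "sets (Gplus_lebesgue q) = sets (Gplus_borel q)"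
  by (simp add: Gplus_lebesgue_def)

lemma space_Gplus_lebesgue: "space (Gplus_lebesgue q) = Gplus q"
  by (simp add: Gplus_lebesgue_def space_Gplus_borel)

lemma nn_integral_Gplus_lebesgue:
  assumes q: "q \<ge> 1" and f: "f \<in> borel_measurable (Gplus_borel q)"
  shows "(\<integral>\<^sup>+A. f A \<partial>Gplus_lebesgue q) =
    (\<integral>\<^sup>+x. f (Gplus_of_coords q x) * indicator (shape_dom q) x \<partial>(shape_lebesgue q))"
  unfolding Gplus_lebesgue_def
  by (subst nn_integral_distr[OF Gplus_of_coords_measurable[OF q]], use f in simp)
    (rule nn_integral_restrict_space[OF shape_dom_sets])

text \<open>Needed for Tonelli over the product of the modes. The exhausting sets bound only the
  free entries; the \<open>(0, 0)\<close> entry may be large on them, but it is not a variable of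
  integration.\<close>

lemma sigma_finite_Gplus_lebesgue:
  assumes q: "q \<ge> 1"
  shows "sigma_finite_measure (Gplus_lebesgue q)"
proof
  interpret product_sigma_finite "\<lambda>_ :: nat \<times> nat. lborel :: real measure" by standard
  let ?B = "\<lambda>n::nat. {A \<in> space (Gplus_borel q). \<forall>ij\<in>shape_idx q. \<bar>A $$ ij\<bar> \<le> real n}"
  have B: "?B n \<in> sets (Gplus_borel q)" for n
  proof (rule sets.sets_Collect_finite_All[OF _ finite_shape_idx])
    fix ij assume "ij \<in> shape_idx q"
    then obtain i j where ij: "ij = (i, j)" "i < q" "j < q" by auto
    show "{A \<in> space (Gplus_borel q). \<bar>A $$ ij\<bar> \<le> real n} \<in> sets (Gplus_borel q)"
      unfolding ij(1)
      by (rule borel_measurable_le[OF borel_measurable_abs[OF measurable_Gplus_index[OF ij(2,3)]] borel_measurable_const])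
  qed
  have fin: "emeasure (Gplus_lebesgue q) (?B n) < \<infinity>" for n
  proof -
    have "emeasure (Gplus_lebesgue q) (?B n) = (\<integral>\<^sup>+A. indicator (?B n) A \<partial>Gplus_lebesgue q)"
      by (rule nn_integral_indicator[symmetric]) (simp only: sets_Gplus_lebesgue B)
    also have "\<dots> = (\<integral>\<^sup>+x. indicator (?B n) (Gplus_of_coords q x) * indicator (shape_dom q) x \<partial>(shape_lebesgue q))"
      by (rule nn_integral_Gplus_lebesgue[OF q borel_measurable_indicator[OF B]])
    also have "\<dots> \<le> (\<integral>\<^sup>+x. (\<Prod>ij\<in>shape_idx q. indicator {- real n..real n} (x ij)) \<partial>(shape_lebesgue q))"
    proof (rule nn_integral_mono)
      fix x :: "nat \<times> nat \<Rightarrow> real"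
      show "indicator (?B n) (Gplus_of_coords q x) * indicator (shape_dom q) x \<le> (\<Prod>ij\<in>shape_idx q. indicator {- real n..real n} (x ij) :: ennreal)"
      proof (cases "Gplus_of_coords q x \<in> ?B n")
        case True
        have "\<bar>x ij\<bar> \<le> real n" if "ij \<in> shape_idx q" for ij
        proof -
          have "Gplus_of_coords q x $$ ij = x ij" using that by (auto simp: Gplus_of_coords_def)
          then show ?thesis using True that by (metis (no_types, lifting) mem_Collect_eq)
        qed
        then have "(\<Prod>ij\<in>shape_idx q. indicator {- real n..real n} (x ij) :: ennreal) = 1"
          by (intro prod.neutral) (auto simp: abs_le_iff minus_le_iff[of _ "real n"])
        then show ?thesis by (simp add: indicator_def)
      qed simp
    qed
    also have "\<dots> = (\<Prod>ij\<in>shape_idx q. \<integral>\<^sup>+t. indicator {- real n..real n} t \<partial>lborel)"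
      by (rule product_nn_integral_prod[OF finite_shape_idx]) auto
    also have "\<dots> = ennreal (2 * real n) ^ card (shape_idx q)" by simp
    also have "\<dots> < \<infinity>" by (simp add: ennreal_power less_top[symmetric])
    finally show ?thesis .
  qed
  have "(\<Union>n. ?B n) = Gplus q"
  proof (intro equalityI subsetI)
    fix A assume A: "A \<in> Gplus q"
    obtain n where "(\<Sum>ij\<in>shape_idx q. \<bar>A $$ ij\<bar>) \<le> real n" using real_arch_simple by blast
    moreover have "\<bar>A $$ ij\<bar> \<le> (\<Sum>ij\<in>shape_idx q. \<bar>A $$ ij\<bar>)" if "ij \<in> shape_idx q" for ij
      by (rule member_le_sum[OF that _ finite_shape_idx]) auto
    ultimately have "A \<in> ?B n" using A by (auto simp: space_Gplus_borel intro: order_trans)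
    then show "A \<in> (\<Union>n. ?B n)" by blast
  qed (auto simp: space_Gplus_borel)
  then show "\<exists>A. countable A \<and> A \<subseteq> sets (Gplus_lebesgue q) \<and> \<Union>A = space (Gplus_lebesgue q) \<and> (\<forall>a\<in>A. emeasure (Gplus_lebesgue q) a \<noteq> \<infinity>)"
  proof (intro exI[of _ "range ?B"] conjI ballI)
    show "range ?B \<subseteq> sets (Gplus_lebesgue q)" using B by (simp only: sets_Gplus_lebesgue image_subset_iff) blast
    show "\<Union> (range ?B) = space (Gplus_lebesgue q)" unfolding space_Gplus_lebesgue by fact
    fix a assume "a \<in> range ?B"
    then obtain n where a: "a = ?B n" by blast
    show "emeasure (Gplus_lebesgue q) a \<noteq> \<infinity>" unfolding a by (rule less_imp_neq[OF fin])
  qed simp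
qed

section \<open>Scale and shape as a Cholesky factor\<close>

definition scale_map :: "nat \<Rightarrow> (nat \<times> nat \<Rightarrow> real) \<Rightarrow> nat \<times> nat \<Rightarrow> real" where
  "scale_map q z = (\<lambda>ij\<in>low q. if ij = (0, 0) then z (0, 0) else z (0, 0) * z ij)"

definition det_map :: "nat \<Rightarrow> (nat \<times> nat \<Rightarrow> real) \<Rightarrow> nat \<times> nat \<Rightarrow> real" where
  "det_map q y = (\<lambda>ij\<in>low q. if ij = (0, 0) then inverse (\<Prod>l\<in>{1..<q}. y (l, l)) * y (0, 0) ^ q else y ij)"

definition solve_map :: "nat \<Rightarrow> real mat \<Rightarrow> (nat \<times> nat \<Rightarrow> real) \<Rightarrow> nat \<times> nat \<Rightarrow> real" where
  "solve_map q R u = (\<lambda>ij\<in>low q. solve_low R u (fst ij) (snd ij))"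

text \<open>The coordinates of (s \<Psi>)^(-1) R, for \<open>z\<close> holding s at
  \<open>(0, 0)\<close> and the free entries of \<Psi> elsewhere.\<close>

definition factor_map :: "nat \<Rightarrow> real mat \<Rightarrow> (nat \<times> nat \<Rightarrow> real) \<Rightarrow> nat \<times> nat \<Rightarrow> real" where
  "factor_map q R z = solve_map q R (det_map q (scale_map q z))"

text \<open>Since det \<Psi> = 1, the determinant of s \<Psi> is s^q. Dividing it by the diagonal
  entries that are scaled already leaves s times the dependent \<open>(0, 0)\<close> entry of
  \<Psi>.\<close>

lemma det_scale_map:
  assumes q: "q \<ge> 1" and z: "z \<in> low_pos q"
  shows "det_map q (scale_map q z) \<in> low_pos q"
    and "low_mat q (det_map q (scale_map q z)) = z (0, 0) \<cdot>\<^sub>m Gplus_of_coords q z"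
    and "i < q \<Longrightarrow> det_map q (scale_map q z) (i, i) = (if i = 0 then z (0, 0) * (\<Prod>l\<in>{1..<q}. inverse (z (l, l))) else z (0, 0) * z (i, i))"
    and "(\<Prod>l\<in>{1..<q}. scale_map q z (l, l)) = z (0, 0) ^ (q - 1) * (\<Prod>l\<in>{1..<q}. z (l, l))"
proof -
  have pos: "z (i, i) > 0" if "i < q" for i using z that by (auto simp: low_pos_def)
  have z0: "z (0, 0) > 0" using pos q by auto
  have y: "scale_map q z (i, j) = (if i = 0 then z (0, 0) else z (0, 0) * z (i, j))" if "j \<le> i" "i < q" for i j
    using that by (auto simp: scale_map_def)
  have "(\<Prod>l\<in>{1..<q}. scale_map q z (l, l)) = (\<Prod>l\<in>{1..<q}. z (0, 0) * z (l, l))"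
    by (intro prod.cong) (auto simp: y)
  then show p: "(\<Prod>l\<in>{1..<q}. scale_map q z (l, l)) = z (0, 0) ^ (q - 1) * (\<Prod>l\<in>{1..<q}. z (l, l))"
    by (simp add: prod.distrib)
  have pp: "(\<Prod>l\<in>{1..<q}. z (l, l)) > 0" using pos by (auto intro!: prod_pos)
  have zq: "z (0, 0) ^ q = z (0, 0) ^ (q - 1) * z (0, 0)" using q power_minus_mult[of q "z (0, 0)"] by simp
  have o: "det_map q (scale_map q z) (0, 0) = z (0, 0) * (\<Prod>l\<in>{1..<q}. inverse (z (l, l)))"
  proof -
    have "det_map q (scale_map q z) (0, 0) = inverse (z (0, 0) ^ (q - 1) * (\<Prod>l\<in>{1..<q}. z (l, l))) * z (0, 0) ^ q"
      using q p y[of 0 0] by (simp add: det_map_def)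
    also have "\<dots> = z (0, 0) * inverse (\<Prod>l\<in>{1..<q}. z (l, l))"
    proof -
      have "inverse (a * b) * (a * c) = c * inverse b" if "a \<noteq> 0" for a b c :: real
        using that by simp
      then show ?thesis unfolding zq using z0 by simp
    qed
    finally show ?thesis by (simp add: prod_inversef[symmetric])
  qed
  have u: "det_map q (scale_map q z) (i, j) = (if i = 0 then z (0, 0) * (\<Prod>l\<in>{1..<q}. inverse (z (l, l))) else z (0, 0) * z (i, j))"
    if "j \<le> i" "i < q" for i j
  proof (cases "i = 0")
    case True then show ?thesis using o that by simp
  next
    case False
    then have "det_map q (scale_map q z) (i, j) = scale_map q z (i, j)" using that by (simp add: det_map_def)
    then show ?thesis using y that False by simp
  qed
  then show "i < q \<Longrightarrow> det_map q (scale_map q z) (i, i) = (if i = 0 then z (0, 0) * (\<Prod>l\<in>{1..<q}. inverse (z (l, l))) else z (0, 0) * z (i, i))"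
    by simp
  show "det_map q (scale_map q z) \<in> low_pos q"
    using u pos z0 by (auto simp: low_pos_def intro!: mult_pos_pos prod_pos)
  show "low_mat q (det_map q (scale_map q z)) = z (0, 0) \<cdot>\<^sub>m Gplus_of_coords q z"
    by (rule eq_matI) (auto simp: u Gplus_of_coords_def)
qed

lemma scale_map_measurable:
  assumes "q \<ge> 1"
  shows "scale_map q \<in> measurable (coord_lebesgue q) (coord_lebesgue q)"
  unfolding scale_map_def
  by (rule measurable_restrict)
    (simp only: measurable_lborel1 measurable_lborel2 triangular_substitution.meas_g[OF triangular_scale[OF assms]])

lemma det_map_measurable:
  assumes "q \<ge> 1"
  shows "det_map q \<in> measurable (coord_lebesgue q) (coord_lebesgue q)"
  unfolding det_map_def
  by (rule measurable_restrict)
    (simp only: measurable_lborel1 measurable_lborel2 triangular_substitution.meas_g[OF triangular_det[OF assms]])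

lemma solve_map_measurable: "solve_map q R \<in> measurable (coord_lebesgue q) (coord_lebesgue q)"
  unfolding solve_map_def
  by (rule measurable_restrict) (use solve_low_measurable in auto)

lemma factor_map_measurable: "q \<ge> 1 \<Longrightarrow> factor_map q R \<in> measurable (coord_lebesgue q) (coord_lebesgue q)"
  unfolding factor_map_def
  by (intro measurable_compose[OF scale_map_measurable measurable_compose[OF det_map_measurable solve_map_measurable]])

text \<open>Each index \<open>i\<close> occurs \<open>i + 1\<close> times as a row and
  \<open>q - i\<close> times as a column.\<close>

lemma prod_low_pairs:
  fixes u :: "nat \<Rightarrow> real"
  shows "(\<Prod>ij\<in>low q. u (snd ij) * u (fst ij)) = (\<Prod>i<q. u i) ^ (q + 1)"
proof -
  have "(\<Prod>ij\<in>low q. u (snd ij) * u (fst ij)) = (\<Prod>i<q. ((\<Prod>j<i. u j) * u i) * u i ^ Suc i)"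
    unfolding prod_low by (intro prod.cong) (auto simp: prod.distrib lessThan_Suc_atMost[symmetric])
  also have "\<dots> = (\<Prod>i<q. u i ^ (q - 1 - i) * u i * u i ^ Suc i)"
    by (simp only: prod.distrib prod_low_columns)
  also have "\<dots> = (\<Prod>i<q. u i ^ (q + 1))"
  proof (rule prod.cong)
    fix i assume "i \<in> {..<q}"
    then have e: "q + 1 = (q - 1 - i) + 1 + Suc i" by auto
    show "u i ^ (q - 1 - i) * u i * u i ^ Suc i = u i ^ (q + 1)"
      unfolding e power_add by simp
  qed simp
  finally show ?thesis by (simp only: prod_power_distrib)
qed

lemma card_shape_idx:
  assumes "q \<ge> 1"
  shows "real (card (shape_idx q)) = real q * (real q + 1) / 2 - 1"
proof -
  have "card (low q) = (\<Sum>i<q. Suc i)" by (simp add: low_eq_Sigma)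
  then have "real (card (low q)) = real q * (real q + 1) / 2"
  proof -
    have "real (\<Sum>i<q. Suc i) = real q * (real q + 1) / 2" by (induction q) (auto simp: field_simps)
    with \<open>card (low q) = _\<close> show ?thesis by simp
  qed
  moreover have "card (low q) = Suc (card (shape_idx q))"
    unfolding low_insert_shape[OF assms] by (rule card_insert_disjoint[OF finite_shape_idx]) auto
  ultimately show ?thesis by simp
qed

text \<open>The four factors on the left are the weight of \<open>V\<close>, whose diagonal is
  \<open>R_ii / u_ii\<close>, and the Jacobians of the three substitutions. As the product of the
  \<open>u_ii\<close> is s^q, only \<Prod> u_ii^i keeps track of the individual entries. It supplies
  the free diagonal entries to the power i; the Jacobian of the determinant takes one power away,
  and the prior exponent i - 1 remains.\<close>

lemma jacobian_identity:
  fixes z :: "nat \<times> nat \<Rightarrow> real" and \<nu> :: real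
  assumes q: "q \<ge> 1" and z: "z \<in> low_pos q" and R: "\<And>i. i < q \<Longrightarrow> R $$ (i, i) > 0"
  defines "y \<equiv> scale_map q z" and "u \<equiv> det_map q (scale_map q z)"
  shows "(\<Prod>i<q. (R $$ (i, i) / u (i, i)) powr (\<nu> - real i - 1)) *
      (\<Prod>ij\<in>low q. R $$ (snd ij, snd ij) / (u (snd ij, snd ij) * u (fst ij, fst ij))) *
      (inverse (\<Prod>l\<in>{1..<q}. y (l, l)) * (real q * y (0, 0) ^ (q - 1))) *
      (\<Prod>ij\<in>low q. if ij = (0, 0) then 1 else z (0, 0)) =
    ((\<Prod>i<q. (R $$ (i, i)) powr (\<nu> - real i - 1)) * (\<Prod>ij\<in>low q. R $$ (snd ij, snd ij)) * real q) *
    (z (0, 0) powr (- (\<nu> * real q) - 1) * (\<Prod>i\<in>{1..<q}. z (i, i) ^ (i - 1)))"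
proof -
  define s where "s = z (0, 0)"
  define d where "d = (\<Prod>l\<in>{1..<q}. z (l, l))"
  define e where "e = (\<Prod>l\<in>{1..<q}. z (l, l) ^ (l - 1))"
  have pos: "z (i, i) > 0" if "i < q" for i using z that by (auto simp: low_pos_def)
  have s: "s > 0" using pos q by (auto simp: s_def)
  have d: "d > 0" using pos by (auto simp: d_def intro!: prod_pos)
  note u = det_scale_map[OF q z, folded u_def y_def]
  have upos: "u (i, i) > 0" if "i < q" for i using u(1) that by (auto simp: low_pos_def)
  have split: "{..<q} = insert 0 {1..<q}" using q by auto
  have pu: "(\<Prod>i<q. u (i, i)) = s ^ q"
  proof -
    have "(\<Prod>i<q. u (i, i)) = u (0, 0) * (\<Prod>i\<in>{1..<q}. u (i, i))" unfolding split by simp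
    also have "(\<Prod>i\<in>{1..<q}. u (i, i)) = (\<Prod>i\<in>{1..<q}. s * z (i, i))"
      by (intro prod.cong) (auto simp: u(3) s_def)
    also have "\<dots> = s ^ (q - 1) * d" by (simp add: prod.distrib d_def)
    also have "u (0, 0) = s * inverse d" using u(3)[of 0] q by (simp add: s_def d_def prod_inversef[symmetric])
    also have "s * inverse d * (s ^ (q - 1) * d) = s ^ (q - 1) * s" using d by simp
    also have "\<dots> = s ^ q" using power_minus_mult[of q s] q by simp
    finally show ?thesis .
  qed
  have ui: "(\<Prod>i<q. u (i, i) ^ i) = s powr (real q * (real q - 1) / 2) * (d * e)"
  proof -
    have "(\<Prod>i<q. u (i, i) ^ i) = (\<Prod>i\<in>{1..<q}. u (i, i) ^ i)" unfolding split by simp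
    also have "\<dots> = (\<Prod>i\<in>{1..<q}. s powr real i * (z (i, i) * z (i, i) ^ (i - 1)))"
    proof (rule prod.cong)
      fix i assume i: "i \<in> {1..<q}"
      have "z (i, i) * z (i, i) ^ (i - 1) = z (i, i) ^ i" using i power_minus_mult[of i "z (i, i)"] by (simp add: mult.commute)
      then show "u (i, i) ^ i = s powr real i * (z (i, i) * z (i, i) ^ (i - 1))"
        using i s by (simp add: u(3) s_def[symmetric] power_mult_distrib powr_realpow)
    qed simp
    also have "\<dots> = (\<Prod>i\<in>{1..<q}. s powr real i) * (d * e)"
      by (simp add: prod.distrib d_def e_def)
    also have "(\<Prod>i\<in>{1..<q}. s powr real i) = s powr (\<Sum>i\<in>{1..<q}. real i)"
      using s by (subst powr_sum) auto
    also have "(\<Sum>i\<in>{1..<q}. real i) = real q * (real q - 1) / 2"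
    proof -
      have "(\<Sum>i<q. real i) = real q * (real q - 1) / 2" by (induction q) (auto simp: field_simps)
      then show ?thesis unfolding split by simp
    qed
    finally show ?thesis .
  qed
  have A: "(\<Prod>i<q. (R $$ (i, i) / u (i, i)) powr (\<nu> - real i - 1)) =
     (\<Prod>i<q. (R $$ (i, i)) powr (\<nu> - real i - 1)) * (s powr (real q * (real q - 1) / 2) * (d * e) / s powr (real q * (\<nu> - 1)))"
  proof -
    have "(\<Prod>i<q. (R $$ (i, i) / u (i, i)) powr (\<nu> - real i - 1)) =
       (\<Prod>i<q. (R $$ (i, i)) powr (\<nu> - real i - 1) * (u (i, i) ^ i / u (i, i) powr (\<nu> - 1)))"
    proof (rule prod.cong)
      fix i assume "i \<in> {..<q}"
      then have i: "R $$ (i, i) > 0" "u (i, i) > 0" using R upos by auto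
      have "u (i, i) powr (\<nu> - real i - 1) = u (i, i) powr (\<nu> - 1) / u (i, i) ^ i"
        using i by (simp add: powr_diff[symmetric] powr_realpow[symmetric] algebra_simps)
      then show "(R $$ (i, i) / u (i, i)) powr (\<nu> - real i - 1) =
          (R $$ (i, i)) powr (\<nu> - real i - 1) * (u (i, i) ^ i / u (i, i) powr (\<nu> - 1))"
        using i by (simp add: powr_divide)
    qed simp
    also have "\<dots> = (\<Prod>i<q. (R $$ (i, i)) powr (\<nu> - real i - 1)) * ((\<Prod>i<q. u (i, i) ^ i) / (\<Prod>i<q. u (i, i) powr (\<nu> - 1)))"
      by (simp add: prod.distrib prod_dividef)
    also have "(\<Prod>i<q. u (i, i) powr (\<nu> - 1)) = (\<Prod>i<q. u (i, i)) powr (\<nu> - 1)"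
      using upos by (intro prod_powr_distrib[symmetric])
    also have "\<dots> = s powr (real q * (\<nu> - 1))" using s unfolding pu by (simp add: powr_powr powr_realpow[symmetric])
    finally show ?thesis unfolding ui .
  qed
  have B: "(\<Prod>ij\<in>low q. R $$ (snd ij, snd ij) / (u (snd ij, snd ij) * u (fst ij, fst ij))) =
     (\<Prod>ij\<in>low q. R $$ (snd ij, snd ij)) / s powr (real q * (real q + 1))"
  proof -
    have "(\<Prod>ij\<in>low q. u (snd ij, snd ij) * u (fst ij, fst ij)) = (s ^ q) ^ (q + 1)"
      using prod_low_pairs[of "\<lambda>i. u (i, i)" q] pu by simp
    also have "\<dots> = s ^ (q * (q + 1))" by (simp only: power_mult)
    also have "\<dots> = s powr real (q * (q + 1))" by (rule powr_realpow[OF s, symmetric])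
    also have "real (q * (q + 1)) = real q * (real q + 1)" by (simp add: algebra_simps)
    finally show ?thesis by (simp add: prod_dividef)
  qed
  have C: "inverse (\<Prod>l\<in>{1..<q}. y (l, l)) * (real q * y (0, 0) ^ (q - 1)) = real q / d"
  proof -
    have "y (0, 0) = s" using q by (simp add: y_def scale_map_def s_def)
    moreover have "inverse (a * b) * (c * a) = c / b" if "a \<noteq> 0" for a b c :: real
      using that by (simp add: field_simps)
    moreover have "(\<Prod>l\<in>{1..<q}. y (l, l)) = s ^ (q - 1) * d" using u(4) by (simp only: s_def d_def)
    ultimately show ?thesis using s by (simp only: power_not_zero less_imp_neq[THEN not_sym] refl simp_thms)
  qed
  have D: "(\<Prod>ij\<in>low q. if ij = (0, 0) then 1 else z (0, 0)) = s powr (real q * (real q + 1) / 2 - 1)"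
  proof -
    have "(\<Prod>ij\<in>low q. if ij = (0, 0) then 1 else z (0, 0)) = (\<Prod>ij\<in>shape_idx q. s)"
      unfolding s_def by (intro prod.mono_neutral_cong_right finite_low) (use q in auto)
    also have "\<dots> = s powr real (card (shape_idx q))" using s by (simp add: powr_realpow)
    finally show ?thesis unfolding card_shape_idx[OF q] .
  qed
  \<comment> \<open>The exponents are q (q - 1) / 2 and - q (\<nu> - 1) from the weight of
    \<open>V\<close>, - q (q + 1) from the Jacobian of W^(-1) R, and q (q + 1) / 2 - 1 from scaling
    the free entries. Their sum is - \<nu> q - 1.\<close>
  have E: "s powr (real q * (real q - 1) / 2) / s powr (real q * (\<nu> - 1)) / s powr (real q * (real q + 1)) * s powr (real q * (real q + 1) / 2 - 1)
     = s powr (- (\<nu> * real q) - 1)"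
  proof -
    have "real q * (real q - 1) / 2 - real q * (\<nu> - 1) - real q * (real q + 1) + (real q * (real q + 1) / 2 - 1) = - (\<nu> * real q) - 1"
      by (simp add: field_simps)
    then show ?thesis unfolding powr_diff[symmetric] powr_add[symmetric] by (simp only:)
  qed
  have gen: "(a * (b * (d * e) / c)) * (f / g) * (real q / d) * h = (a * f * real q) * ((b / c / g * h) * e)" for a b c f g h :: real
    using d by (simp add: field_simps)
  show ?thesis
    unfolding A B C D
    unfolding s_def[symmetric] e_def[symmetric] E[symmetric]
    by (rule gen)
qed

text \<open>
  Since \<open>s \<Psi> = R V\<^sup>-\<^sup>1\<close> with \<open>V\<close> lower triangular, \<open>R\<close> only rescales the measure
  \<open>\<Prod> V\<^sub>i\<^sub>i\<^sup>\<nu>\<^sup>-\<^sup>i\<^sup>-\<^sup>1 dV\<close> by a constant.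
\<close>
lemma nn_integral_scale_shape_coords:
  assumes q: "q \<ge> 1" and R: "R \<in> carrier_mat q q" "lower_triangular R" "pos_diag R"
  obtains C where "C > 0" "\<And>G. G \<in> borel_measurable (coord_lebesgue q) \<Longrightarrow>
     (\<integral>\<^sup>+z. G (factor_map q R z) * ennreal (z (0, 0) powr (- (\<nu> * real q) - 1) * (\<Prod>i\<in>{1..<q}. z (i, i) ^ (i - 1))) \<partial>low_lebesgue q) =
     ennreal C * (\<integral>\<^sup>+V. G V * ennreal (\<Prod>i<q. V (i, i) powr (\<nu> - real i - 1)) \<partial>low_lebesgue q)"
proof -
  have Rpos: "R $$ (i, i) > 0" if "i < q" for i using R that by (auto simp: pos_diag_def)
  \<comment> \<open>The constant for the passage from \<open>V\<close> to \<open>z\<close>; the one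
    that is claimed is its reciprocal.\<close>
  define C where "C = (\<Prod>i<q. (R $$ (i, i)) powr (\<nu> - real i - 1)) * (\<Prod>ij\<in>low q. R $$ (snd ij, snd ij)) * real q"
  have C: "C > 0" unfolding C_def by (intro mult_pos_pos prod_pos) (use Rpos q in force)+
  define w where "w z = z (0, 0) powr (- (\<nu> * real q) - 1) * (\<Prod>i\<in>{1..<q}. z (i, i) ^ (i - 1))" for z :: "nat \<times> nat \<Rightarrow> real"
  have wm: "w \<in> borel_measurable (coord_lebesgue q)"
    unfolding w_def by (intro borel_measurable_times powr_real_measurable borel_measurable_prod borel_measurable_power measurable_coord borel_measurable_const) (use q in auto)
  have "(\<integral>\<^sup>+z. G (factor_map q R z) * ennreal (w z) \<partial>low_lebesgue q) =
     ennreal (1 / C) * (\<integral>\<^sup>+V. G V * ennreal (\<Prod>i<q. V (i, i) powr (\<nu> - real i - 1)) \<partial>low_lebesgue q)"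
    if G: "G \<in> borel_measurable (coord_lebesgue q)" for G
  proof -
    define F where "F V = G V * ennreal (\<Prod>i<q. V (i, i) powr (\<nu> - real i - 1))" for V
    define J3 where "J3 u = (\<Prod>ij\<in>low q. ennreal (R $$ (snd ij, snd ij) / (u (snd ij, snd ij) * u (fst ij, fst ij))))" for u :: "nat \<times> nat \<Rightarrow> real"
    define J2 where "J2 y = (\<Prod>ij\<in>low q. if ij = (0, 0) then ennreal (inverse (\<Prod>l\<in>{1..<q}. y (l, l)) * (real q * y (0, 0) ^ (q - 1))) else 1)" for y :: "nat \<times> nat \<Rightarrow> real"
    define J1 where "J1 z = (\<Prod>ij\<in>low q. if ij = (0, 0) then 1 else ennreal (z (0, 0)))" for z :: "nat \<times> nat \<Rightarrow> real"
    have F: "F \<in> borel_measurable (coord_lebesgue q)"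
      unfolding F_def by (intro borel_measurable_times_ennreal G measurable_compose[OF _ measurable_ennreal] borel_measurable_prod powr_real_measurable measurable_coord borel_measurable_const) auto
    have J3: "J3 \<in> borel_measurable (coord_lebesgue q)"
      unfolding J3_def by (intro borel_measurable_prod_ennreal triangular_substitution.meas_J[OF triangular_solve_low[OF R(1,3)]])
    have J2: "J2 \<in> borel_measurable (coord_lebesgue q)"
      unfolding J2_def by (intro borel_measurable_prod_ennreal triangular_substitution.meas_J[OF triangular_det[OF q]])
    have F1: "(\<lambda>u. F (solve_map q R u) * J3 u) \<in> borel_measurable (coord_lebesgue q)"
      by (intro borel_measurable_times_ennreal J3 measurable_compose[OF solve_map_measurable F])
    have F2: "(\<lambda>y. F (solve_map q R (det_map q y)) * J3 (det_map q y) * J2 y) \<in> borel_measurable (coord_lebesgue q)"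
      by (intro borel_measurable_times_ennreal J2 measurable_compose[OF det_map_measurable[OF q] F1])
    \<comment> \<open>The substitutions are applied outermost first, from \<open>V\<close> back to
      scale and shape, and each leaves its Jacobian behind.\<close>
    have "(\<integral>\<^sup>+V. F V \<partial>low_lebesgue q) = (\<integral>\<^sup>+u. F (solve_map q R u) * J3 u \<partial>low_lebesgue q)"
      unfolding solve_map_def J3_def by (rule nn_integral_low_low[OF triangular_solve_low[OF R(1,3)] F, symmetric])
    also have "\<dots> = (\<integral>\<^sup>+y. F (solve_map q R (det_map q y)) * J3 (det_map q y) * J2 y \<partial>low_lebesgue q)"
      using nn_integral_low_low[OF triangular_det[OF q] F1] unfolding det_map_def J2_def by simp
    also have "\<dots> = (\<integral>\<^sup>+z. F (factor_map q R z) * J3 (det_map q (scale_map q z)) * J2 (scale_map q z) * J1 z \<partial>low_lebesgue q)"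
      using nn_integral_low_low[OF triangular_scale[OF q] F2] unfolding scale_map_def J1_def factor_map_def by simp
    also have "\<dots> = (\<integral>\<^sup>+z. ennreal C * (G (factor_map q R z) * ennreal (w z)) \<partial>low_lebesgue q)"
    proof (rule nn_integral_low_lebesgue_cong)
      fix z assume z: "z \<in> low_pos q"
      define y where "y = scale_map q z"
      define u where "u = det_map q y"
      have zpos: "z (i, i) > 0" if "i < q" for i using z that by (auto simp: low_pos_def)
      have upos: "u (i, i) > 0" if "i < q" for i
        using det_scale_map(1)[OF q z] that by (auto simp: low_pos_def u_def y_def)
      have ypos: "y (i, i) > 0" if "i < q" for i
        using that zpos q by (auto simp: y_def scale_map_def)
      have V: "factor_map q R z (i, i) = R $$ (i, i) / u (i, i)" if "i < q" for i
        using that by (simp add: factor_map_def solve_map_def u_def y_def solve_low_diag)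
      let ?a = "\<Prod>i<q. (R $$ (i, i) / u (i, i)) powr (\<nu> - real i - 1)"
      let ?b = "\<Prod>ij\<in>low q. R $$ (snd ij, snd ij) / (u (snd ij, snd ij) * u (fst ij, fst ij))"
      let ?c = "inverse (\<Prod>l\<in>{1..<q}. y (l, l)) * (real q * y (0, 0) ^ (q - 1))"
      let ?d = "\<Prod>ij\<in>low q. if ij = (0, 0) then 1 else z (0, 0)"
      have a: "?a \<ge> 0" by (intro prod_nonneg) auto
      have b: "?b \<ge> 0" using Rpos upos by (intro prod_nonneg) (auto simp: less_imp_le)
      have c: "?c \<ge> 0" using ypos q by (intro mult_nonneg_nonneg) (auto intro!: prod_nonneg simp: less_imp_le)
      have d: "?d \<ge> 0" using zpos q by (intro prod_nonneg) (auto simp: less_imp_le)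
      have w: "w z \<ge> 0" using zpos by (auto simp: w_def intro!: mult_nonneg_nonneg prod_nonneg simp: less_imp_le)
      have "F (factor_map q R z) = G (factor_map q R z) * ennreal ?a"
        unfolding F_def by (simp add: V)
      moreover have "J3 u = ennreal ?b"
        unfolding J3_def using Rpos upos by (intro prod_ennreal) (auto simp: less_imp_le)
      moreover have "J2 y = ennreal ?c"
        unfolding J2_def using q finite_low[of q] by (subst prod.delta) auto
      moreover have "J1 z = ennreal ?d"
      proof -
        have "J1 z = (\<Prod>ij\<in>low q. ennreal (if ij = (0, 0) then 1 else z (0, 0)))"
          unfolding J1_def by (intro prod.cong) auto
        also have "\<dots> = ennreal ?d" using zpos q by (intro prod_ennreal) (auto simp: less_imp_le)
        finally show ?thesis .
      qed
      ultimately have "F (factor_map q R z) * J3 u * J2 y * J1 z = G (factor_map q R z) * (ennreal ?a * ennreal ?b * ennreal ?c * ennreal ?d)"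
        by (simp only: mult.assoc)
      also have "ennreal ?a * ennreal ?b * ennreal ?c * ennreal ?d = ennreal (?a * ?b * ?c * ?d)"
        using a b c d by (simp only: ennreal_mult[symmetric] mult_nonneg_nonneg)
      also have "?a * ?b * ?c * ?d = C * w z"
        unfolding C_def w_def u_def y_def by (rule jacobian_identity[OF q z Rpos])
      also have "ennreal (C * w z) = ennreal C * ennreal (w z)"
        using C w by (intro ennreal_mult) auto
      finally show "F (factor_map q R z) * J3 (det_map q (scale_map q z)) * J2 (scale_map q z) * J1 z =
          ennreal C * (G (factor_map q R z) * ennreal (w z))"
        unfolding u_def y_def by (simp only: mult_ac)
    qed
    also have "\<dots> = ennreal C * (\<integral>\<^sup>+z. G (factor_map q R z) * ennreal (w z) \<partial>low_lebesgue q)"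
    proof (rule nn_integral_cmult)
      show "(\<lambda>z. G (factor_map q R z) * ennreal (w z)) \<in> borel_measurable (low_lebesgue q)"
        unfolding measurable_cong_sets[OF sets_low_lebesgue refl]
        by (intro borel_measurable_times_ennreal measurable_compose[OF factor_map_measurable[OF q] G] measurable_compose[OF wm measurable_ennreal])
    qed
    finally have "ennreal (1 / C) * (\<integral>\<^sup>+V. F V \<partial>low_lebesgue q) =
       (ennreal (1 / C) * ennreal C) * (\<integral>\<^sup>+z. G (factor_map q R z) * ennreal (w z) \<partial>low_lebesgue q)"
      by (simp only: mult.assoc)
    also have "ennreal (1 / C) * ennreal C = 1" using C by (simp add: ennreal_mult[symmetric])
    finally show ?thesis unfolding F_def by simp
  qed
  then show ?thesis using C that[of "1 / C"] unfolding w_def by simp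
qed

section \<open>From coordinates to scale and shape\<close>

abbreviation pos_lborel :: "real measure" where
  "pos_lborel \<equiv> restrict_space lborel {0<..}"

lemma snd_pos_lborel_measurable: "snd \<in> borel_measurable (N \<Otimes>\<^sub>M pos_lborel)"
  by (rule measurable_compose[OF measurable_snd]) (intro measurable_restrict_space1, simp)

lemma Gplus_det: "A \<in> Gplus q \<Longrightarrow> det A = 1"
  by (simp add: Gplus_def)

lemma mat_meas_inv_scaled:
  "mat_meas (Gplus_borel q \<Otimes>\<^sub>M pos_lborel) q q (\<lambda>x. mat_inv (snd x \<cdot>\<^sub>m fst x))"
proof (rule mat_meas_mat_inv)
  show "mat_meas (Gplus_borel q \<Otimes>\<^sub>M pos_lborel) q q (\<lambda>x. snd x \<cdot>\<^sub>m fst x)"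
    by (rule mat_meas_smult[OF mat_meas_compose[OF mat_meas_Gplus_id measurable_fst] snd_pos_lborel_measurable])
  fix x assume "x \<in> space (Gplus_borel q \<Otimes>\<^sub>M pos_lborel)"
  then have x: "fst x \<in> Gplus q" "snd x > 0"
    by (auto simp: space_pair_measure space_Gplus_borel space_restrict_space)
  then show "det (snd x \<cdot>\<^sub>m fst x) \<noteq> 0" by (simp add: Gplus_det)
qed

lemma shape_weight_measurable:
  "(\<lambda>x. snd x powr a * (\<Prod>i\<in>{1..<q}. fst x $$ (i, i) ^ (i - 1))) \<in> borel_measurable (Gplus_borel q \<Otimes>\<^sub>M pos_lborel)"
proof -
  have e: "(\<lambda>x. fst x $$ (i, i)) \<in> borel_measurable (Gplus_borel q \<Otimes>\<^sub>M pos_lborel)" if "i < q" for i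
    by (rule measurable_compose[OF measurable_fst measurable_Gplus_index]) (use that in auto)
  show ?thesis
    by (intro borel_measurable_times powr_real_measurable snd_pos_lborel_measurable borel_measurable_const borel_measurable_prod borel_measurable_power e) auto
qed

lemma sigma_finite_pos_lborel: "sigma_finite_measure pos_lborel"
  by (rule sigma_finite_measure_restrict_space[OF sigma_finite_lborel]) auto

lemma measurable_low_mat: "low_mat q \<in> measurable (coord_lebesgue q) (mat_borel q)"
proof (rule measurable_mat_borelI)
  have "mat_meas (coord_lebesgue q) q q (\<lambda>x. low_mat q x)"
    by (rule mat_meas_low_mat) (auto intro: measurable_coord)
  then show "(\<lambda>w. low_mat q w $$ (i, j)) \<in> borel_measurable (coord_lebesgue q)" if "i < q" "j < q" for i j
    using that by (auto dest: mat_measD)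
qed simp

text \<open>Putting the scale into the vacant position \<open>(0, 0)\<close> merges the iterated
  integral over shape and scale into a single integral over all lower triangular
  coordinates.\<close>

lemma nn_integral_scale_shape:
  assumes q: "q \<ge> 1" and R: "R \<in> carrier_mat q q" "lower_triangular R" "pos_diag R"
  obtains C where "C > 0" "\<And>H. H \<in> borel_measurable (mat_borel q) \<Longrightarrow>
     (\<integral>\<^sup>+\<Psi>. \<integral>\<^sup>+s. H (mat_inv (s \<cdot>\<^sub>m \<Psi>) * R) *
        ennreal (s powr (- (\<nu> * real q) - 1) * (\<Prod>i\<in>{1..<q}. \<Psi> $$ (i, i) ^ (i - 1))) \<partial>pos_lborel \<partial>Gplus_lebesgue q) =
     ennreal C * (\<integral>\<^sup>+V. H (low_mat q V) * ennreal (\<Prod>i<q. V (i, i) powr (\<nu> - real i - 1)) \<partial>low_lebesgue q)"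
proof -
  interpret product_sigma_finite "\<lambda>_ :: nat \<times> nat. lborel :: real measure" by standard
  interpret pos: sigma_finite_measure pos_lborel by (rule sigma_finite_pos_lborel)
  obtain C where C: "C > 0" "\<And>G. G \<in> borel_measurable (coord_lebesgue q) \<Longrightarrow>
     (\<integral>\<^sup>+z. G (factor_map q R z) * ennreal (z (0, 0) powr (- (\<nu> * real q) - 1) * (\<Prod>i\<in>{1..<q}. z (i, i) ^ (i - 1))) \<partial>low_lebesgue q) =
     ennreal C * (\<integral>\<^sup>+V. G V * ennreal (\<Prod>i<q. V (i, i) powr (\<nu> - real i - 1)) \<partial>low_lebesgue q)"
    using nn_integral_scale_shape_coords[OF q R] by blast
  define w where "w \<Psi> s = s powr (- (\<nu> * real q) - 1) * (\<Prod>i\<in>{1..<q}. \<Psi> $$ (i, i) ^ (i - 1))" for \<Psi> :: "real mat" and s :: real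
  define w' where "w' z = z (0, 0) powr (- (\<nu> * real q) - 1) * (\<Prod>i\<in>{1..<q}. z (i, i) ^ (i - 1))" for z :: "nat \<times> nat \<Rightarrow> real"
  have w'm: "w' \<in> borel_measurable (coord_lebesgue q)"
    unfolding w'_def by (intro borel_measurable_times powr_real_measurable borel_measurable_prod borel_measurable_power measurable_coord borel_measurable_const) (use q in auto)
  have "(\<integral>\<^sup>+\<Psi>. \<integral>\<^sup>+s. H (mat_inv (s \<cdot>\<^sub>m \<Psi>) * R) * ennreal (w \<Psi> s) \<partial>pos_lborel \<partial>Gplus_lebesgue q) =
     ennreal C * (\<integral>\<^sup>+V. H (low_mat q V) * ennreal (\<Prod>i<q. V (i, i) powr (\<nu> - real i - 1)) \<partial>low_lebesgue q)"
    if H: "H \<in> borel_measurable (mat_borel q)" for H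
  proof -
    define k where "k \<Psi> s = H (mat_inv (s \<cdot>\<^sub>m \<Psi>) * R) * ennreal (w \<Psi> s)" for \<Psi> s
    define k' where "k' z = H (low_mat q (factor_map q R z)) * ennreal (w' z)" for z
    have Gm: "(\<lambda>V. H (low_mat q V)) \<in> borel_measurable (coord_lebesgue q)"
      by (rule measurable_compose[OF measurable_low_mat H])
    have k'm: "k' \<in> borel_measurable (coord_lebesgue q)"
      unfolding k'_def
      by (intro borel_measurable_times_ennreal measurable_compose[OF factor_map_measurable[OF q] Gm] measurable_compose[OF w'm measurable_ennreal])
    have km: "(\<lambda>(\<Psi>, s). k \<Psi> s) \<in> borel_measurable (Gplus_borel q \<Otimes>\<^sub>M pos_lborel)"
    proof -
      have "mat_meas (Gplus_borel q \<Otimes>\<^sub>M pos_lborel) q q (\<lambda>x. mat_inv (snd x \<cdot>\<^sub>m fst x) * R)"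
        by (rule mat_meas_mult[OF mat_meas_inv_scaled mat_meas_const[OF R(1)]])
      then have "(\<lambda>x. mat_inv (snd x \<cdot>\<^sub>m fst x) * R) \<in> measurable (Gplus_borel q \<Otimes>\<^sub>M pos_lborel) (mat_borel q)"
        by (intro measurable_mat_borelI) (auto dest: mat_measD)
      from measurable_compose[OF this H] shape_weight_measurable[of "- (\<nu> * real q) - 1" q]
      show ?thesis unfolding k_def w_def split_beta'
        by (intro borel_measurable_times_ennreal measurable_compose[OF _ measurable_ennreal])
    qed
    have inner: "(\<lambda>\<Psi>. \<integral>\<^sup>+s. k \<Psi> s \<partial>pos_lborel) \<in> borel_measurable (Gplus_borel q)"
      by (rule pos.borel_measurable_nn_integral[OF km])
    \<comment> \<open>\<open>Gplus_of_coords\<close> never reads position \<open>(0, 0)\<close>, so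
      overwriting it by the scale leaves the shape unchanged; the two positivity conditions together
      are those of \<open>low_pos\<close>.\<close>
    have key: "k (Gplus_of_coords q x) s * indicator {0<..} s * indicator (shape_dom q) x =
        k' (x((0, 0) := s)) * indicator (low_pos q) (x((0, 0) := s))" for x s
    proof (cases "x((0, 0) := s) \<in> low_pos q")
      case True
      let ?z = "x((0, 0) := s)"
      have s: "s > 0" using True q by (auto simp: low_pos_def dest: spec[of _ 0])
      have x: "x \<in> shape_dom q" using True by (auto simp: low_pos_def split: if_splits)
      have G: "Gplus_of_coords q ?z = Gplus_of_coords q x"
        by (intro eq_matI) (auto simp: Gplus_of_coords_def intro!: prod.cong)
      have W: "?z (0, 0) \<cdot>\<^sub>m Gplus_of_coords q ?z = s \<cdot>\<^sub>m Gplus_of_coords q x" unfolding G by simp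
      let ?u = "det_map q (scale_map q ?z)"
      have u: "?u \<in> low_pos q" "low_mat q ?u = s \<cdot>\<^sub>m Gplus_of_coords q x"
        using det_scale_map(1,2)[OF q True] W by auto
      have "low_mat q (factor_map q R ?z) = mat_inv (s \<cdot>\<^sub>m Gplus_of_coords q x) * R"
      proof -
        have "low_mat q (factor_map q R ?z) = low_mat q (\<lambda>(i, j). solve_low R ?u i j)"
          by (rule low_mat_cong) (simp add: factor_map_def solve_map_def)
        then show ?thesis using low_mat_solve_low[OF u(1) R(1,2)] u(2) by simp
      qed
      moreover have "w (Gplus_of_coords q x) s = w' ?z"
        unfolding w_def w'_def by (auto simp: Gplus_of_coords_def intro!: prod.cong)
      ultimately show ?thesis using True s x by (simp add: k_def k'_def)
    next
      case False
      have "\<not> (s > 0 \<and> x \<in> shape_dom q)"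
      proof
        assume "s > 0 \<and> x \<in> shape_dom q"
        then have "x((0, 0) := s) \<in> low_pos q" by (auto simp: low_pos_def)
        then show False using False by simp
      qed
      then show ?thesis using False by (auto simp: indicator_def)
    qed
    have "(\<integral>\<^sup>+\<Psi>. \<integral>\<^sup>+s. k \<Psi> s \<partial>pos_lborel \<partial>Gplus_lebesgue q) =
      (\<integral>\<^sup>+x. (\<integral>\<^sup>+s. k (Gplus_of_coords q x) s \<partial>pos_lborel) * indicator (shape_dom q) x \<partial>shape_lebesgue q)"
      by (rule nn_integral_Gplus_lebesgue[OF q inner])
    also have "\<dots> = (\<integral>\<^sup>+x. \<integral>\<^sup>+s. k' (x((0, 0) := s)) * indicator (low_pos q) (x((0, 0) := s)) \<partial>lborel \<partial>shape_lebesgue q)"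
    proof (rule nn_integral_cong)
      fix x :: "nat \<times> nat \<Rightarrow> real"
      have "(\<integral>\<^sup>+s. k (Gplus_of_coords q x) s \<partial>pos_lborel) * indicator (shape_dom q) x =
         (\<integral>\<^sup>+s. k (Gplus_of_coords q x) s * indicator {0<..} s \<partial>lborel) * indicator (shape_dom q) x"
        by (subst nn_integral_restrict_space) auto
      also have "\<dots> = (\<integral>\<^sup>+s. k (Gplus_of_coords q x) s * indicator {0<..} s * indicator (shape_dom q) x \<partial>lborel)"
        by (cases "x \<in> shape_dom q") auto
      finally show "(\<integral>\<^sup>+s. k (Gplus_of_coords q x) s \<partial>pos_lborel) * indicator (shape_dom q) x =
         (\<integral>\<^sup>+s. k' (x((0, 0) := s)) * indicator (low_pos q) (x((0, 0) := s)) \<partial>lborel)"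
        unfolding key .
    qed
    also have "\<dots> = (\<integral>\<^sup>+z. k' z * indicator (low_pos q) z \<partial>coord_lebesgue q)"
    proof -
      have "(\<lambda>z. k' z * indicator (low_pos q) z) \<in> borel_measurable (coord_lebesgue q)"
        by (intro borel_measurable_times_ennreal k'm indicator_low_pos_measurable)
      then have 1: "(\<lambda>z. k' z * indicator (low_pos q) z) \<in> borel_measurable (PiM (insert (0, 0) (shape_idx q)) (\<lambda>_. lborel))"
        unfolding low_insert_shape[OF q] .
      have 2: "(0, 0) \<notin> shape_idx q" by simp
      show ?thesis
        using product_nn_integral_insert[OF finite_shape_idx 2 1] unfolding low_insert_shape[OF q] by (rule sym)
    qed
    also have "\<dots> = (\<integral>\<^sup>+z. k' z \<partial>low_lebesgue q)" by (rule nn_integral_low_lebesgue[OF k'm, symmetric])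
    also have "\<dots> = ennreal C * (\<integral>\<^sup>+V. H (low_mat q V) * ennreal (\<Prod>i<q. V (i, i) powr (\<nu> - real i - 1)) \<partial>low_lebesgue q)"
      unfolding k'_def w'_def by (rule C(2)[OF Gm])
    finally show ?thesis unfolding k_def .
  qed
  then show ?thesis using C(1) that unfolding w_def by blast
qed

section \<open>The full conditional for a fixed scale matrix\<close>

text \<open>The posterior kernel as a function of the scale and one shape, with \<open>N\<close> for
  np and with \<open>S\<close> carrying all that the data and the other shapes contribute to the
  exponent.\<close>

definition cond_kernel :: "nat \<Rightarrow> nat \<Rightarrow> real mat \<Rightarrow> real \<Rightarrow> real mat \<Rightarrow> real" where
  "cond_kernel q N S s \<Psi> = inverse (s ^ N) *
     exp (- (1 / (2 * s\<^sup>2)) * mat_trace (mat_inv \<Psi> * S * transpose_mat (mat_inv \<Psi>))) *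
     (1 / s) * (\<Prod>i\<in>{1..<q}. \<Psi> $$ (i, i) ^ (i - 1))"

lemma mat_trace_smult: "A \<in> carrier_mat n n \<Longrightarrow> mat_trace (a \<cdot>\<^sub>m A) = a * mat_trace A"
  by (auto simp: mat_trace_def sum_distrib_left)

lemma transpose_smult: "transpose_mat (a \<cdot>\<^sub>m A) = a \<cdot>\<^sub>m transpose_mat A"
  by (auto intro!: eq_matI)

lemma mat_inv_smult:
  assumes A: "A \<in> carrier_mat n n" "det A \<noteq> 0" and s: "s \<noteq> 0"
  shows "mat_inv (s \<cdot>\<^sub>m A) = inverse s \<cdot>\<^sub>m mat_inv A"
proof (rule mat_inv_unique(1))
  note Ai = mat_inv[OF A]
  have "(s \<cdot>\<^sub>m A) * (inverse s \<cdot>\<^sub>m mat_inv A) = s \<cdot>\<^sub>m (inverse s \<cdot>\<^sub>m (A * mat_inv A))"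
    using A(1) Ai(1) by (simp add: mult_smult_assoc_mat[of _ n n _ n] mult_smult_distrib[of _ n n _ n]) (auto intro!: eq_matI)
  also have "\<dots> = 1\<^sub>m n" unfolding Ai(2) using s by (auto intro!: eq_matI)
  finally show "(s \<cdot>\<^sub>m A) * (inverse s \<cdot>\<^sub>m mat_inv A) = 1\<^sub>m n" .
qed (use A mat_inv[OF A] in auto)

text \<open>Stated for an arbitrary middle factor \<open>T\<close> so as to serve twice: with the
  identity when \<open>S\<close> is positive definite, and with a degenerate \<open>T\<close> when
  it is singular.\<close>

lemma cond_kernel_eq:
  assumes \<Psi>: "\<Psi> \<in> Gplus q" and s: "s > 0" and N: "real N = \<nu> * real q"
    and R: "R \<in> carrier_mat q q" and T: "T \<in> carrier_mat q q" and S: "S = R * T * transpose_mat R"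
  defines "V \<equiv> mat_inv (s \<cdot>\<^sub>m \<Psi>) * R"
  shows "cond_kernel q N S s \<Psi> = exp (- mat_trace (V * T * transpose_mat V) / 2) *
     (s powr (- (\<nu> * real q) - 1) * (\<Prod>i\<in>{1..<q}. \<Psi> $$ (i, i) ^ (i - 1)))"
proof -
  have P: "\<Psi> \<in> carrier_mat q q" "det \<Psi> \<noteq> 0" using \<Psi> by (auto simp: Gplus_def)
  note Pi = mat_inv[OF P]
  have V: "V = inverse s \<cdot>\<^sub>m (mat_inv \<Psi> * R)"
    unfolding V_def using mat_inv_smult[OF P, of s] s Pi R by (simp add: mult_smult_assoc_mat[of _ q q _ q])
  let ?B = "mat_inv \<Psi> * R"
  have B: "?B \<in> carrier_mat q q" using Pi R by auto
  have "V * T * transpose_mat V = inverse s \<cdot>\<^sub>m (inverse s \<cdot>\<^sub>m (?B * T * transpose_mat ?B))"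
    unfolding V using B T
    by (simp add: transpose_smult mult_smult_assoc_mat[of _ q q _ q] mult_smult_distrib[of _ q q _ q])
  also have "?B * T * transpose_mat ?B = mat_inv \<Psi> * S * transpose_mat (mat_inv \<Psi>)"
    unfolding S using Pi(1) R T
    by (simp add: transpose_mult[of _ q q _ q] assoc_mult_mat[of _ q q _ q _ q])
  finally have VT: "V * T * transpose_mat V = inverse s \<cdot>\<^sub>m (inverse s \<cdot>\<^sub>m (mat_inv \<Psi> * S * transpose_mat (mat_inv \<Psi>)))" .
  have M: "mat_inv \<Psi> * S * transpose_mat (mat_inv \<Psi>) \<in> carrier_mat q q" using Pi(1) R T S by auto
  have "mat_trace (V * T * transpose_mat V) = inverse s * (inverse s * mat_trace (mat_inv \<Psi> * S * transpose_mat (mat_inv \<Psi>)))"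
    unfolding VT mat_trace_smult[OF smult_carrier_mat[OF M]] mat_trace_smult[OF M] ..
  then have e: "- mat_trace (V * T * transpose_mat V) / 2 = - (1 / (2 * s\<^sup>2)) * mat_trace (mat_inv \<Psi> * S * transpose_mat (mat_inv \<Psi>))"
    by (simp add: power2_eq_square field_simps)
  have "s powr (- (\<nu> * real q) - 1) = inverse (s ^ N) * (1 / s)"
    using s by (simp add: N[symmetric] powr_diff powr_minus powr_realpow divide_inverse)
  then show ?thesis unfolding cond_kernel_def e by simp
qed

lemma mat_meas_trace:
  assumes f: "mat_meas M n n f"
  shows "(\<lambda>w. mat_trace (f w)) \<in> borel_measurable M"
proof -
  have "(\<lambda>w. mat_trace (f w)) \<in> borel_measurable M \<longleftrightarrow> (\<lambda>w. \<Sum>i<n. f w $$ (i, i)) \<in> borel_measurable M"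
    by (rule measurable_cong) (use mat_measD(1)[OF f] in \<open>fastforce simp: mat_trace_def\<close>)
  then show ?thesis using mat_measD(2)[OF f] by (auto intro!: borel_measurable_sum)
qed

lemma mat_meas_borel_id: "mat_meas (mat_borel q) q q (\<lambda>A. A)"
  by (rule mat_measI) (auto simp: space_mat_borel intro: measurable_mat_index)

lemma mat_meas_mat_borel: "mat_meas M q q f \<Longrightarrow> f \<in> measurable M (mat_borel q)"
  by (rule measurable_mat_borelI) (auto dest: mat_measD)

lemma mirror_pos_def:
  assumes U: "U \<in> carrier_mat q q" "det U \<noteq> 0" and V: "V \<in> carrier_mat q q" "det V \<noteq> 0"
  shows "U * transpose_mat V * V * transpose_mat U \<in> pos_def_mats q"
proof -
  let ?B = "V * transpose_mat U"
  have B: "?B \<in> carrier_mat q q" using U V by auto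
  have "det ?B \<noteq> 0" using U V det_transpose[OF U(1)] by (simp add: det_mult[of _ q])
  then have "transpose_mat ?B * ?B \<in> pos_def_mats q"
    using B by (intro pos_def_gram[where r = q]) (auto intro: nonsingular_mult_vec[where A = ?B])
  also have "transpose_mat ?B * ?B = U * transpose_mat V * V * transpose_mat U"
    using U V by (simp add: transpose_mult[of _ q q _ q] assoc_mult_mat[of _ q q _ q _ q])
  finally show ?thesis .
qed

lemma mat_meas_mirror:
  assumes U: "mat_meas M q q U" and V: "mat_meas M q q V"
  shows "mat_meas M q q (\<lambda>w. U w * transpose_mat (V w) * V w * transpose_mat (U w))"
  by (rule mat_meas_mult[OF mat_meas_mult[OF mat_meas_mult[OF U mat_meas_transpose[OF V]] V] mat_meas_transpose[OF U]])

lemma mirror_measurable: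
  assumes U: "mat_meas M q q U" "\<And>w. w \<in> space M \<Longrightarrow> det (U w) \<noteq> 0"
    and V: "mat_meas M q q V" "\<And>w. w \<in> space M \<Longrightarrow> det (V w) \<noteq> 0"
  shows "(\<lambda>w. U w * transpose_mat (V w) * V w * transpose_mat (U w)) \<in> measurable M (pd_borel q)"
proof (rule measurable_pd_borelI)
  fix w assume "w \<in> space M"
  then show "U w * transpose_mat (V w) * V w * transpose_mat (U w) \<in> pos_def_mats q"
    using U V by (intro mirror_pos_def) (auto dest: mat_measD)
qed (use mat_measD(2)[OF mat_meas_mirror[OF U(1) V(1)]] in auto)

lemma det_lower_chol: "S \<in> pos_def_mats q \<Longrightarrow> det (lower_chol S) \<noteq> 0"
  using det_lower_pos[of "lower_chol S" q] lower_chol(2-4) by fastforce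

text \<open>The event is written as a trace on the positive definite matrices because the integrand
  in \<open>y\<close> is formed for all coordinates, also where the mirrored product need not be
  positive definite.\<close>

lemma emeasure_mirror_wishart:
  assumes \<nu>: "\<nu> > real q - 1" and S: "S \<in> pos_def_mats q" and A: "A \<in> sets (mat_borel q)"
  defines "U \<equiv> mat_inv (transpose_mat (lower_chol S))"
  shows "emeasure (mirror_wishart q \<nu> (mat_inv S)) (pos_def_mats q \<inter> A) =
    (\<integral>\<^sup>+y. indicator A (U * transpose_mat (low_mat q y) * low_mat q y * transpose_mat U) *
       ennreal (2 ^ q / wishart_const q \<nu> * bartlett q \<nu> y) \<partial>low_lebesgue q)"
proof -
  let ?f = "\<lambda>S. U * transpose_mat (lower_chol S) * lower_chol S * transpose_mat U"
  have LT: "transpose_mat (lower_chol S) \<in> carrier_mat q q" "det (transpose_mat (lower_chol S)) \<noteq> 0"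
    using lower_chol(2)[OF S] det_lower_chol[OF S] det_transpose[of "lower_chol S" q] by auto
  have U: "U \<in> carrier_mat q q" "det U \<noteq> 0" unfolding U_def using mat_inv(1)[OF LT] det_mat_inv[OF LT] by auto
  have f: "?f \<in> measurable (pd_borel q) (pd_borel q)"
    by (rule mirror_measurable[OF mat_meas_const[OF U(1)] _ mat_meas_lower_chol[OF mat_meas_pd_id]])
      (auto simp: space_pd_borel U det_lower_chol)
  have pA: "pos_def_mats q \<inter> A \<in> sets (pd_borel q)"
    unfolding pd_borel_def sets_restrict_space using A by auto
  have "mirror_wishart q \<nu> (mat_inv S) = distr (wishart q \<nu>) (pd_borel q) ?f"
    unfolding mirror_wishart_def upper_chol_mat_inv[OF S] U_def Let_def ..
  then have "emeasure (mirror_wishart q \<nu> (mat_inv S)) (pos_def_mats q \<inter> A) = emeasure (distr (wishart q \<nu>) (pd_borel q) ?f) (pos_def_mats q \<inter> A)" by simp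
  also have "\<dots> = (\<integral>\<^sup>+S. indicator (pos_def_mats q \<inter> A) S \<partial>distr (wishart q \<nu>) (pd_borel q) ?f)"
    by (rule nn_integral_indicator[symmetric]) (simp add: pA)
  also have "\<dots> = (\<integral>\<^sup>+S. indicator (pos_def_mats q \<inter> A) (?f S) \<partial>wishart q \<nu>)"
    by (rule nn_integral_distr) (use f pA in \<open>simp_all add: measurable_cong_sets[OF sets_wishart refl]\<close>)
  also have "\<dots> = (\<integral>\<^sup>+y. indicator A (U * transpose_mat (low_mat q y) * low_mat q y * transpose_mat U) *
       ennreal (2 ^ q / wishart_const q \<nu> * bartlett q \<nu> y) \<partial>low_lebesgue q)"
  proof (rule nn_integral_wishart[OF \<nu>])
    show "(\<lambda>S. indicator (pos_def_mats q \<inter> A) (?f S)) \<in> borel_measurable (pd_borel q)"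
      by (rule measurable_compose[OF f borel_measurable_indicator[OF pA]])
    have "mat_meas (coord_lebesgue q) q q (\<lambda>y. U * transpose_mat (low_mat q y) * low_mat q y * transpose_mat U)"
      by (intro mat_meas_mirror mat_meas_const U mat_meas_low_mat measurable_coord) auto
    from measurable_compose[OF mat_meas_mat_borel[OF this] borel_measurable_indicator[OF A]]
    show "(\<lambda>y. indicator A (U * transpose_mat (low_mat q y) * low_mat q y * transpose_mat U)) \<in> borel_measurable (coord_lebesgue q)" .
    fix S' assume S': "S' \<in> pos_def_mats q"
    have "low_mat q (low_coords q (lower_chol S')) = lower_chol S'"
      using lower_chol(2,3)[OF S'] by (rule low_mat_low_coords)
    moreover have "?f S' \<in> pos_def_mats q"
      using U lower_chol(2)[OF S'] det_lower_chol[OF S'] by (intro mirror_pos_def)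
    ultimately show "indicator (pos_def_mats q \<inter> A) (?f S') = indicator A (U * transpose_mat (low_mat q (low_coords q (lower_chol S'))) * low_mat q (low_coords q (lower_chol S')) * transpose_mat U)"
      by (simp add: indicator_def)
  qed
  finally show ?thesis .
qed

lemma nn_integral_Gplus_cong:
  assumes "\<And>\<Psi> s. \<Psi> \<in> Gplus q \<Longrightarrow> s > 0 \<Longrightarrow> f \<Psi> s = g \<Psi> s"
  shows "(\<integral>\<^sup>+\<Psi>. \<integral>\<^sup>+s. f \<Psi> s \<partial>pos_lborel \<partial>Gplus_lebesgue q) = (\<integral>\<^sup>+\<Psi>. \<integral>\<^sup>+s. g \<Psi> s \<partial>pos_lborel \<partial>Gplus_lebesgue q)"
  by (intro nn_integral_cong assms) (auto simp: space_Gplus_lebesgue space_restrict_space)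

text \<open>With \<open>R R\<^sup>T = S\<close> the trace in the kernel becomes the squared norm of \<open>V\<close>.\<close>
lemma nn_integral_cond_kernel:
  assumes q: "q \<ge> 1" and S: "S \<in> pos_def_mats q" and \<nu>: "\<nu> > real q - 1" and N: "real N = \<nu> * real q"
  obtains C where "C > 0" "\<And>A. A \<in> sets (pd_borel q) \<Longrightarrow>
    (\<integral>\<^sup>+\<Psi>. \<integral>\<^sup>+s. ennreal (cond_kernel q N S s \<Psi>) * indicator A (mat_inv (s\<^sup>2 \<cdot>\<^sub>m (\<Psi> * transpose_mat \<Psi>))) \<partial>pos_lborel \<partial>Gplus_lebesgue q) =
    ennreal C * emeasure (mirror_wishart q \<nu> (mat_inv S)) A"
proof -
  define R where "R = lower_chol S"
  note R = lower_chol[OF S, folded R_def]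
  define U where "U = mat_inv (transpose_mat R)"
  have dR: "det R \<noteq> 0" using det_lower_chol[OF S] by (simp add: R_def)
  have RT: "transpose_mat R \<in> carrier_mat q q" "det (transpose_mat R) \<noteq> 0"
    using R(2) dR det_transpose[OF R(2)] by auto
  note U = mat_inv[OF RT, folded U_def]
  have dU: "det U \<noteq> 0" using det_mat_inv[OF RT] by (simp add: U_def)
  \<comment> \<open>The cancellation behind the mirror: with V = W^(-1) R, the outer factors
    \<open>U\<close> and its transpose strip \<open>R\<close> from V^T V and leave (W
    W^T)^(-1).\<close>
  have RU: "R * transpose_mat U = 1\<^sub>m q"
    using U R(2) by (metis transpose_mult transpose_one transpose_transpose transpose_carrier_mat)
  obtain C where C: "C > 0" "\<And>H. H \<in> borel_measurable (mat_borel q) \<Longrightarrow>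
     (\<integral>\<^sup>+\<Psi>. \<integral>\<^sup>+s. H (mat_inv (s \<cdot>\<^sub>m \<Psi>) * R) *
        ennreal (s powr (- (\<nu> * real q) - 1) * (\<Prod>i\<in>{1..<q}. \<Psi> $$ (i, i) ^ (i - 1))) \<partial>pos_lborel \<partial>Gplus_lebesgue q) =
     ennreal C * (\<integral>\<^sup>+V. H (low_mat q V) * ennreal (\<Prod>i<q. V (i, i) powr (\<nu> - real i - 1)) \<partial>low_lebesgue q)"
    using nn_integral_scale_shape[OF q R(2-4)] by blast
  \<comment> \<open>The factor that normalizes Bartlett's density; dividing by it turns the constant
    of the substitution into the total mass of the kernel.\<close>
  define c where "c = 2 ^ q / wishart_const q \<nu>"
  have c: "c > 0" using wishart_const_pos[OF \<nu>] by (simp add: c_def)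
  have "(\<integral>\<^sup>+\<Psi>. \<integral>\<^sup>+s. ennreal (cond_kernel q N S s \<Psi>) * indicator A (mat_inv (s\<^sup>2 \<cdot>\<^sub>m (\<Psi> * transpose_mat \<Psi>))) \<partial>pos_lborel \<partial>Gplus_lebesgue q) =
    ennreal (C / c) * emeasure (mirror_wishart q \<nu> (mat_inv S)) A" if "A \<in> sets (pd_borel q)" for A
  proof -
    from that obtain A' where A': "A' \<in> sets (mat_borel q)" and AA': "A = pos_def_mats q \<inter> A'"
      unfolding pd_borel_def sets_restrict_space by auto
    define M where "M V = U * transpose_mat V * V * transpose_mat U" for V
    define H where "H V = ennreal (exp (- mat_trace (V * 1\<^sub>m q * transpose_mat V) / 2)) * indicator A' (M V)" for V
    have tm: "(\<lambda>V. mat_trace (V * 1\<^sub>m q * transpose_mat V)) \<in> borel_measurable (mat_borel q)"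
      by (rule mat_meas_trace[OF mat_meas_mult[OF mat_meas_mult[OF mat_meas_borel_id mat_meas_const[OF one_carrier_mat]]
            mat_meas_transpose[OF mat_meas_borel_id]]])
    have Mm: "M \<in> measurable (mat_borel q) (mat_borel q)"
      unfolding M_def by (intro mat_meas_mat_borel mat_meas_mirror mat_meas_const U mat_meas_borel_id)
    have Hm: "H \<in> borel_measurable (mat_borel q)"
      unfolding H_def
      by (intro borel_measurable_times_ennreal measurable_compose[OF _ measurable_ennreal] measurable_compose[OF _ borel_measurable_exp]
          borel_measurable_divide borel_measurable_uminus borel_measurable_const tm measurable_compose[OF Mm borel_measurable_indicator[OF A']])
    have "(\<integral>\<^sup>+\<Psi>. \<integral>\<^sup>+s. ennreal (cond_kernel q N S s \<Psi>) * indicator A (mat_inv (s\<^sup>2 \<cdot>\<^sub>m (\<Psi> * transpose_mat \<Psi>))) \<partial>pos_lborel \<partial>Gplus_lebesgue q) =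
      (\<integral>\<^sup>+\<Psi>. \<integral>\<^sup>+s. H (mat_inv (s \<cdot>\<^sub>m \<Psi>) * R) *
        ennreal (s powr (- (\<nu> * real q) - 1) * (\<Prod>i\<in>{1..<q}. \<Psi> $$ (i, i) ^ (i - 1))) \<partial>pos_lborel \<partial>Gplus_lebesgue q)"
    proof (rule nn_integral_Gplus_cong)
      fix \<Psi> and s :: real assume \<Psi>: "\<Psi> \<in> Gplus q" and s: "s > 0"
      define W where "W = s \<cdot>\<^sub>m \<Psi>"
      have W: "W \<in> carrier_mat q q" "det W \<noteq> 0" using \<Psi> s by (auto simp: W_def Gplus_def)
      note Wi = mat_inv[OF W]
      have WT: "transpose_mat W \<in> carrier_mat q q" "det (transpose_mat W) \<noteq> 0"
        using W det_transpose[OF W(1)] by auto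
      have "s\<^sup>2 \<cdot>\<^sub>m (\<Psi> * transpose_mat \<Psi>) = W * transpose_mat W"
      proof -
        have "\<Psi> \<in> carrier_mat q q" using \<Psi> by (auto simp: Gplus_def)
        then show ?thesis unfolding W_def
          by (simp add: transpose_smult mult_smult_assoc_mat[of _ q q _ q] mult_smult_distrib[of _ q q _ q])
            (auto intro!: eq_matI simp: power2_eq_square)
      qed
      then have "mat_inv (s\<^sup>2 \<cdot>\<^sub>m (\<Psi> * transpose_mat \<Psi>)) = transpose_mat (mat_inv W) * mat_inv W"
        using mat_inv_mult[OF W WT] mat_inv_transpose[OF W] by simp
      also have "\<dots> = M (mat_inv W * R)"
      proof -
        have "M (mat_inv W * R) = (U * transpose_mat R) * (transpose_mat (mat_inv W) * mat_inv W) * (R * transpose_mat U)"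
          unfolding M_def using U(1) R(2) Wi(1)
          by (simp add: transpose_mult[of _ q q _ q] assoc_mult_mat[of _ q q _ q _ q])
        then show ?thesis unfolding RU U(3) using Wi(1) by simp
      qed
      finally have inv: "mat_inv (s\<^sup>2 \<cdot>\<^sub>m (\<Psi> * transpose_mat \<Psi>)) = M (mat_inv W * R)" .
      have "det (mat_inv W * R) \<noteq> 0" using det_mat_inv[OF W] dR Wi(1) R(2) by (simp add: det_mult[of _ q])
      then have "M (mat_inv W * R) \<in> pos_def_mats q"
        unfolding M_def using U(1) dU Wi(1) R(2) by (intro mirror_pos_def) auto
      then have ind: "indicator A (mat_inv (s\<^sup>2 \<cdot>\<^sub>m (\<Psi> * transpose_mat \<Psi>))) = (indicator A' (M (mat_inv W * R)) :: ennreal)"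
        unfolding inv AA' by (simp add: indicator_def)
      have S1: "S = R * 1\<^sub>m q * transpose_mat R" using R by simp
      have w: "s powr (- (\<nu> * real q) - 1) * (\<Prod>i\<in>{1..<q}. \<Psi> $$ (i, i) ^ (i - 1)) \<ge> 0"
        using \<Psi> by (intro mult_nonneg_nonneg prod_nonneg) (auto simp: Gplus_def pos_diag_def less_imp_le)
      have "ennreal (cond_kernel q N S s \<Psi>) = ennreal (exp (- mat_trace ((mat_inv W * R) * 1\<^sub>m q * transpose_mat (mat_inv W * R)) / 2)) *
         ennreal (s powr (- (\<nu> * real q) - 1) * (\<Prod>i\<in>{1..<q}. \<Psi> $$ (i, i) ^ (i - 1)))"
        unfolding cond_kernel_eq[OF \<Psi> s N R(2) one_carrier_mat S1] W_def
        by (rule ennreal_mult) (use w in auto)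
      then show "ennreal (cond_kernel q N S s \<Psi>) * indicator A (mat_inv (s\<^sup>2 \<cdot>\<^sub>m (\<Psi> * transpose_mat \<Psi>))) =
          H (mat_inv (s \<cdot>\<^sub>m \<Psi>) * R) * ennreal (s powr (- (\<nu> * real q) - 1) * (\<Prod>i\<in>{1..<q}. \<Psi> $$ (i, i) ^ (i - 1)))"
        unfolding ind H_def W_def by (simp only: mult_ac)
    qed
    also have "\<dots> = ennreal C * (\<integral>\<^sup>+V. H (low_mat q V) * ennreal (\<Prod>i<q. V (i, i) powr (\<nu> - real i - 1)) \<partial>low_lebesgue q)"
      by (rule C(2)[OF Hm])
    also have "(\<integral>\<^sup>+V. H (low_mat q V) * ennreal (\<Prod>i<q. V (i, i) powr (\<nu> - real i - 1)) \<partial>low_lebesgue q) =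
       (\<integral>\<^sup>+V. ennreal (1 / c) * (indicator A' (M (low_mat q V)) * ennreal (c * bartlett q \<nu> V)) \<partial>low_lebesgue q)"
    proof (rule nn_integral_cong)
      fix V
      have b: "bartlett q \<nu> V = exp (- mat_trace (low_mat q V * 1\<^sub>m q * transpose_mat (low_mat q V)) / 2) * (\<Prod>i<q. V (i, i) powr (\<nu> - real i - 1))"
        unfolding bartlett_def using trace_gram_low[of q V] by simp
      have "(\<Prod>i<q. V (i, i) powr (\<nu> - real i - 1)) \<ge> 0" by (intro prod_nonneg) auto
      then have "ennreal (bartlett q \<nu> V) = ennreal (exp (- mat_trace (low_mat q V * 1\<^sub>m q * transpose_mat (low_mat q V)) / 2)) * ennreal (\<Prod>i<q. V (i, i) powr (\<nu> - real i - 1))"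
        unfolding b by (intro ennreal_mult) auto
      moreover have "ennreal (1 / c) * ennreal (c * bartlett q \<nu> V) = ennreal (bartlett q \<nu> V)"
        using c bartlett_nonneg[of q \<nu> V] by (simp add: ennreal_mult[symmetric])
      ultimately have e: "ennreal (exp (- mat_trace (low_mat q V * 1\<^sub>m q * transpose_mat (low_mat q V)) / 2)) * ennreal (\<Prod>i<q. V (i, i) powr (\<nu> - real i - 1)) =
          ennreal (1 / c) * ennreal (c * bartlett q \<nu> V)" by (simp only:)
      have gen: "(a * i) * b = d * (i * e)" if "a * b = d * e" for a b d e i :: ennreal
      proof -
        have "(a * i) * b = i * (a * b)" by (simp only: mult_ac)
        also have "\<dots> = d * (i * e)" unfolding that by (simp only: mult_ac)
        finally show ?thesis .
      qed
      show "H (low_mat q V) * ennreal (\<Prod>i<q. V (i, i) powr (\<nu> - real i - 1)) =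
          ennreal (1 / c) * (indicator A' (M (low_mat q V)) * ennreal (c * bartlett q \<nu> V))"
        unfolding H_def by (rule gen[OF e])
    qed
    also have "\<dots> = ennreal (1 / c) * (\<integral>\<^sup>+V. indicator A' (M (low_mat q V)) * ennreal (c * bartlett q \<nu> V) \<partial>low_lebesgue q)"
    proof (rule nn_integral_cmult)
      show "(\<lambda>V. indicator A' (M (low_mat q V)) * ennreal (c * bartlett q \<nu> V)) \<in> borel_measurable (low_lebesgue q)"
        unfolding measurable_cong_sets[OF sets_low_lebesgue refl]
        by (intro borel_measurable_times_ennreal measurable_compose[OF measurable_low_mat measurable_compose[OF Mm borel_measurable_indicator[OF A']]]
            measurable_compose[OF _ measurable_ennreal] borel_measurable_times borel_measurable_const bartlett_measurable)
    qed
    also have "(\<integral>\<^sup>+V. indicator A' (M (low_mat q V)) * ennreal (c * bartlett q \<nu> V) \<partial>low_lebesgue q) = emeasure (mirror_wishart q \<nu> (mat_inv S)) A"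
      unfolding AA' emeasure_mirror_wishart[OF \<nu> S A'] M_def U_def R_def c_def ..
    also have "ennreal C * (ennreal (1 / c) * emeasure (mirror_wishart q \<nu> (mat_inv S)) A) = ennreal (C / c) * emeasure (mirror_wishart q \<nu> (mat_inv S)) A"
      using C(1) c by (simp add: mult.assoc[symmetric] ennreal_mult[symmetric])
    finally show ?thesis .
  qed
  then show ?thesis using that[of "C / c"] C(1) c by auto
qed

section \<open>The singular case\<close>

text \<open>No power is integrable both at 0 and at infinity. After t = exp u the integrand is exp
  ((a + 1) u), whose values at \<open>u\<close> and \<open>- u\<close> add up to at least 1.\<close>

lemma nn_integral_powr_infinite: "(\<integral>\<^sup>+t. ennreal (t powr a) * indicator {0<..} t \<partial>lborel) = \<top>"
proof -
  let ?f = "\<lambda>u. ennreal (exp ((a + 1) * u))"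
  have sub: "(\<integral>\<^sup>+u. ennreal (exp u powr a) * (ennreal \<bar>exp u\<bar> * indicator UNIV u) \<partial>lborel) = (\<integral>\<^sup>+t. ennreal (t powr a) * indicator {0<..} t \<partial>lborel)"
  proof (rule nn_integral_change_of_variables_real)
    show "range exp = {0 :: real<..}" by (auto simp: image_iff) (metis exp_ln)
    show "(exp has_real_derivative exp x) (at x within UNIV)" for x :: real by (auto intro!: derivative_eq_intros)
  qed (auto simp: inj_on_def)
  have E: "ennreal (exp u powr a) * (ennreal \<bar>exp u\<bar> * indicator UNIV u) = ?f u" for u
    by (simp add: ennreal_mult[symmetric] powr_def exp_add[symmetric] algebra_simps)
  have I: "(\<integral>\<^sup>+t. ennreal (t powr a) * indicator {0<..} t \<partial>lborel) = (\<integral>\<^sup>+u. ?f u \<partial>lborel)"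
    unfolding E[symmetric] by (rule sub[symmetric])
  have J: "(\<integral>\<^sup>+u. ?f (- u) \<partial>lborel) = (\<integral>\<^sup>+u. ?f u \<partial>lborel)"
    using nn_integral_subst_affine[of "-1" ?f 0] by simp
  have "\<top> = (\<integral>\<^sup>+u. 1 \<partial>(lborel :: real measure))" by simp
  also have "\<dots> \<le> (\<integral>\<^sup>+u. ?f u + ?f (- u) \<partial>lborel)"
  proof (rule nn_integral_mono)
    fix u :: real
    have "1 \<le> exp ((a + 1) * u) + exp ((a + 1) * - u)"
    proof (cases "(a + 1) * u \<ge> 0")
      case True
      then have "1 \<le> exp ((a + 1) * u)" by simp
      moreover have "0 \<le> exp ((a + 1) * - u)" by simp
      ultimately show ?thesis by linarith
    next
      case False
      then have "1 \<le> exp ((a + 1) * - u)" by simp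
      moreover have "0 \<le> exp ((a + 1) * u)" by simp
      ultimately show ?thesis by linarith
    qed
    then show "1 \<le> ?f u + ?f (- u)"
      by (metis ennreal_leI ennreal_1 ennreal_plus exp_ge_zero)
  qed
  also have "\<dots> = (\<integral>\<^sup>+u. ?f u \<partial>lborel) + (\<integral>\<^sup>+u. ?f u \<partial>lborel)"
    by (subst nn_integral_add) (simp_all only: J, auto)
  finally show ?thesis unfolding I by (simp add: top_unique)
qed

lemma mult_mat_index:
  assumes "A \<in> carrier_mat n k" "B \<in> carrier_mat k l" "i < n" "j < l"
  shows "(A * B) $$ (i, j) = (\<Sum>a<k. A $$ (i, a) * B $$ (a, j))"
  using assms by (simp add: scalar_prod_def lessThan_atLeast0)

lemma ennreal_top_mult_top: "\<top> * \<top> = (\<top> :: ennreal)"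
  by (simp add: ennreal_mult_eq_top_iff)

lemma mat_trace_sandwich:
  assumes "V \<in> carrier_mat q q" "T \<in> carrier_mat q q"
  shows "mat_trace (V * T * transpose_mat V) = (\<Sum>i<q. \<Sum>b<q. (\<Sum>a<q. V $$ (i, a) * T $$ (a, b)) * V $$ (i, b))"
proof -
  have "(V * T * transpose_mat V) $$ (i, i) = (\<Sum>b<q. (\<Sum>a<q. V $$ (i, a) * T $$ (a, b)) * V $$ (i, b))" if "i < q" for i
  proof -
    have "(V * T * transpose_mat V) $$ (i, i) = (\<Sum>b<q. (V * T) $$ (i, b) * transpose_mat V $$ (b, i))"
      by (rule mult_mat_index[of _ q q _ q]) (use assms that in auto)
    also have "\<dots> = (\<Sum>b<q. (\<Sum>a<q. V $$ (i, a) * T $$ (a, b)) * V $$ (i, b))"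
    proof (rule sum.cong)
      fix b assume "b \<in> {..<q}"
      then show "(V * T) $$ (i, b) * transpose_mat V $$ (b, i) = (\<Sum>a<q. V $$ (i, a) * T $$ (a, b)) * V $$ (i, b)"
        using mult_mat_index[OF assms, of i b] assms that by simp
    qed simp
    finally show ?thesis .
  qed
  then show ?thesis using assms by (simp add: mat_trace_def)
qed

text \<open>
  For a null vector \<open>v\<close> of \<open>S\<close> with last nonzero entry at \<open>m\<close>, substituting with the \<open>R\<close> for which the
  \<open>m\<close>-th column of \<open>R\<^sup>-\<^sup>T\<close> is \<open>v\<close> makes the exponent independent of the diagonal entry \<open>V\<^sub>m\<^sub>m\<close>, over which
  a power is then integrated.  The conclusion says that the integral is \<open>0\<close> or \<open>\<infinity>\<close>.
\<close>
lemma nn_integral_cond_kernel_singular: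
  assumes q: "q \<ge> 1" and S: "S \<in> carrier_mat q q" "transpose_mat S = S"
    and v: "v \<in> carrier_vec q" "v \<noteq> 0\<^sub>v q" "S *\<^sub>v v = 0\<^sub>v q" and N: "real N = \<nu> * real q"
  shows "(\<integral>\<^sup>+\<Psi>. \<integral>\<^sup>+s. ennreal (cond_kernel q N S s \<Psi>) \<partial>pos_lborel \<partial>Gplus_lebesgue q) =
    \<top> * (\<integral>\<^sup>+\<Psi>. \<integral>\<^sup>+s. ennreal (cond_kernel q N S s \<Psi>) \<partial>pos_lborel \<partial>Gplus_lebesgue q)"
proof -
  interpret product_sigma_finite "\<lambda>_ :: nat \<times> nat. lborel :: real measure" by standard
  define m where "m = Max {i. i < q \<and> vec_index v i \<noteq> 0}"
  have ne: "{i. i < q \<and> vec_index v i \<noteq> 0} \<noteq> {}"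
  proof
    assume "{i. i < q \<and> vec_index v i \<noteq> 0} = {}"
    then have "v = 0\<^sub>v q" using v(1) by (intro eq_vecI) auto
    then show False using v(2) by simp
  qed
  have "m \<in> {i. i < q \<and> vec_index v i \<noteq> 0}" unfolding m_def using ne by (intro Max_in) auto
  then have m: "m < q" "vec_index v m \<noteq> 0" by auto
  have above: "vec_index v i = 0" if "i < q" "i > m" for i
  proof (rule ccontr)
    assume "vec_index v i \<noteq> 0"
    then have "i \<le> m" unfolding m_def using that by (intro Max_ge) auto
    then show False using that by simp
  qed
  \<comment> \<open>The identity with column \<open>m\<close> replaced by \<open>v\<close>,
    normalized to have 1 on the diagonal. As \<open>v\<close> vanishes after \<open>m\<close>, this
    matrix is upper triangular, which makes the inverse \<open>R\<close> of its transpose an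
    admissible lower triangular factor.\<close>
  define Q where "Q = mat q q (\<lambda>(i, j). if j = m then vec_index v i / vec_index v m else if i = j then 1 else (0::real))"
  have Q: "Q \<in> carrier_mat q q" by (simp add: Q_def)
  have QT: "transpose_mat Q \<in> carrier_mat q q" "lower_triangular (transpose_mat Q)" "pos_diag (transpose_mat Q)"
    using above m by (auto simp: lower_triangular_def pos_diag_def Q_def)
  have dQ: "det (transpose_mat Q) \<noteq> 0" using det_lower_pos[OF QT] by simp
  define R where "R = mat_inv (transpose_mat Q)"
  note R = mat_inv[OF QT(1) dQ, folded R_def] lower_triangular_mat_inv[OF QT, folded R_def]
  \<comment> \<open>Column \<open>m\<close> of \<open>S * Q\<close> is a multiple of
    \<open>S v = 0\<close>; by symmetry both row and column \<open>m\<close> of \<open>T\<close>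
    vanish.\<close>
  define T where "T = transpose_mat Q * S * Q"
  have T: "T \<in> carrier_mat q q" using Q S by (auto simp: T_def)
  have QRT: "Q * transpose_mat R = 1\<^sub>m q"
    using R(3) Q R(1) by (metis transpose_mult transpose_one transpose_transpose transpose_carrier_mat)
  have SRT: "S = R * T * transpose_mat R"
  proof -
    have "R * T * transpose_mat R = (R * transpose_mat Q) * S * (Q * transpose_mat R)"
      unfolding T_def using R(1) Q S(1) by (simp add: assoc_mult_mat[of _ q q _ q _ q])
    then show ?thesis unfolding QRT R(3) using S(1) by simp
  qed
  have Tcol: "T $$ (i, m) = 0" if "i < q" for i
  proof -
    have SQ: "(S * Q) $$ (a, m) = 0" if "a < q" for a
    proof -
      have "(S * Q) $$ (a, m) = (\<Sum>b=0..<q. S $$ (a, b) * (vec_index v b / vec_index v m))"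
        using that m S Q by (simp add: scalar_prod_def) (simp add: Q_def)
      also have "\<dots> = (\<Sum>b=0..<q. S $$ (a, b) * vec_index v b) / vec_index v m"
        by (simp add: sum_divide_distrib)
      also have "(\<Sum>b=0..<q. S $$ (a, b) * vec_index v b) = vec_index (S *\<^sub>v v) a"
        using that S(1) v(1) by (simp add: scalar_prod_def)
      also have "vec_index (S *\<^sub>v v) a = 0" using v(3) that by simp
      finally show ?thesis by simp
    qed
    have "T = transpose_mat Q * (S * Q)" unfolding T_def using Q S by (simp add: assoc_mult_mat[of _ q q _ q _ q])
    then have "T $$ (i, m) = (\<Sum>a<q. transpose_mat Q $$ (i, a) * (S * Q) $$ (a, m))"
      using that m(1) Q S(1) by (simp only:) (rule mult_mat_index[of _ q q _ q], auto)
    then show ?thesis using SQ by simp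
  qed
  have "transpose_mat T = T"
    unfolding T_def using Q S by (simp add: transpose_mult[of _ q q _ q] assoc_mult_mat[of _ q q _ q _ q])
  then have Trow: "T $$ (m, i) = 0" if "i < q" for i
    using Tcol[OF that] T that m by (metis index_transpose_mat(1) carrier_matD)
  \<comment> \<open>The trace pairs the rows of \<open>V\<close> through \<open>T\<close>, so the
    whole column \<open>m\<close> of \<open>V\<close> drops out of it, in particular the diagonal
    entry.\<close>
  have tr: "mat_trace (low_mat q (x((m, m) := t)) * T * transpose_mat (low_mat q (x((m, m) := t)))) =
      mat_trace (low_mat q (x((m, m) := 1)) * T * transpose_mat (low_mat q (x((m, m) := 1))))" for x t
    unfolding mat_trace_sandwich[OF low_mat_carrier(1) T]
  proof (intro sum.cong refl)
    fix i b assume ib: "i \<in> {..<q}" "b \<in> {..<q}"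
    have 1: "(\<Sum>a<q. low_mat q (x((m, m) := t)) $$ (i, a) * T $$ (a, b)) = (\<Sum>a<q. low_mat q (x((m, m) := 1)) $$ (i, a) * T $$ (a, b))"
    proof (intro sum.cong refl)
      fix a assume "a \<in> {..<q}"
      then show "low_mat q (x((m, m) := t)) $$ (i, a) * T $$ (a, b) = low_mat q (x((m, m) := 1)) $$ (i, a) * T $$ (a, b)"
        using ib Trow by (cases "a = m") auto
    qed
    show "(\<Sum>a<q. low_mat q (x((m, m) := t)) $$ (i, a) * T $$ (a, b)) * low_mat q (x((m, m) := t)) $$ (i, b) =
       (\<Sum>a<q. low_mat q (x((m, m) := 1)) $$ (i, a) * T $$ (a, b)) * low_mat q (x((m, m) := 1)) $$ (i, b)"
    proof (cases "b = m")
      case True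
      then have "(\<Sum>a<q. low_mat q (x((m, m) := 1)) $$ (i, a) * T $$ (a, b)) = 0" using Tcol by (intro sum.neutral) auto
      then show ?thesis unfolding 1 by simp
    next
      case False
      then show ?thesis unfolding 1 using ib by simp
    qed
  qed
  define H where "H V = ennreal (exp (- mat_trace (V * T * transpose_mat V) / 2))" for V
  have Hm: "H \<in> borel_measurable (mat_borel q)"
    unfolding H_def
    by (intro measurable_compose[OF _ measurable_ennreal] measurable_compose[OF _ borel_measurable_exp]
          borel_measurable_divide borel_measurable_uminus borel_measurable_const
          mat_meas_trace[OF mat_meas_mult[OF mat_meas_mult[OF mat_meas_borel_id mat_meas_const[OF T]]
            mat_meas_transpose[OF mat_meas_borel_id]]])
  obtain C where C: "C > 0" "\<And>H. H \<in> borel_measurable (mat_borel q) \<Longrightarrow>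
     (\<integral>\<^sup>+\<Psi>. \<integral>\<^sup>+s. H (mat_inv (s \<cdot>\<^sub>m \<Psi>) * R) *
        ennreal (s powr (- (\<nu> * real q) - 1) * (\<Prod>i\<in>{1..<q}. \<Psi> $$ (i, i) ^ (i - 1))) \<partial>pos_lborel \<partial>Gplus_lebesgue q) =
     ennreal C * (\<integral>\<^sup>+V. H (low_mat q V) * ennreal (\<Prod>i<q. V (i, i) powr (\<nu> - real i - 1)) \<partial>low_lebesgue q)"
    using nn_integral_scale_shape[OF q R(1,4,5)] by blast
  define f where "f V = H (low_mat q V) * ennreal (\<Prod>i<q. V (i, i) powr (\<nu> - real i - 1))" for V
  have fm: "f \<in> borel_measurable (coord_lebesgue q)"
    unfolding f_def
    by (intro borel_measurable_times_ennreal measurable_compose[OF measurable_low_mat Hm] measurable_compose[OF _ measurable_ennreal]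
        borel_measurable_prod powr_real_measurable measurable_coord borel_measurable_const) auto
  have I: "(\<integral>\<^sup>+\<Psi>. \<integral>\<^sup>+s. ennreal (cond_kernel q N S s \<Psi>) \<partial>pos_lborel \<partial>Gplus_lebesgue q) = ennreal C * (\<integral>\<^sup>+V. f V \<partial>low_lebesgue q)"
    unfolding f_def C(2)[OF Hm, symmetric]
  proof (rule nn_integral_Gplus_cong)
    fix \<Psi> and s :: real assume \<Psi>: "\<Psi> \<in> Gplus q" and s: "s > 0"
    have w: "s powr (- (\<nu> * real q) - 1) * (\<Prod>i\<in>{1..<q}. \<Psi> $$ (i, i) ^ (i - 1)) \<ge> 0"
      using \<Psi> by (intro mult_nonneg_nonneg prod_nonneg) (auto simp: Gplus_def pos_diag_def less_imp_le)
    show "ennreal (cond_kernel q N S s \<Psi>) = H (mat_inv (s \<cdot>\<^sub>m \<Psi>) * R) * ennreal (s powr (- (\<nu> * real q) - 1) * (\<Prod>i\<in>{1..<q}. \<Psi> $$ (i, i) ^ (i - 1)))"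
      unfolding cond_kernel_eq[OF \<Psi> s N R(1) T SRT] H_def
      by (rule ennreal_mult) (use w in auto)
  qed
  define K where "K = low q - {(m, m)}"
  have K: "low q = insert (m, m) K" "(m, m) \<notin> K" "finite K" using m finite_low[of q] by (auto simp: K_def)
  \<comment> \<open>The 1 at \<open>(m, m)\<close> is an arbitrary placeholder that makes
    \<open>e\<close> independent of that coordinate.\<close>
  define e where "e x = H (low_mat q (x((m, m) := 1))) * ennreal (\<Prod>i\<in>{..<q} - {m}. x (i, i) powr (\<nu> - real i - 1)) *
     of_bool (\<forall>i<q. i \<noteq> m \<longrightarrow> x (i, i) > 0)" for x
  have fe: "f (x((m, m) := t)) * indicator (low_pos q) (x((m, m) := t)) = e x * (ennreal (t powr (\<nu> - real m - 1)) * indicator {0<..} t)" for x t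
  proof -
    have "(\<Prod>i<q. (x((m, m) := t)) (i, i) powr (\<nu> - real i - 1)) = t powr (\<nu> - real m - 1) * (\<Prod>i\<in>{..<q} - {m}. x (i, i) powr (\<nu> - real i - 1))"
      using m by (subst prod.remove[of _ m]) (auto intro!: prod.cong)
    then have "ennreal (\<Prod>i<q. (x((m, m) := t)) (i, i) powr (\<nu> - real i - 1)) = ennreal (t powr (\<nu> - real m - 1)) * ennreal (\<Prod>i\<in>{..<q} - {m}. x (i, i) powr (\<nu> - real i - 1))"
      by (simp add: ennreal_mult prod_nonneg)
    moreover have "indicator (low_pos q) (x((m, m) := t)) = (of_bool (\<forall>i<q. i \<noteq> m \<longrightarrow> x (i, i) > 0) * indicator {0<..} t :: ennreal)"
      using m by (auto simp: low_pos_def indicator_def)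
    moreover have "H (low_mat q (x((m, m) := t))) = H (low_mat q (x((m, m) := 1)))"
      unfolding H_def tr[of x t] ..
    ultimately show ?thesis unfolding f_def e_def by (simp only: mult_ac)
  qed
  \<comment> \<open>The inner integral over the free diagonal entry is infinite and absorbs
    \<open>c\<close>. Comparing \<open>c = 1\<close> with \<open>c = \<top>\<close> shows that the
    whole integral is unchanged by multiplication with \<open>\<top>\<close>.\<close>
  have J: "(\<integral>\<^sup>+V. c * f V \<partial>low_lebesgue q) = (\<integral>\<^sup>+x. e x * \<top> \<partial>PiM K (\<lambda>_. lborel))" if c: "c * \<top> = \<top>" for c :: ennreal
  proof -
    have cfm: "(\<lambda>V. c * f V) \<in> borel_measurable (coord_lebesgue q)"
      by (intro borel_measurable_times_ennreal borel_measurable_const fm)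
    have "(\<integral>\<^sup>+V. c * f V \<partial>low_lebesgue q) = (\<integral>\<^sup>+V. c * f V * indicator (low_pos q) V \<partial>coord_lebesgue q)"
      by (rule nn_integral_low_lebesgue[OF cfm])
    also have "\<dots> = (\<integral>\<^sup>+x. \<integral>\<^sup>+t. c * f (x((m, m) := t)) * indicator (low_pos q) (x((m, m) := t)) \<partial>lborel \<partial>PiM K (\<lambda>_. lborel))"
    proof -
      have "(\<lambda>V. c * f V * indicator (low_pos q) V) \<in> borel_measurable (PiM (insert (m, m) K) (\<lambda>_. lborel))"
        unfolding K(1)[symmetric] by (intro borel_measurable_times_ennreal cfm indicator_low_pos_measurable)
      from product_nn_integral_insert[OF K(3,2) this] show ?thesis unfolding K(1)[symmetric] .
    qed
    also have "\<dots> = (\<integral>\<^sup>+x. e x * \<top> \<partial>PiM K (\<lambda>_. lborel))"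
    proof (rule nn_integral_cong)
      fix x
      have "(\<integral>\<^sup>+t. c * f (x((m, m) := t)) * indicator (low_pos q) (x((m, m) := t)) \<partial>lborel) =
        (\<integral>\<^sup>+t. (c * e x) * (ennreal (t powr (\<nu> - real m - 1)) * indicator {0<..} t) \<partial>lborel)"
        by (simp only: mult.assoc fe)
      also have "\<dots> = (c * e x) * \<top>"
        by (subst nn_integral_cmult) (simp_all only: nn_integral_powr_infinite, auto)
      also have "\<dots> = e x * (c * \<top>)" by (simp only: mult_ac)
      finally show "(\<integral>\<^sup>+t. c * f (x((m, m) := t)) * indicator (low_pos q) (x((m, m) := t)) \<partial>lborel) = e x * \<top>"
        unfolding c .
    qed
    finally show ?thesis .
  qed
  have "\<top> * (\<integral>\<^sup>+V. f V \<partial>low_lebesgue q) = (\<integral>\<^sup>+V. \<top> * f V \<partial>low_lebesgue q)"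
    by (rule nn_integral_cmult[symmetric]) (simp only: measurable_cong_sets[OF sets_low_lebesgue refl] fm)
  also have "\<dots> = (\<integral>\<^sup>+V. 1 * f V \<partial>low_lebesgue q)" unfolding J[of \<top>, OF ennreal_top_mult_top] J[of 1, OF mult_1] ..
  finally have "\<top> * (\<integral>\<^sup>+V. f V \<partial>low_lebesgue q) = (\<integral>\<^sup>+V. f V \<partial>low_lebesgue q)" by simp
  then show ?thesis unfolding I by (metis mult.left_commute)
qed

section \<open>Tucker products and matricization\<close>

lemma multi_indices_list_all2: "is \<in> multi_indices ds \<longleftrightarrow> list_all2 (<) is ds"
  by (auto simp: multi_indices_def list_all2_conv_all_nth)

lemma multi_index_bounds: "l < prod_list ds \<Longrightarrow> list_all2 (<) (multi_index ds l) ds"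
proof (induction ds arbitrary: l)
  case (Cons d ds)
  then have "d > 0" by (cases d) auto
  then show ?case using Cons by (auto simp: less_mult_imp_div_less mult.commute)
qed simp

lemma flat_index_bound: "list_all2 (<) is ds \<Longrightarrow> flat_index ds is < prod_list ds"
proof (induction "is" ds rule: list_all2_induct)
  case (Cons i "is" d ds)
  have "i + d * flat_index ds is < d * Suc (flat_index ds is)" using Cons by simp
  also have "\<dots> \<le> d * prod_list ds" using Cons by (intro mult_le_mono2) simp
  finally show ?case by simp
qed simp

lemma multi_index_flat_index: "list_all2 (<) is ds \<Longrightarrow> multi_index ds (flat_index ds is) = is"
  by (induction "is" ds rule: list_all2_induct) auto

lemma flat_index_multi_index: "l < prod_list ds \<Longrightarrow> flat_index ds (multi_index ds l) = l"
proof (induction ds arbitrary: l)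
  case (Cons d ds)
  then show ?case by (auto simp: less_mult_imp_div_less mult.commute)
qed simp

lemma sum_multi_indices: "(\<Sum>is\<in>multi_indices ds. f is) = (\<Sum>l<prod_list ds. f (multi_index ds l))"
  by (rule sum.reindex_bij_witness[where i = "multi_index ds" and j = "flat_index ds"])
    (auto simp: multi_indices_list_all2 multi_index_bounds flat_index_bound multi_index_flat_index flat_index_multi_index)

text \<open>The index-level form of \<open>matricize\<close>: the row index is split off and the
  remaining modes index the columns.\<close>

lemma sum_multi_indices_insert:
  fixes f :: "nat list \<Rightarrow> real"
  shows "(\<Sum>is\<in>multi_indices (ds1 @ d # ds2). f is) =
    (\<Sum>i<d. \<Sum>js\<in>multi_indices (ds1 @ ds2). f (take (length ds1) js @ i # drop (length ds1) js))"
proof -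
  let ?k = "length ds1"
  have "(\<Sum>is\<in>multi_indices (ds1 @ d # ds2). f is) =
    (\<Sum>(i, js)\<in>{..<d} \<times> multi_indices (ds1 @ ds2). f (take ?k js @ i # drop ?k js))"
  proof (rule sum.reindex_bij_witness[where i = "\<lambda>(i, js). take ?k js @ i # drop ?k js"
        and j = "\<lambda>is. (is ! ?k, take ?k is @ drop (Suc ?k) is)"], goal_cases)
    case (1 "is")
    then have "?k < length is" by (auto simp: multi_indices_def)
    then show ?case by (simp add: id_take_nth_drop[symmetric])
  next
    case (2 "is")
    then obtain is1 i is2 where e: "is = is1 @ i # is2" "list_all2 (<) is1 ds1" "i < d" "list_all2 (<) is2 ds2"
      by (auto simp: multi_indices_list_all2 list_all2_append2 list_all2_Cons2)
    then have "length is1 = ?k" by (auto dest: list_all2_lengthD)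
    then show ?case using e by (auto simp: multi_indices_list_all2 nth_append intro: list_all2_appendI)
  next
    case (3 x)
    then obtain i js1 js2 where e: "x = (i, js1 @ js2)" "i < d" "list_all2 (<) js1 ds1" "list_all2 (<) js2 ds2"
      by (auto simp: multi_indices_list_all2 list_all2_append2)
    then have "length js1 = ?k" by (auto dest: list_all2_lengthD)
    then show ?case using e by (auto simp: nth_append)
  next
    case (4 x)
    then obtain i js1 js2 where e: "x = (i, js1 @ js2)" "i < d" "list_all2 (<) js1 ds1" "list_all2 (<) js2 ds2"
      by (auto simp: multi_indices_list_all2 list_all2_append2)
    then have "length js1 = ?k" by (auto dest: list_all2_lengthD)
    then show ?case using e by (auto simp: multi_indices_list_all2 intro!: list_all2_appendI)
  next
    case (5 "is")
    then have "?k < length is" by (auto simp: multi_indices_def)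
    then show ?case by (simp add: id_take_nth_drop[symmetric])
  qed
  then show ?thesis by (simp add: sum.cartesian_product)
qed

section \<open>Kronecker products addressed by multi-indices\<close>

text \<open>The reversed order in \<open>kronecker_rev\<close> matches the convention that the first
  index varies fastest, so factors and indices are read in the same direction and a factor can be
  taken out at any position.\<close>

fun kron_entry :: "real mat list \<Rightarrow> nat list \<Rightarrow> nat list \<Rightarrow> real" where
  "kron_entry (A # As) (i # is) (j # js) = A $$ (i, j) * kron_entry As is js"
| "kron_entry _ _ _ = 1"

lemma dim_kronecker[simp]:
  "dim_row (kronecker A B) = dim_row A * dim_row B" "dim_col (kronecker A B) = dim_col A * dim_col B"
  by (auto simp: kronecker_def)

lemma dim_kronecker_rev[simp]:
  "dim_row (kronecker_rev As) = prod_list (map dim_row As)" "dim_col (kronecker_rev As) = prod_list (map dim_col As)"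
  by (induction As) auto

lemma kronecker_rev_index:
  "r < prod_list (map dim_row As) \<Longrightarrow> c < prod_list (map dim_col As) \<Longrightarrow>
    kronecker_rev As $$ (r, c) = kron_entry As (multi_index (map dim_row As) r) (multi_index (map dim_col As) c)"
proof (induction As arbitrary: r c)
  case (Cons A As)
  have "r div dim_row A < prod_list (map dim_row As)" "c div dim_col A < prod_list (map dim_col As)"
    using Cons.prems by (auto simp: less_mult_imp_div_less mult.commute)
  then show ?case using Cons by (simp add: kronecker_def mult.commute)
qed simp

lemma kron_entry_insert:
  "length is1 = length As1 \<Longrightarrow> length js1 = length As1 \<Longrightarrow>
    kron_entry (As1 @ A # As2) (is1 @ i # is2) (js1 @ j # js2) = A $$ (i, j) * kron_entry (As1 @ As2) (is1 @ is2) (js1 @ js2)"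
proof (induction As1 arbitrary: is1 js1)
  case (Cons B Bs)
  then show ?case by (cases is1; cases js1) auto
qed auto

lemma sum_div_mod:
  fixes f :: "nat \<Rightarrow> nat \<Rightarrow> 'a::comm_monoid_add"
  shows "(\<Sum>l<a * b. f (l div b) (l mod b)) = (\<Sum>i<a. \<Sum>j<b. f i j)"
proof -
  have "(\<Sum>l<a * b. f (l div b) (l mod b)) = (\<Sum>(i, j)\<in>{..<a} \<times> {..<b}. f i j)"
  proof (rule sum.reindex_bij_witness[where i = "\<lambda>(i, j). i * b + j" and j = "\<lambda>l. (l div b, l mod b)"], goal_cases)
    case (4 ij)
    then obtain i j where ij: "ij = (i, j)" "i < a" "j < b" by auto
    have "i * b + j < Suc i * b" using ij by simp
    also have "\<dots> \<le> a * b" using ij by (intro mult_le_mono1) simp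
    finally show ?case using ij by simp
  next
    case (2 l)
    then have "b > 0" by (cases b) auto
    then show ?case using 2 by (auto simp: less_mult_imp_div_less)
  qed auto
  then show ?thesis by (simp add: sum.cartesian_product)
qed

lemma kronecker_mult:
  assumes "A \<in> carrier_mat a b" "C \<in> carrier_mat b c" "B \<in> carrier_mat a' b'" "D \<in> carrier_mat b' c'"
  shows "kronecker A B * kronecker C D = kronecker (A * C) (B * D)"
proof (rule eq_matI)
  fix i j assume "i < dim_row (kronecker (A * C) (B * D))" "j < dim_col (kronecker (A * C) (B * D))"
  then have ij: "i < a * a'" "j < c * c'" using assms by auto
  then have pos: "a' > 0" "c' > 0" by (cases a'; cases c'; auto)+
  then have d: "i div a' < a" "i mod a' < a'" "j div c' < c" "j mod c' < c'"
    using ij by (auto simp: less_mult_imp_div_less)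
  have "(kronecker A B * kronecker C D) $$ (i, j) = (\<Sum>l<b * b'. kronecker A B $$ (i, l) * kronecker C D $$ (l, j))"
    by (rule mult_mat_index[of _ "a * a'" _ _ "c * c'"]) (use assms ij in \<open>auto intro!: carrier_matI\<close>)
  also have "\<dots> = (\<Sum>l<b * b'. A $$ (i div a', l div b') * B $$ (i mod a', l mod b') * (C $$ (l div b', j div c') * D $$ (l mod b', j mod c')))"
    using assms ij by (intro sum.cong) (auto simp: kronecker_def)
  also have "\<dots> = (\<Sum>l<b. \<Sum>l'<b'. A $$ (i div a', l) * B $$ (i mod a', l') * (C $$ (l, j div c') * D $$ (l', j mod c')))"
    by (rule sum_div_mod)
  also have "\<dots> = (\<Sum>l<b. A $$ (i div a', l) * C $$ (l, j div c')) * (\<Sum>l'<b'. B $$ (i mod a', l') * D $$ (l', j mod c'))"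
    by (simp add: sum_product mult_ac)
  also have "\<dots> = (A * C) $$ (i div a', j div c') * (B * D) $$ (i mod a', j mod c')"
    using mult_mat_index[OF assms(1,2) d(1,3)] mult_mat_index[OF assms(3,4) d(2,4)] by simp
  also have "\<dots> = kronecker (A * C) (B * D) $$ (i, j)"
    using assms ij by (simp add: kronecker_def)
  finally show "(kronecker A B * kronecker C D) $$ (i, j) = kronecker (A * C) (B * D) $$ (i, j)" .
qed (use assms in auto)

lemma kronecker_one: "kronecker (1\<^sub>m a) (1\<^sub>m b) = 1\<^sub>m (a * b)"
proof (rule eq_matI)
  fix i j assume ij: "i < dim_row (1\<^sub>m (a * b) :: real mat)" "j < dim_col (1\<^sub>m (a * b) :: real mat)"
  then have "b > 0" by (cases b) auto
  then have "i div b < a" "j div b < a" "i mod b < b" "j mod b < b" using ij by (auto simp: less_mult_imp_div_less)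
  moreover have "i = j \<longleftrightarrow> i div b = j div b \<and> i mod b = j mod b" by (metis div_mult_mod_eq)
  ultimately show "kronecker (1\<^sub>m a) (1\<^sub>m b) $$ (i, j) = 1\<^sub>m (a * b) $$ (i, j)"
    using ij by (auto simp: kronecker_def)
qed auto

lemma map_dims_mat_inv:
  assumes "\<And>A. A \<in> set As \<Longrightarrow> square_mat A \<and> det A \<noteq> 0"
  shows "map dim_col As = map dim_row As" "map dim_row (map mat_inv As) = map dim_row As" "map dim_col (map mat_inv As) = map dim_row As"
proof -
  have 1: "dim_col A = dim_row A" if "A \<in> set As" for A using assms[OF that] by simp
  have A: "A \<in> carrier_mat (dim_row A) (dim_row A)" if "A \<in> set As" for A
    by (rule carrier_matI[OF refl 1[OF that]])
  have 2: "dim_row (mat_inv A) = dim_row A" "dim_col (mat_inv A) = dim_row A" if "A \<in> set As" for A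
    using mat_inv(1)[OF A[OF that]] assms[OF that] by auto
  show "map dim_col As = map dim_row As" by (rule map_cong[OF refl 1])
  show "map dim_row (map mat_inv As) = map dim_row As" "map dim_col (map mat_inv As) = map dim_row As"
    unfolding map_map comp_def by (rule map_cong[OF refl], erule 2)+
qed

lemma kronecker_rev_inverse:
  assumes "\<And>A. A \<in> set As \<Longrightarrow> square_mat A \<and> det A \<noteq> 0"
  shows "kronecker_rev As * kronecker_rev (map mat_inv As) = 1\<^sub>m (prod_list (map dim_row As))"
  using assms
proof (induction As)
  case (Cons A As)
  have sqA: "square_mat A \<and> det A \<noteq> 0" by (rule Cons.prems) simp
  have A: "A \<in> carrier_mat (dim_row A) (dim_row A)" "det A \<noteq> 0"
    by (rule carrier_matI[OF refl], use sqA in simp, rule conjunct2[OF sqA])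
  note Ai = mat_inv[OF A]
  have sq: "square_mat A \<and> det A \<noteq> 0" if "A \<in> set As" for A by (rule Cons.prems) (simp add: that)
  note d = map_dims_mat_inv[OF sq]
  define n where "n = prod_list (map dim_row As)"
  have 1: "kronecker_rev As \<in> carrier_mat n n"
    by (rule carrier_matI) (simp_all only: dim_kronecker_rev d(1) n_def)
  have 2: "kronecker_rev (map mat_inv As) \<in> carrier_mat n n"
    by (rule carrier_matI) (simp_all only: dim_kronecker_rev d(2,3) n_def)
  have "kronecker_rev (A # As) * kronecker_rev (map mat_inv (A # As)) =
      kronecker (kronecker_rev As) A * kronecker (kronecker_rev (map mat_inv As)) (mat_inv A)" by (simp only: kronecker_rev.simps list.map)
  also have "\<dots> = kronecker (kronecker_rev As * kronecker_rev (map mat_inv As)) (A * mat_inv A)"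
    by (rule kronecker_mult[OF 1 2 A(1) Ai(1)])
  also have "\<dots> = 1\<^sub>m (prod_list (map dim_row (A # As)))"
  proof -
    have "kronecker_rev As * kronecker_rev (map mat_inv As) = 1\<^sub>m n"
      unfolding n_def by (rule Cons.IH) (rule sq)
    then show ?thesis by (simp only: Ai(2) kronecker_one) (simp add: n_def mult.commute)
  qed
  finally show ?case .
qed simp

lemma mat_inv_kronecker_rev:
  assumes "\<And>A. A \<in> set As \<Longrightarrow> square_mat A \<and> det A \<noteq> 0"
  shows "mat_inv (kronecker_rev As) = kronecker_rev (map mat_inv As)" "det (kronecker_rev As) \<noteq> 0"
proof -
  note d = map_dims_mat_inv[OF assms]
  have 1: "kronecker_rev As \<in> carrier_mat (prod_list (map dim_row As)) (prod_list (map dim_row As))"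
    by (rule carrier_matI) (simp_all only: dim_kronecker_rev d(1))
  have 2: "kronecker_rev (map mat_inv As) \<in> carrier_mat (prod_list (map dim_row As)) (prod_list (map dim_row As))"
    by (rule carrier_matI) (simp_all only: dim_kronecker_rev d(2,3))
  show "mat_inv (kronecker_rev As) = kronecker_rev (map mat_inv As)" "det (kronecker_rev As) \<noteq> 0"
    using mat_inv_unique[OF 1 2 kronecker_rev_inverse[OF assms]] by auto
qed

text \<open>Matricized at the chosen mode, the product array is B = A M N^T, and the squared norm of
  the array is the trace of B B^T. Square factors keep the dimensions of the array
  unchanged.\<close>

lemma array_norm_tucker:
  fixes Z :: array
  assumes sq: "\<And>B. B \<in> set (As1 @ A # As2) \<Longrightarrow> square_mat B"
  defines "ds1 \<equiv> map dim_row As1" and "d \<equiv> dim_row A" and "ds2 \<equiv> map dim_row As2"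
  defines "M \<equiv> matricize (ds1 @ d # ds2) (length As1) Z" and "N \<equiv> kronecker_rev (As1 @ As2)"
  shows "(array_norm (ds1 @ d # ds2) (tucker Z (As1 @ A # As2)))\<^sup>2 =
    mat_trace (A * (M * transpose_mat N * N * transpose_mat M) * transpose_mat A)"
proof -
  let ?ds = "ds1 @ d # ds2" and ?es = "ds1 @ ds2" and ?As = "As1 @ A # As2" and ?k = "length As1"
  let ?r = "prod_list ?es"
  have cols: "map dim_col As1 = ds1" "dim_col A = d" "map dim_col As2 = ds2" using sq by (auto simp: ds1_def d_def ds2_def)
  have A: "A \<in> carrier_mat d d" using cols by (auto simp: d_def)
  have N: "N \<in> carrier_mat ?r ?r"
    by (rule carrier_matI) (simp_all only: N_def dim_kronecker_rev map_append cols ds1_def[symmetric] ds2_def[symmetric])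
  have lk: "length ds1 = ?k" by (simp add: ds1_def)
  have es: "take ?k ?ds @ drop (Suc ?k) ?ds = ?es" using lk by simp
  have M: "M \<in> carrier_mat d ?r" unfolding M_def matricize_def es Let_def using lk by (auto simp: nth_append)
  have Mi: "M $$ (i, l) = Z (take ?k (multi_index ?es l) @ i # drop ?k (multi_index ?es l))" if "i < d" "l < ?r" for i l
    unfolding M_def matricize_def es Let_def using that lk by (simp add: nth_append)
  have Ni: "N $$ (a, b) = kron_entry (As1 @ As2) (multi_index ?es a) (multi_index ?es b)" if "a < ?r" "b < ?r" for a b
    using that kronecker_rev_index[of a "As1 @ As2" b] cols by (simp add: N_def ds1_def ds2_def)
  have kr: "map dim_row ?As = ?ds" "map dim_col ?As = ?ds" using cols by (auto simp: ds1_def d_def ds2_def)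
  have tuck: "tucker Z ?As is = (\<Sum>js\<in>multi_indices ?ds. kron_entry ?As is js * Z js)" if "is \<in> multi_indices ?ds" for "is"
  proof -
    have l: "list_all2 (<) is ?ds" using that by (simp add: multi_indices_list_all2)
    have fb: "flat_index ?ds is < prod_list ?ds" by (rule flat_index_bound[OF l])
    have "tucker Z ?As is = (\<Sum>c<prod_list ?ds. kronecker_rev ?As $$ (flat_index ?ds is, c) * Z (multi_index ?ds c))"
      unfolding tucker_def kr using fb kr
      by (simp add: scalar_prod_def array_vec_def lessThan_atLeast0)
    also have "\<dots> = (\<Sum>c<prod_list ?ds. kron_entry ?As is (multi_index ?ds c) * Z (multi_index ?ds c))"
    proof (rule sum.cong)
      fix c assume "c \<in> {..<prod_list ?ds}"
      then have "kronecker_rev ?As $$ (flat_index ?ds is, c) = kron_entry ?As is (multi_index ?ds c)"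
        using kronecker_rev_index[of "flat_index ?ds is" ?As c] fb multi_index_flat_index[OF l] unfolding kr by simp
      then show "kronecker_rev ?As $$ (flat_index ?ds is, c) * Z (multi_index ?ds c) = kron_entry ?As is (multi_index ?ds c) * Z (multi_index ?ds c)" by simp
    qed simp
    finally show ?thesis by (simp add: sum_multi_indices)
  qed
  define B where "B = A * M * transpose_mat N"
  have B: "B \<in> carrier_mat d ?r" using A M N by (auto simp: B_def)
  \<comment> \<open>The sum over all multi-indices splits into a sum over the index of the chosen
    mode, on which \<open>A\<close> acts, and one over the remaining modes, on which
    \<open>N\<close> acts.\<close>
  have ins: "tucker Z ?As (take ?k (multi_index ?es a) @ i # drop ?k (multi_index ?es a)) = B $$ (i, a)" if i: "i < d" and a: "a < ?r" for i a
  proof -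
    let ?ia = "multi_index ?es a"
    have la: "list_all2 (<) ?ia ?es" by (rule multi_index_bounds[OF a])
    then have len: "length ?ia = length ?es" by (rule list_all2_lengthD)
    obtain is1 is2 where ia: "?ia = is1 @ is2" and l12: "list_all2 (<) is1 ds1" "list_all2 (<) is2 ds2"
      using la by (auto simp: list_all2_append2)
    have l1: "length is1 = ?k" using list_all2_lengthD[OF l12(1)] lk by simp
    have mem: "take ?k ?ia @ i # drop ?k ?ia \<in> multi_indices ?ds"
      unfolding ia using l1 l12 i by (simp add: multi_indices_list_all2 list_all2_appendI)
    have "tucker Z ?As (take ?k ?ia @ i # drop ?k ?ia) =
      (\<Sum>j<d. \<Sum>js\<in>multi_indices ?es. kron_entry ?As (take ?k ?ia @ i # drop ?k ?ia) (take ?k js @ j # drop ?k js) * Z (take ?k js @ j # drop ?k js))"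
      unfolding tuck[OF mem] sum_multi_indices_insert lk ..
    also have "\<dots> = (\<Sum>j<d. \<Sum>b<?r. A $$ (i, j) * N $$ (a, b) * M $$ (j, b))"
      unfolding sum_multi_indices
    proof (intro sum.cong refl)
      fix j b assume j: "j \<in> {..<d}" and b: "b \<in> {..<?r}"
      let ?jb = "multi_index ?es b"
      have lb: "length ?jb = length ?es" using b by (intro list_all2_lengthD[OF multi_index_bounds]) simp
      have "kron_entry ?As (take ?k ?ia @ i # drop ?k ?ia) (take ?k ?jb @ j # drop ?k ?jb) = A $$ (i, j) * kron_entry (As1 @ As2) (take ?k ?ia @ drop ?k ?ia) (take ?k ?jb @ drop ?k ?jb)"
        by (rule kron_entry_insert) (use len lb lk in auto)
      then show "kron_entry ?As (take ?k ?ia @ i # drop ?k ?ia) (take ?k ?jb @ j # drop ?k ?jb) * Z (take ?k ?jb @ j # drop ?k ?jb) = A $$ (i, j) * N $$ (a, b) * M $$ (j, b)"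
        using a b j by (simp add: Ni Mi)
    qed
    also have "\<dots> = (\<Sum>b<?r. (\<Sum>j<d. A $$ (i, j) * M $$ (j, b)) * N $$ (a, b))"
      by (subst sum.swap) (simp add: sum_distrib_left sum_distrib_right mult_ac)
    also have "\<dots> = (\<Sum>b<?r. (A * M) $$ (i, b) * transpose_mat N $$ (b, a))"
      using mult_mat_index[OF A M i] N a by (intro sum.cong) auto
    also have "\<dots> = B $$ (i, a)"
      unfolding B_def by (rule mult_mat_index[symmetric, of _ d _ _ ?r]) (use A M N i a in auto)
    finally show ?thesis .
  qed
  have "(array_norm ?ds (tucker Z ?As))\<^sup>2 = (\<Sum>is\<in>multi_indices ?ds. (tucker Z ?As is)\<^sup>2)"
    unfolding array_norm_def by (rule real_sqrt_pow2) (auto intro: sum_nonneg)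
  also have "\<dots> = (\<Sum>i<d. \<Sum>a<?r. (B $$ (i, a))\<^sup>2)"
    unfolding sum_multi_indices_insert lk unfolding sum_multi_indices by (intro sum.cong) (auto simp: ins)
  also have "\<dots> = mat_trace (B * transpose_mat B)"
    unfolding mat_trace_def
  proof (intro sum.cong)
    fix i assume i: "i \<in> {..<dim_row (B * transpose_mat B)}"
    then have "(B * transpose_mat B) $$ (i, i) = (\<Sum>a<?r. B $$ (i, a) * transpose_mat B $$ (a, i))"
      by (intro mult_mat_index[of _ d _ _ d]) (use B in auto)
    then show "(\<Sum>a<?r. (B $$ (i, a))\<^sup>2) = (B * transpose_mat B) $$ (i, i)"
      using B i by (simp add: power2_eq_square)
  qed (use B in auto)
  also have "B * transpose_mat B = A * (M * transpose_mat N * N * transpose_mat M) * transpose_mat A"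
  proof -
    let ?Y = "N * (transpose_mat M * transpose_mat A)"
    have c: "transpose_mat M \<in> carrier_mat ?r d" "transpose_mat A \<in> carrier_mat d d" "transpose_mat N \<in> carrier_mat ?r ?r"
        "transpose_mat M * transpose_mat A \<in> carrier_mat ?r d" "?Y \<in> carrier_mat ?r d" "M * transpose_mat N \<in> carrier_mat d ?r"
        "M * transpose_mat N * N \<in> carrier_mat d ?r" "M * transpose_mat N * N * transpose_mat M \<in> carrier_mat d d" "A * M \<in> carrier_mat d ?r"
      using A M N by auto
    have "transpose_mat B = ?Y"
      unfolding B_def transpose_mult[OF c(9,3)] transpose_mult[OF A M] by simp
    moreover have "A * (M * transpose_mat N * N * transpose_mat M) * transpose_mat A = B * ?Y"
      unfolding B_def assoc_mult_mat[OF A c(8,2)] assoc_mult_mat[OF c(7,1,2)] assoc_mult_mat[OF c(6) N c(4)]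
        assoc_mult_mat[OF A M c(3)] assoc_mult_mat[OF A c(6,5)] ..
    ultimately show ?thesis by simp
  qed
  finally show ?thesis .
qed

text \<open>Padding with zero rows to a square matrix leaves a zero row, so the determinant vanishes
  and a null vector exists.\<close>

lemma wide_matrix_kernel:
  fixes B :: "real mat"
  assumes B: "B \<in> carrier_mat r q" and "r < q"
  obtains v where "v \<in> carrier_vec q" "v \<noteq> 0\<^sub>v q" "B *\<^sub>v v = 0\<^sub>v r"
proof -
  define B' where "B' = mat q q (\<lambda>(i, j). if i < r then B $$ (i, j) else 0)"
  have B': "B' \<in> carrier_mat q q" by (simp add: B'_def)
  have "det B' = 0"
  proof (rule ccontr)
    assume d: "det B' \<noteq> 0"
    have "(B' * mat_inv B') $$ (r, r) = (\<Sum>a<q. B' $$ (r, a) * mat_inv B' $$ (a, r))"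
      by (rule mult_mat_index[OF B' mat_inv(1)[OF B' d]]) (use assms in auto)
    also have "\<dots> = 0" using assms by (intro sum.neutral) (auto simp: B'_def)
    finally show False using mat_inv(2)[OF B' d] assms by simp
  qed
  then obtain v where v: "v \<in> carrier_vec q" "v \<noteq> 0\<^sub>v q" "B' *\<^sub>v v = 0\<^sub>v q"
    using det_0_iff_vec_prod_zero_field[OF B'] by auto
  have "B *\<^sub>v v = 0\<^sub>v r"
  proof (rule eq_vecI)
    fix i assume "i < dim_vec (0\<^sub>v r :: real Matrix.vec)"
    then have i: "i < r" by simp
    have "vec_index (B *\<^sub>v v) i = vec_index (B' *\<^sub>v v) i"
      using i B v(1) assms by (simp add: scalar_prod_def B'_def)
    then show "vec_index (B *\<^sub>v v) i = vec_index (0\<^sub>v r) i" using v(3) i assms by simp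
  qed (use B in auto)
  with v show ?thesis using that by blast
qed

section \<open>Regular conditional distribution of the posterior\<close>

text \<open>Its inverse is the scale matrix of the mirror-Wishart law, and it takes the place of
  \<open>S\<close> in \<open>cond_kernel\<close>.\<close>

definition row_scatter :: "nat \<Rightarrow> (nat \<Rightarrow> nat) \<Rightarrow> nat \<Rightarrow> array \<Rightarrow> nat \<Rightarrow> (nat \<Rightarrow> real mat) \<Rightarrow> real mat" where
  "row_scatter K p n X k P = matricize (data_dims K p n) k X * transpose_mat (mat_inv (Psi_minus K n k P))
     * mat_inv (Psi_minus K n k P) * transpose_mat (matricize (data_dims K p n) k X)"

lemma upt_split: "k < K \<Longrightarrow> [0..<K] = [0..<k] @ k # [Suc k..<K]"
proof -
  assume "k < K"
  then obtain d where K: "K = k + Suc d" by (auto dest: less_imp_Suc_add)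
  have "[0..<k + Suc d] = [0..<k] @ [k..<k + Suc d]" by (rule upt_add_eq_append) simp
  also have "[k..<k + Suc d] = k # [Suc k..<k + Suc d]" by (rule upt_conv_Cons) simp
  finally show ?thesis unfolding K .
qed

lemma data_dims_split: "k < K \<Longrightarrow> data_dims K p n = map p [0..<k] @ p k # (map p [Suc k..<K] @ [n])"
  by (simp add: data_dims_def upt_split[of k K])

text \<open>The number of columns of the matricization, np / p_k, which becomes the degrees of
  freedom.\<close>

definition other_dim :: "nat \<Rightarrow> (nat \<Rightarrow> nat) \<Rightarrow> nat \<Rightarrow> nat \<Rightarrow> nat" where
  "other_dim K p n k = prod_list (map p [0..<k] @ map p [Suc k..<K] @ [n])"

lemma other_dim_mult: "k < K \<Longrightarrow> other_dim K p n k * p k = n * (\<Prod>j<K. p j)"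
proof -
  assume k: "k < K"
  have "(\<Prod>j<K. p j) = prod_list (map p [0..<K])"
    using prod.distinct_set_conv_list[of "[0..<K]" p] by (simp add: lessThan_atLeast0)
  then show ?thesis by (simp add: upt_split[OF k] other_dim_def mult_ac)
qed

lemma matricize_carrier:
  assumes "k < K"
  shows "matricize (data_dims K p n) k X \<in> carrier_mat (p k) (other_dim K p n k)"
  unfolding matricize_def Let_def data_dims_split[OF assms] other_dim_def
  using assms by (auto simp: nth_append)

definition others_fac :: "nat \<Rightarrow> nat \<Rightarrow> nat \<Rightarrow> (nat \<Rightarrow> real mat) \<Rightarrow> real mat list" where
  "others_fac K n k P = map P ([0..<k] @ [Suc k..<K]) @ [1\<^sub>m n]"

lemma Psi_minus_facts:
  assumes k: "k < K" and P: "\<forall>j\<in>{..<K} - {k}. P j \<in> Gplus (p j)"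
  shows "Psi_minus K n k P \<in> carrier_mat (other_dim K p n k) (other_dim K p n k)"
    and "det (Psi_minus K n k P) \<noteq> 0"
    and "mat_inv (Psi_minus K n k P) = kronecker_rev (map (\<lambda>j. mat_inv (P j)) [0..<k] @ map (\<lambda>j. mat_inv (P j)) [Suc k..<K] @ [1\<^sub>m n])"
proof -
  let ?As = "map P ([0..<k] @ [Suc k..<K]) @ [1\<^sub>m n]"
  have Pj: "dim_row (P j) = p j" "dim_col (P j) = p j" "det (P j) = 1" if "j < k \<or> Suc k \<le> j \<and> j < K" for j
    using bspec[OF P, of j] that k by (auto simp: Gplus_def)
  have sq: "square_mat A \<and> det A \<noteq> 0" if "A \<in> set ?As" for A
    using that by (auto simp: Pj)
  have 1: "map dim_row ?As = map p [0..<k] @ map p [Suc k..<K] @ [n]"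
    by (auto simp: Pj)
  have 2: "map dim_col ?As = map p [0..<k] @ map p [Suc k..<K] @ [n]"
    by (auto simp: Pj)
  show "Psi_minus K n k P \<in> carrier_mat (other_dim K p n k) (other_dim K p n k)"
    unfolding Psi_minus_def other_dim_def by (rule carrier_matI) (simp_all only: dim_kronecker_rev 1 2)
  show "det (Psi_minus K n k P) \<noteq> 0"
    unfolding Psi_minus_def by (rule mat_inv_kronecker_rev(2)) (rule sq)
  have "mat_inv (1\<^sub>m n) = (1\<^sub>m n :: real mat)" by (rule mat_inv_unique(1)) auto
  moreover have "mat_inv (kronecker_rev ?As) = kronecker_rev (map mat_inv ?As)"
    by (rule mat_inv_kronecker_rev(1)) (rule sq)
  ultimately show "mat_inv (Psi_minus K n k P) = kronecker_rev (map (\<lambda>j. mat_inv (P j)) [0..<k] @ map (\<lambda>j. mat_inv (P j)) [Suc k..<K] @ [1\<^sub>m n])"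
    unfolding Psi_minus_def by (simp add: comp_def)
qed

lemma Psi_minus_cong:
  "(\<And>j. j \<in> {..<K} - {k} \<Longrightarrow> P j = P' j) \<Longrightarrow> k < K \<Longrightarrow> Psi_minus K n k P = Psi_minus K n k P'"
  unfolding Psi_minus_def by (intro arg_cong[where f = kronecker_rev] arg_cong2[where f = append] map_cong) auto

text \<open>Symmetry, positive definiteness and null vectors of the scatter matrix are all read off
  from this Gram form.\<close>

lemma row_scatter_gram:
  fixes X :: array and n :: nat
  assumes k: "k < K" and P: "\<forall>j\<in>{..<K} - {k}. P j \<in> Gplus (p j)"
  defines "B \<equiv> mat_inv (Psi_minus K n k P) * transpose_mat (matricize (data_dims K p n) k X)"
  shows "B \<in> carrier_mat (other_dim K p n k) (p k)" and "row_scatter K p n X k P = transpose_mat B * B"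
proof -
  let ?r = "other_dim K p n k"
  note M = matricize_carrier[OF k, of p n X]
  note N = mat_inv(1)[OF Psi_minus_facts(1,2)[OF k P, where n = n]]
  show "B \<in> carrier_mat ?r (p k)" unfolding B_def using M N by auto
  have MT: "transpose_mat (matricize (data_dims K p n) k X) \<in> carrier_mat ?r (p k)" using M by auto
  have NT: "transpose_mat (mat_inv (Psi_minus K n k P)) \<in> carrier_mat ?r ?r" using N by auto
  have MN: "matricize (data_dims K p n) k X * transpose_mat (mat_inv (Psi_minus K n k P)) \<in> carrier_mat (p k) ?r"
    using M NT by auto
  show "row_scatter K p n X k P = transpose_mat B * B"
    unfolding B_def row_scatter_def transpose_mult[OF N MT] transpose_transpose assoc_mult_mat[OF MN N MT] ..
qed

lemma row_scatter_carrier: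
  assumes k: "k < K" and P: "\<forall>j\<in>{..<K} - {k}. P j \<in> Gplus (p j)"
  shows "row_scatter K p n X k P \<in> carrier_mat (p k) (p k)"
    and "transpose_mat (row_scatter K p n X k P) = row_scatter K p n X k P"
proof -
  note B = row_scatter_gram[OF k P, where X = X and n = n]
  show "row_scatter K p n X k P \<in> carrier_mat (p k) (p k)" unfolding B(2) by (rule mult_carrier_mat[OF _ B(1)]) (use B(1) in simp)
  show "transpose_mat (row_scatter K p n X k P) = row_scatter K p n X k P"
    unfolding B(2) by (subst transpose_mult[OF _ B(1)]) (use B(1) in auto)
qed

text \<open>The factor built from the other shapes is invertible, so whether the scatter matrix is
  singular depends on the data alone. Together with \<open>row_scatter_null\<close> this means
  singular for all values of the other shapes or for none.\<close>

lemma row_scatter_pos_def: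
  assumes k: "k < K" and P: "\<forall>j\<in>{..<K} - {k}. P j \<in> Gplus (p j)"
    and inj: "\<And>v. v \<in> carrier_vec (p k) \<Longrightarrow> transpose_mat (matricize (data_dims K p n) k X) *\<^sub>v v = 0\<^sub>v (other_dim K p n k) \<Longrightarrow> v = 0\<^sub>v (p k)"
  shows "row_scatter K p n X k P \<in> pos_def_mats (p k)"
  unfolding row_scatter_gram(2)[OF k P]
proof (rule pos_def_gram[OF row_scatter_gram(1)[OF k P]])
  let ?r = "other_dim K p n k" and ?N = "mat_inv (Psi_minus K n k P)" and ?MT = "transpose_mat (matricize (data_dims K p n) k X)"
  note N = mat_inv(1)[OF Psi_minus_facts(1,2)[OF k P, where n = n]] and dN = det_mat_inv[OF Psi_minus_facts(1,2)[OF k P, where n = n]]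
  have MT: "?MT \<in> carrier_mat ?r (p k)" using matricize_carrier[OF k, of p n X] by auto
  fix v assume v: "v \<in> carrier_vec (p k)" and "(?N * ?MT) *\<^sub>v v = 0\<^sub>v ?r"
  then have "?N *\<^sub>v (?MT *\<^sub>v v) = 0\<^sub>v ?r" using assoc_mult_mat_vec[OF N MT v] by simp
  then have "?MT *\<^sub>v v = 0\<^sub>v ?r" by (rule nonsingular_mult_vec[OF N dN mult_mat_vec_carrier[OF MT v]])
  then show "v = 0\<^sub>v (p k)" by (rule inj[OF v])
qed

lemma mult_mat_vec_zero: "A \<in> carrier_mat r c \<Longrightarrow> A *\<^sub>v 0\<^sub>v c = (0\<^sub>v r :: real Matrix.vec)"
  by (intro eq_vecI) (auto simp: scalar_prod_def)

lemma row_scatter_null: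
  assumes k: "k < K" and P: "\<forall>j\<in>{..<K} - {k}. P j \<in> Gplus (p j)"
    and v: "v \<in> carrier_vec (p k)" "transpose_mat (matricize (data_dims K p n) k X) *\<^sub>v v = 0\<^sub>v (other_dim K p n k)"
  shows "row_scatter K p n X k P *\<^sub>v v = 0\<^sub>v (p k)"
proof -
  let ?r = "other_dim K p n k" and ?N = "mat_inv (Psi_minus K n k P)" and ?MT = "transpose_mat (matricize (data_dims K p n) k X)"
  note N = mat_inv(1)[OF Psi_minus_facts(1,2)[OF k P, where n = n]]
  have MT: "?MT \<in> carrier_mat ?r (p k)" using matricize_carrier[OF k, of p n X] by auto
  note B = row_scatter_gram[OF k P, where X = X and n = n]
  have BT: "transpose_mat (?N * ?MT) \<in> carrier_mat (p k) ?r" using B(1) by simp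
  have Bv: "(?N * ?MT) *\<^sub>v v = 0\<^sub>v ?r"
    unfolding assoc_mult_mat_vec[OF N MT v(1)] v(2) by (rule mult_mat_vec_zero[OF N])
  show ?thesis
    unfolding B(2) assoc_mult_mat_vec[OF BT B(1) v(1)] Bv by (rule mult_mat_vec_zero[OF BT])
qed

definition other_weight :: "nat \<Rightarrow> (nat \<Rightarrow> nat) \<Rightarrow> nat \<Rightarrow> (nat \<Rightarrow> real mat) \<Rightarrow> real" where
  "other_weight K p k P = (\<Prod>j\<in>{..<K} - {k}. \<Prod>i\<in>{1..<p j}. P j $$ (i, i) ^ (i - 1))"

text \<open>Separates the factor that depends on the other shapes alone, which is common to both
  sides of the disintegration, from the conditional kernel.\<close>

lemma posterior_kernel_eq:
  assumes k: "k < K" and P: "\<forall>j\<in>{..<K} - {k}. P j \<in> Gplus (p j)" and \<Psi>: "\<Psi> \<in> Gplus (p k)"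
  shows "posterior_kernel K p n X s (P(k := \<Psi>)) =
    other_weight K p k P * cond_kernel (p k) (n * (\<Prod>j<K. p j)) (row_scatter K p n X k P) s \<Psi>"
proof -
  let ?Q = "P(k := \<Psi>)"
  define As1 where "As1 = map (\<lambda>j. mat_inv (P j)) [0..<k]"
  define As2 where "As2 = map (\<lambda>j. mat_inv (P j)) [Suc k..<K] @ [1\<^sub>m n]"
  have Pi: "mat_inv (P j) \<in> carrier_mat (p j) (p j)" if "j < k \<or> Suc k \<le> j \<and> j < K" for j
    using bspec[OF P, of j] that k by (intro mat_inv(1)) (auto simp: Gplus_def)
  have Pid: "dim_row (mat_inv (P j)) = p j" "dim_col (mat_inv (P j)) = p j" if "j < k \<or> Suc k \<le> j \<and> j < K" for j
    using Pi[OF that] by auto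
  have \<Psi>i: "mat_inv \<Psi> \<in> carrier_mat (p k) (p k)" using \<Psi> by (intro mat_inv(1)) (auto simp: Gplus_def)
  have l: "map (\<lambda>j. mat_inv (?Q j)) [0..<K] @ [1\<^sub>m n] = As1 @ mat_inv \<Psi> # As2"
    by (simp add: upt_split[OF k] As1_def As2_def)
  have dims: "map dim_row As1 = map p [0..<k]" "dim_row (mat_inv \<Psi>) = p k" "map dim_row As2 = map p [Suc k..<K] @ [n]"
    using \<Psi>i by (auto simp: As1_def As2_def Pid)
  have sq: "square_mat B" if "B \<in> set (As1 @ mat_inv \<Psi> # As2)" for B
    using that \<Psi>i by (auto simp: As1_def As2_def Pid)
  have "(array_norm (data_dims K p n) (tucker X (map (\<lambda>j. mat_inv (?Q j)) [0..<K] @ [1\<^sub>m n])))\<^sup>2 =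
     mat_trace (mat_inv \<Psi> * row_scatter K p n X k P * transpose_mat (mat_inv \<Psi>))"
  proof -
    have "(array_norm (map dim_row As1 @ dim_row (mat_inv \<Psi>) # map dim_row As2) (tucker X (As1 @ mat_inv \<Psi> # As2)))\<^sup>2 =
      mat_trace (mat_inv \<Psi> * (matricize (map dim_row As1 @ dim_row (mat_inv \<Psi>) # map dim_row As2) (length As1) X * transpose_mat (kronecker_rev (As1 @ As2)) *
        kronecker_rev (As1 @ As2) * transpose_mat (matricize (map dim_row As1 @ dim_row (mat_inv \<Psi>) # map dim_row As2) (length As1) X)) * transpose_mat (mat_inv \<Psi>))"
      by (rule array_norm_tucker) (rule sq)
    moreover have "mat_inv (Psi_minus K n k P) = kronecker_rev (As1 @ As2)"
      unfolding As1_def As2_def by (rule Psi_minus_facts(3)[OF k P])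
    moreover have "length As1 = k" by (simp add: As1_def)
    ultimately show ?thesis by (simp only: l dims data_dims_split[OF k] row_scatter_def)
  qed
  moreover have "(\<Prod>j<K. \<Prod>i\<in>{1..<p j}. ?Q j $$ (i, i) ^ (i - 1)) = (\<Prod>i\<in>{1..<p k}. \<Psi> $$ (i, i) ^ (i - 1)) * other_weight K p k P"
    unfolding other_weight_def using k by (subst prod.remove[of _ k]) (auto intro!: prod.cong)
  ultimately show ?thesis unfolding posterior_kernel_def cond_kernel_def by (simp add: mult_ac)
qed

section \<open>Measurability of the conditional law and Tonelli for the parameter space\<close>

lemma mat_meas_kronecker:
  assumes f: "mat_meas M r c f" and g: "mat_meas M r' c' g"
  shows "mat_meas M (r * r') (c * c') (\<lambda>w. kronecker (f w) (g w))"
proof (rule mat_measI)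
  fix i j assume ij: "i < r * r'" "j < c * c'"
  then have "r' > 0" "c' > 0" by (auto intro: Nat.gr0I)
  then have d: "i div r' < r" "i mod r' < r'" "j div c' < c" "j mod c' < c'" using ij by (auto simp: less_mult_imp_div_less)
  have "(\<lambda>w. kronecker (f w) (g w) $$ (i, j)) \<in> borel_measurable M \<longleftrightarrow>
    (\<lambda>w. f w $$ (i div r', j div c') * g w $$ (i mod r', j mod c')) \<in> borel_measurable M"
  proof (rule measurable_cong)
    fix w assume w: "w \<in> space M"
    show "kronecker (f w) (g w) $$ (i, j) = f w $$ (i div r', j div c') * g w $$ (i mod r', j mod c')"
      using mat_measD(1)[OF f w] mat_measD(1)[OF g w] ij by (simp add: kronecker_def)
  qed
  then show "(\<lambda>w. kronecker (f w) (g w) $$ (i, j)) \<in> borel_measurable M"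
    using borel_measurable_times[OF mat_measD(2)[OF f d(1,3)] mat_measD(2)[OF g d(2,4)]] by simp
next
  fix w assume w: "w \<in> space M"
  show "kronecker (f w) (g w) \<in> carrier_mat (r * r') (c * c')"
    using mat_measD(1)[OF f w] mat_measD(1)[OF g w] by (intro carrier_matI) auto
qed

lemma mat_meas_kronecker_rev:
  assumes "list_all2 (\<lambda>f d. mat_meas M d d f) fs ds"
  shows "mat_meas M (prod_list ds) (prod_list ds) (\<lambda>w. kronecker_rev (map (\<lambda>f. f w) fs))"
  using assms
proof (induction fs ds rule: list_all2_induct)
  case Nil
  then show ?case by (auto intro: mat_meas_const)
next
  case (Cons f fs d ds)
  from mat_meas_kronecker[OF Cons.IH Cons.hyps(1)] show ?case by (simp add: mult.commute)
qed

abbreviation others_borel :: "nat \<Rightarrow> (nat \<Rightarrow> nat) \<Rightarrow> nat \<Rightarrow> (nat \<Rightarrow> real mat) measure" where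
  "others_borel K p k \<equiv> (\<Pi>\<^sub>M j \<in> {..<K} - {k}. Gplus_borel (p j))"

lemma space_others: "P \<in> space (others_borel K p k) \<Longrightarrow> \<forall>j\<in>{..<K} - {k}. P j \<in> Gplus (p j)"
  by (auto simp: space_PiM space_Gplus_borel PiE_def Pi_def)

lemma mat_meas_row_scatter:
  assumes k: "k < K"
  shows "mat_meas (others_borel K p k) (p k) (p k) (row_scatter K p n X k)"
proof -
  let ?L = "others_borel K p k"
  have c: "mat_meas ?L (p j) (p j) (\<lambda>P. P j)" if "j \<in> {..<K} - {k}" for j
    by (rule mat_meas_compose[OF mat_meas_Gplus_id measurable_component_singleton[OF that]])
  have "mat_meas ?L (prod_list (map p ([0..<k] @ [Suc k..<K]) @ [n])) (prod_list (map p ([0..<k] @ [Suc k..<K]) @ [n]))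
      (\<lambda>w. kronecker_rev (map (\<lambda>f. f w) (map (\<lambda>j P. P j) ([0..<k] @ [Suc k..<K]) @ [\<lambda>_. 1\<^sub>m n])))"
  proof (rule mat_meas_kronecker_rev, rule list_all2_appendI)
    show "list_all2 (\<lambda>f d. mat_meas ?L d d f) (map (\<lambda>j P. P j) ([0..<k] @ [Suc k..<K])) (map p ([0..<k] @ [Suc k..<K]))"
      using c k by (auto simp: list_all2_conv_all_nth nth_append)
    show "list_all2 (\<lambda>f d. mat_meas ?L d d f) [\<lambda>_. 1\<^sub>m n] [n]" by (auto intro: mat_meas_const)
  qed
  then have "mat_meas ?L (other_dim K p n k) (other_dim K p n k) (Psi_minus K n k)"
    unfolding Psi_minus_def[abs_def] other_dim_def by (simp add: comp_def)
  then have N: "mat_meas ?L (other_dim K p n k) (other_dim K p n k) (\<lambda>P. mat_inv (Psi_minus K n k P))"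
    by (rule mat_meas_mat_inv) (rule Psi_minus_facts(2)[OF k space_others])
  note M = mat_meas_const[OF matricize_carrier[OF k, of p n X], of ?L]
  show ?thesis
    unfolding row_scatter_def[abs_def]
    by (rule mat_meas_mult[OF mat_meas_mult[OF mat_meas_mult[OF M mat_meas_transpose[OF N]] N] mat_meas_transpose[OF M]])
qed

text \<open>The whole family is the image of one fixed Wishart law under a map that is jointly
  measurable in the parameter and the Wishart matrix; measurability in the parameter follows from
  that.\<close>

lemma mirror_wishart_kernel:
  assumes \<nu>: "\<nu> > real q - 1" and S: "mat_meas L q q S" and pd: "\<And>w. w \<in> space L \<Longrightarrow> S w \<in> pos_def_mats q"
  shows "(\<lambda>w. mirror_wishart q \<nu> (mat_inv (S w))) \<in> measurable L (prob_algebra (pd_borel q))"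
proof -
  let ?U = "\<lambda>w. mat_inv (transpose_mat (lower_chol (S w)))"
  have R: "mat_meas L q q (\<lambda>w. lower_chol (S w))" by (rule mat_meas_lower_chol[OF S]) (rule pd)
  have dRT: "det (transpose_mat (lower_chol (S w))) \<noteq> 0" if "w \<in> space L" for w
    using det_lower_chol[OF pd[OF that]] det_transpose[OF lower_chol(2)[OF pd[OF that]]] by simp
  have U: "mat_meas L q q ?U" by (rule mat_meas_mat_inv[OF mat_meas_transpose[OF R]]) (rule dRT)
  have dU: "det (?U w) \<noteq> 0" if "w \<in> space L" for w
    by (rule det_mat_inv[OF _ dRT[OF that]]) (use lower_chol(2)[OF pd[OF that]] in simp)
  have "(\<lambda>x. ?U (fst x) * transpose_mat (lower_chol (snd x)) * lower_chol (snd x) * transpose_mat (?U (fst x)))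
      \<in> measurable (L \<Otimes>\<^sub>M pd_borel q) (pd_borel q)"
  proof (rule mirror_measurable)
    show "mat_meas (L \<Otimes>\<^sub>M pd_borel q) q q (\<lambda>x. ?U (fst x))" by (rule mat_meas_compose[OF U measurable_fst])
    show "mat_meas (L \<Otimes>\<^sub>M pd_borel q) q q (\<lambda>x. lower_chol (snd x))"
      by (rule mat_meas_compose[OF mat_meas_lower_chol[OF mat_meas_pd_id] measurable_snd]) (simp add: space_pd_borel)
    fix x assume "x \<in> space (L \<Otimes>\<^sub>M pd_borel q)"
    then have x: "fst x \<in> space L" "snd x \<in> pos_def_mats q" by (auto simp: space_pair_measure space_pd_borel)
    show "det (?U (fst x)) \<noteq> 0" by (rule dU[OF x(1)])
    show "det (lower_chol (snd x)) \<noteq> 0" by (rule det_lower_chol[OF x(2)])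
  qed
  then have "(\<lambda>(w, S'). ?U w * transpose_mat (lower_chol S') * lower_chol S' * transpose_mat (?U w)) \<in> measurable (L \<Otimes>\<^sub>M pd_borel q) (pd_borel q)"
    by (simp only: split_beta')
  from measurable_distr_prob_space2[OF measurable_const[OF wishart_prob_algebra[OF \<nu>]] this]
  have "(\<lambda>w. distr (wishart q \<nu>) (pd_borel q) (\<lambda>S'. ?U w * transpose_mat (lower_chol S') * lower_chol S' * transpose_mat (?U w))) \<in> measurable L (prob_algebra (pd_borel q))" .
  moreover have "mirror_wishart q \<nu> (mat_inv (S w)) = distr (wishart q \<nu>) (pd_borel q) (\<lambda>S'. ?U w * transpose_mat (lower_chol S') * lower_chol S' * transpose_mat (?U w))"
    if "w \<in> space L" for w
    unfolding mirror_wishart_def upper_chol_mat_inv[OF pd[OF that]] Let_def ..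
  ultimately show ?thesis by (subst measurable_cong) auto
qed

lemma mat_inv_scaled_gram_pos_def:
  assumes \<Psi>: "\<Psi> \<in> carrier_mat q q" "det \<Psi> \<noteq> 0" and s: "s \<noteq> (0::real)"
  shows "mat_inv (s\<^sup>2 \<cdot>\<^sub>m (\<Psi> * transpose_mat \<Psi>)) \<in> pos_def_mats q" "det (s\<^sup>2 \<cdot>\<^sub>m (\<Psi> * transpose_mat \<Psi>)) \<noteq> 0"
proof -
  define W where "W = s \<cdot>\<^sub>m \<Psi>"
  have W: "W \<in> carrier_mat q q" "det W \<noteq> 0" using \<Psi> s by (auto simp: W_def)
  have WT: "transpose_mat W \<in> carrier_mat q q" "det (transpose_mat W) \<noteq> 0" using W det_transpose[OF W(1)] by auto
  have e: "s\<^sup>2 \<cdot>\<^sub>m (\<Psi> * transpose_mat \<Psi>) = W * transpose_mat W"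
    unfolding W_def using \<Psi>(1)
    by (simp add: transpose_smult mult_smult_assoc_mat[of _ q q _ q] mult_smult_distrib[of _ q q _ q])
      (auto intro!: eq_matI simp: power2_eq_square)
  note Wi = mat_inv[OF W]
  have "transpose_mat (mat_inv W) * mat_inv W \<in> pos_def_mats q"
    by (rule pos_def_gram[OF Wi(1)]) (rule nonsingular_mult_vec[OF Wi(1) det_mat_inv[OF W]])
  then show "mat_inv (s\<^sup>2 \<cdot>\<^sub>m (\<Psi> * transpose_mat \<Psi>)) \<in> pos_def_mats q"
    unfolding e mat_inv_mult[OF W WT] mat_inv_transpose[OF W] .
  show "det (s\<^sup>2 \<cdot>\<^sub>m (\<Psi> * transpose_mat \<Psi>)) \<noteq> 0"
    unfolding e using W WT det_mult[OF W(1) WT(1)] by simp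
qed

lemma precision_measurable:
  assumes s: "s \<in> borel_measurable M" "\<And>w. w \<in> space M \<Longrightarrow> s w > 0" and F: "F \<in> measurable M (Gplus_borel q)"
  shows "(\<lambda>w. mat_inv ((s w)\<^sup>2 \<cdot>\<^sub>m (F w * transpose_mat (F w)))) \<in> measurable M (pd_borel q)"
proof (rule measurable_pd_borelI)
  have G: "F w \<in> carrier_mat q q" "det (F w) \<noteq> 0" "s w \<noteq> 0" if "w \<in> space M" for w
    using measurable_space[OF F that] s(2)[OF that] by (auto simp: space_Gplus_borel Gplus_def)
  fix w assume w: "w \<in> space M"
  show "mat_inv ((s w)\<^sup>2 \<cdot>\<^sub>m (F w * transpose_mat (F w))) \<in> pos_def_mats q"
    by (rule mat_inv_scaled_gram_pos_def(1)[OF G[OF w]])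
next
  have G: "F w \<in> carrier_mat q q" "det (F w) \<noteq> 0" "s w \<noteq> 0" if "w \<in> space M" for w
    using measurable_space[OF F that] s(2)[OF that] by (auto simp: space_Gplus_borel Gplus_def)
  note Fm = mat_meas_compose[OF mat_meas_Gplus_id F]
  have "mat_meas M q q (\<lambda>w. mat_inv ((s w)\<^sup>2 \<cdot>\<^sub>m (F w * transpose_mat (F w))))"
    by (rule mat_meas_mat_inv[OF mat_meas_smult[OF mat_meas_mult[OF Fm mat_meas_transpose[OF Fm]] borel_measurable_power[OF s(1)]]])
      (rule mat_inv_scaled_gram_pos_def(2), auto dest: G)
  then show "(\<lambda>w. mat_inv ((s w)\<^sup>2 \<cdot>\<^sub>m (F w * transpose_mat (F w))) $$ (i, j)) \<in> borel_measurable M" if "i < q" "j < q" for i j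
    using that by (auto dest: mat_measD)
qed

lemma cond_kernel_measurable:
  assumes S: "S \<in> carrier_mat q q"
  shows "(\<lambda>x. cond_kernel q N S (snd x) (fst x)) \<in> borel_measurable (Gplus_borel q \<Otimes>\<^sub>M pos_lborel)"
proof -
  let ?M = "Gplus_borel q \<Otimes>\<^sub>M pos_lborel"
  have i: "mat_meas ?M q q (\<lambda>x. mat_inv (fst x))"
    by (rule mat_meas_compose[OF mat_meas_mat_inv[OF mat_meas_Gplus_id] measurable_fst]) (simp add: space_Gplus_borel Gplus_det)
  have t: "(\<lambda>x. mat_trace (mat_inv (fst x) * S * transpose_mat (mat_inv (fst x)))) \<in> borel_measurable ?M"
    by (rule mat_meas_trace[OF mat_meas_mult[OF mat_meas_mult[OF i mat_meas_const[OF S]] mat_meas_transpose[OF i]]])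
  have d: "(\<lambda>x. fst x $$ (i, i)) \<in> borel_measurable ?M" if "i < q" for i
    by (rule measurable_compose[OF measurable_fst measurable_Gplus_index[OF that that]])
  show ?thesis
    unfolding cond_kernel_def
    by (intro borel_measurable_times borel_measurable_inverse borel_measurable_power borel_measurable_divide borel_measurable_uminus
        measurable_compose[OF _ borel_measurable_exp] borel_measurable_prod borel_measurable_const t d snd_pos_lborel_measurable) auto
qed

lemma cond_kernel_nonneg:
  assumes "\<Psi> \<in> Gplus q" "s > 0"
  shows "cond_kernel q N S s \<Psi> \<ge> 0"
  unfolding cond_kernel_def using assms
  by (intro mult_nonneg_nonneg prod_nonneg) (auto simp: Gplus_def pos_diag_def less_imp_le)

lemma nn_integral_shape_scale_cmult:
  assumes "(\<lambda>x. f (fst x) (snd x)) \<in> borel_measurable (Gplus_borel q \<Otimes>\<^sub>M pos_lborel)"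
  shows "(\<integral>\<^sup>+\<Psi>. \<integral>\<^sup>+s. r * f \<Psi> s \<partial>pos_lborel \<partial>Gplus_lebesgue q) = r * (\<integral>\<^sup>+\<Psi>. \<integral>\<^sup>+s. f \<Psi> s \<partial>pos_lborel \<partial>Gplus_lebesgue q)"
proof -
  interpret pos: sigma_finite_measure pos_lborel by (rule sigma_finite_pos_lborel)
  have f: "(\<lambda>(\<Psi>, s). f \<Psi> s) \<in> borel_measurable (Gplus_borel q \<Otimes>\<^sub>M pos_lborel)"
    using assms by (simp only: split_beta')
  have "(\<integral>\<^sup>+\<Psi>. \<integral>\<^sup>+s. r * f \<Psi> s \<partial>pos_lborel \<partial>Gplus_lebesgue q) = (\<integral>\<^sup>+\<Psi>. r * (\<integral>\<^sup>+s. f \<Psi> s \<partial>pos_lborel) \<partial>Gplus_lebesgue q)"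
  proof (rule nn_integral_cong)
    fix \<Psi> assume "\<Psi> \<in> space (Gplus_lebesgue q)"
    then have "\<Psi> \<in> space (Gplus_borel q)" by (simp add: space_Gplus_lebesgue space_Gplus_borel)
    from measurable_compose[OF measurable_Pair1'[OF this] f] show "(\<integral>\<^sup>+s. r * f \<Psi> s \<partial>pos_lborel) = r * (\<integral>\<^sup>+s. f \<Psi> s \<partial>pos_lborel)"
      by (intro nn_integral_cmult) simp
  qed
  also have "\<dots> = r * (\<integral>\<^sup>+\<Psi>. \<integral>\<^sup>+s. f \<Psi> s \<partial>pos_lborel \<partial>Gplus_lebesgue q)"
    by (rule nn_integral_cmult) (simp only: measurable_cong_sets[OF sets_Gplus_lebesgue refl] pos.borel_measurable_nn_integral[OF f])
  finally show ?thesis .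
qed

text \<open>Tonelli with the integrals over scale and shape \<open>k\<close> innermost, the order
  that conditioning on the other shapes requires.\<close>

lemma nn_integral_param_lebesgue:
  assumes k: "k < K" and p: "\<And>j. j < K \<Longrightarrow> p j \<ge> 1" and g: "g \<in> borel_measurable (param_lebesgue K p)"
  shows "(\<integral>\<^sup>+x. g x \<partial>param_lebesgue K p) =
    (\<integral>\<^sup>+P. \<integral>\<^sup>+\<Psi>. \<integral>\<^sup>+s. g (s, P(k := \<Psi>)) \<partial>pos_lborel \<partial>Gplus_lebesgue (p k) \<partial>(\<Pi>\<^sub>M j \<in> {..<K} - {k}. Gplus_lebesgue (p j)))"
proof -
  \<comment> \<open>Sigma-finiteness is asked at every index, whereas \<open>p j \<ge> 1\<close> is
    known only for \<open>j < K\<close>; dimension 1 is a harmless default elsewhere.\<close>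
  let ?G = "\<lambda>j. Gplus_lebesgue (if j < K then p j else 1)"
  have sf: "sigma_finite_measure (?G j)" for j
  proof -
    have "(if j < K then p j else 1) \<ge> 1" using p[of j] by (cases "j < K") simp_all
    then show ?thesis by (rule sigma_finite_Gplus_lebesgue)
  qed
  interpret G: product_sigma_finite ?G by (rule product_sigma_finite.intro) (rule sf)
  have PK: "(\<Pi>\<^sub>M j \<in> {..<K}. Gplus_lebesgue (p j)) = PiM {..<K} ?G" by (rule PiM_cong) auto
  have PI: "(\<Pi>\<^sub>M j \<in> {..<K} - {k}. Gplus_lebesgue (p j)) = PiM ({..<K} - {k}) ?G" by (rule PiM_cong) auto
  interpret P: sigma_finite_measure "PiM {..<K} ?G" by (rule G.sigma_finite) simp
  interpret pos: sigma_finite_measure pos_lborel by (rule sigma_finite_pos_lborel)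
  interpret pair: pair_sigma_finite pos_lborel "PiM {..<K} ?G" ..
  have param: "param_lebesgue K p = pos_lborel \<Otimes>\<^sub>M PiM {..<K} ?G" by (simp only: param_lebesgue_def PK)
  have gm: "g \<in> borel_measurable (pos_lborel \<Otimes>\<^sub>M PiM {..<K} ?G)" using g by (simp only: param)
  have ins: "{..<K} = insert k ({..<K} - {k})" using k by auto
  have "(\<integral>\<^sup>+x. g x \<partial>param_lebesgue K p) = (\<integral>\<^sup>+P. \<integral>\<^sup>+s. g (s, P) \<partial>pos_lborel \<partial>PiM {..<K} ?G)"
    unfolding param by (rule pair.nn_integral_snd[OF gm, symmetric])
  also have "\<dots> = (\<integral>\<^sup>+P. \<integral>\<^sup>+\<Psi>. \<integral>\<^sup>+s. g (s, P(k := \<Psi>)) \<partial>pos_lborel \<partial>?G k \<partial>PiM ({..<K} - {k}) ?G)"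
  proof -
    have "(\<lambda>P. \<integral>\<^sup>+s. g (s, P) \<partial>pos_lborel) \<in> borel_measurable (PiM {..<K} ?G)"
    proof (rule pos.borel_measurable_nn_integral)
      have "(\<lambda>(P, s). (s, P)) \<in> measurable (PiM {..<K} ?G \<Otimes>\<^sub>M pos_lborel) (pos_lborel \<Otimes>\<^sub>M PiM {..<K} ?G)"
        by (rule measurable_pair_swap')
      from measurable_compose[OF this gm] show "(\<lambda>(P, s). g (s, P)) \<in> borel_measurable (PiM {..<K} ?G \<Otimes>\<^sub>M pos_lborel)"
        by (simp only: split_beta' prod.case)
    qed
    then have 1: "(\<lambda>P. \<integral>\<^sup>+s. g (s, P) \<partial>pos_lborel) \<in> borel_measurable (PiM (insert k ({..<K} - {k})) ?G)" by (simp only: ins[symmetric])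
    have 2: "finite ({..<K} - {k})" "k \<notin> {..<K} - {k}" by auto
    from G.product_nn_integral_insert[OF 2 1] show ?thesis by (simp only: ins[symmetric])
  qed
  finally show ?thesis using k by (simp only: PI if_True)
qed

section \<open>Disintegration of the posterior\<close>

theorem mainTheorem4:
  fixes M :: "'w measure"
    and K n k :: nat
    and p :: "nat \<Rightarrow> nat"
    and X :: array
    and \<sigma> :: "'w \<Rightarrow> real"
    and \<Psi> :: "nat \<Rightarrow> 'w \<Rightarrow> real mat"
    and c :: real
  assumes "prob_space M"
    and "n \<ge> 1"
    and "\<And>j. j < K \<Longrightarrow> p j \<ge> 1"
    and "c > 0"
    and posterior: "distributed M (param_lebesgue K p)
      (\<lambda>\<omega>. (\<sigma> \<omega>, \<lambda>j\<in>{..<K}. \<Psi> j \<omega>))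
      (\<lambda>(s, P). ennreal (c * posterior_kernel K p n X s P))"
    and "k < K"
  shows "has_conditional_distribution M
    (pd_borel (p k))
    (\<lambda>\<omega>. mat_inv ((\<sigma> \<omega>)\<^sup>2 \<cdot>\<^sub>m (\<Psi> k \<omega> * transpose_mat (\<Psi> k \<omega>))))
    (\<Pi>\<^sub>M j \<in> {..<K} - {k}. Gplus_borel (p j))
    (\<lambda>\<omega>. \<lambda>j\<in>{..<K} - {k}. \<Psi> j \<omega>)
    (\<lambda>P. mirror_wishart (p k) (real (n * (\<Prod>j<K. p j)) / real (p k))
      (mat_inv (matricize (data_dims K p n) k X
        * transpose_mat (mat_inv (Psi_minus K n k P))
        * mat_inv (Psi_minus K n k P)
        * transpose_mat (matricize (data_dims K p n) k X))))"
proof -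
  interpret M: prob_space M by fact
  define q where "q = p k"
  define r where "r = other_dim K p n k"
  define N where "N = n * (\<Prod>j<K. p j)"
  define \<nu> where "\<nu> = real N / real q"
  define S where "S = row_scatter K p n X k"
  define \<kappa> where "\<kappa> P = mirror_wishart q \<nu> (mat_inv (S P))" for P
  let ?I = "{..<K} - {k}"
  let ?L = "others_borel K p k"
  let ?G = "\<Pi>\<^sub>M j \<in> ?I. Gplus_lebesgue (p j)"
  let ?T = "\<lambda>\<omega>. (\<sigma> \<omega>, \<lambda>j\<in>{..<K}. \<Psi> j \<omega>)"
  let ?f = "\<lambda>(s, P). ennreal (c * posterior_kernel K p n X s P)"
  let ?Z = "\<lambda>s A. mat_inv (s\<^sup>2 \<cdot>\<^sub>m (A * transpose_mat A))"
  have k: "k < K" by fact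
  have q: "q \<ge> 1" using assms(3)[OF k] by (simp add: q_def)
  \<comment> \<open>Hence \<nu> is the integer \<open>r\<close>, the number of columns of the
    matricization, and the bound \<nu> > q - 1 becomes a statement about its rank.\<close>
  have rq: "r * q = N" unfolding r_def q_def N_def by (rule other_dim_mult[OF k])
  then have \<nu>r: "\<nu> = real r" using q unfolding \<nu>_def by (metis nonzero_mult_div_cancel_right of_nat_0_eq_iff of_nat_mult not_one_le_zero)
  have N: "real N = \<nu> * real q" unfolding \<nu>r rq[symmetric] by simp
  have T: "?T \<in> measurable M (param_lebesgue K p)" by (rule distributed_measurable[OF posterior])
  have fm: "?f \<in> borel_measurable (param_lebesgue K p)" by (rule distributed_borel_measurable[OF posterior])
  have sets_param: "sets (param_lebesgue K p) = sets (pos_lborel \<Otimes>\<^sub>M (\<Pi>\<^sub>M j \<in> {..<K}. Gplus_borel (p j)))"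
    unfolding param_lebesgue_def by (intro sets_pair_measure_cong refl sets_PiM_cong sets_Gplus_lebesgue)
  note T' = T[unfolded measurable_cong_sets[OF refl sets_param]]
  have M_int: "(\<integral>\<^sup>+\<omega>. g (?T \<omega>) \<partial>M) = (\<integral>\<^sup>+x. ?f x * g x \<partial>param_lebesgue K p)"
    if g: "g \<in> borel_measurable (param_lebesgue K p)" for g
  proof -
    have "(\<integral>\<^sup>+\<omega>. g (?T \<omega>) \<partial>M) = (\<integral>\<^sup>+x. g x \<partial>distr M (param_lebesgue K p) ?T)"
      by (rule nn_integral_distr[symmetric]) (use T g in simp_all)
    also have "\<dots> = (\<integral>\<^sup>+x. ?f x * g x \<partial>param_lebesgue K p)"
      unfolding distributed_distr_eq_density[OF posterior] by (rule nn_integral_density[OF fm g])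
    finally show ?thesis .
  qed
  have spaceG: "\<forall>j\<in>?I. P j \<in> Gplus (p j)" if "P \<in> space ?G" for P
    using that by (auto simp: space_PiM space_Gplus_lebesgue PiE_def Pi_def)
  have S_upd: "S (P(k := A)) = S P" for P A
  proof -
    have "Psi_minus K n k (P(k := A)) = Psi_minus K n k P" by (rule Psi_minus_cong) (use k in auto)
    then show ?thesis by (simp only: S_def row_scatter_def)
  qed
  have r_upd: "restrict (P(k := A)) ?I = P" if "P \<in> space ?G" for P A
    using that by (auto simp: space_PiM PiE_def extensional_def fun_eq_iff)
  have f_eq: "?f (s, P(k := A)) = ennreal (c * other_weight K p k P) * ennreal (cond_kernel q N (S P) s A)"
    if P: "P \<in> space ?G" and A: "A \<in> Gplus q" and s: "s > 0" for P A s
  proof -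
    have w: "other_weight K p k P \<ge> 0"
      unfolding other_weight_def
    proof (intro prod_nonneg ballI zero_le_power)
      fix j i assume "j \<in> ?I" "i \<in> {1..<p j}"
      then have "P j \<in> Gplus (p j)" "i < p j" using spaceG[OF P] by auto
      then show "0 \<le> P j $$ (i, i)" by (auto simp: Gplus_def pos_diag_def less_imp_le)
    qed
    have "c * posterior_kernel K p n X s (P(k := A)) = (c * other_weight K p k P) * cond_kernel q N (S P) s A"
      unfolding posterior_kernel_eq[OF k spaceG[OF P] A[unfolded q_def]] S_def q_def N_def by (simp only: mult.assoc)
    moreover have "c * other_weight K p k P \<ge> 0" using w assms(4) by simp
    ultimately show ?thesis using cond_kernel_nonneg[OF A s]
      by (simp only: prod.case) (rule ennreal_mult)
  qed
  \<comment> \<open>Both sides of the disintegration are integrals of this shape: \<open>h\<close>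
    tests the scale and shape \<open>k\<close>, \<open>b\<close> the other shapes. The inner double
    integral is the unnormalized conditional expectation of \<open>h\<close>.\<close>
  have param_int: "(\<integral>\<^sup>+x. ?f x * (h (fst x) (snd x k) * b (restrict (snd x) ?I)) \<partial>param_lebesgue K p) =
      (\<integral>\<^sup>+P. ennreal (c * other_weight K p k P) * b P * (\<integral>\<^sup>+A. \<integral>\<^sup>+s. ennreal (cond_kernel q N (S P) s A) * h s A \<partial>pos_lborel \<partial>Gplus_lebesgue q) \<partial>?G)"
    if h: "(\<lambda>x. h (snd x) (fst x)) \<in> borel_measurable (Gplus_borel q \<Otimes>\<^sub>M pos_lborel)"
      and hm: "(\<lambda>x. h (fst x) (snd x k) * b (restrict (snd x) ?I)) \<in> borel_measurable (param_lebesgue K p)" for h b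
  proof -
    have "(\<integral>\<^sup>+x. ?f x * (h (fst x) (snd x k) * b (restrict (snd x) ?I)) \<partial>param_lebesgue K p) =
      (\<integral>\<^sup>+P. \<integral>\<^sup>+A. \<integral>\<^sup>+s. ?f (s, P(k := A)) * (h (fst (s, P(k := A))) (snd (s, P(k := A)) k) * b (restrict (snd (s, P(k := A))) ?I)) \<partial>pos_lborel \<partial>Gplus_lebesgue (p k) \<partial>?G)"
      by (rule nn_integral_param_lebesgue[OF k assms(3) borel_measurable_times_ennreal[OF fm hm]])
    also have "\<dots> = (\<integral>\<^sup>+P. \<integral>\<^sup>+A. \<integral>\<^sup>+s. (ennreal (c * other_weight K p k P) * b P) * (ennreal (cond_kernel q N (S P) s A) * h s A) \<partial>pos_lborel \<partial>Gplus_lebesgue q \<partial>?G)"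
      unfolding q_def[symmetric]
    proof (intro nn_integral_cong)
      fix P A s assume P: "P \<in> space ?G" and "A \<in> space (Gplus_lebesgue q)" "s \<in> space pos_lborel"
      then have A: "A \<in> Gplus q" "s > 0" by (auto simp: space_Gplus_lebesgue space_restrict_space)
      have gen: "(a * d) * (e * b) = (a * b) * (d * e)" for a b d e :: ennreal by (simp only: mult_ac)
      show "?f (s, P(k := A)) * (h (fst (s, P(k := A))) (snd (s, P(k := A)) k) * b (restrict (snd (s, P(k := A))) ?I)) =
         (ennreal (c * other_weight K p k P) * b P) * (ennreal (cond_kernel q N (S P) s A) * h s A)"
        unfolding f_eq[OF P A] fst_conv snd_conv r_upd[OF P] fun_upd_same by (rule gen)
    qed
    also have "\<dots> = (\<integral>\<^sup>+P. ennreal (c * other_weight K p k P) * b P * (\<integral>\<^sup>+A. \<integral>\<^sup>+s. ennreal (cond_kernel q N (S P) s A) * h s A \<partial>pos_lborel \<partial>Gplus_lebesgue q) \<partial>?G)"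
    proof (rule nn_integral_cong)
      fix P assume P: "P \<in> space ?G"
      have "S P \<in> carrier_mat q q" unfolding S_def q_def by (rule row_scatter_carrier(1)[OF k spaceG[OF P]])
      from cond_kernel_measurable[OF this] h
      show "(\<integral>\<^sup>+A. \<integral>\<^sup>+s. (ennreal (c * other_weight K p k P) * b P) * (ennreal (cond_kernel q N (S P) s A) * h s A) \<partial>pos_lborel \<partial>Gplus_lebesgue q) =
        ennreal (c * other_weight K p k P) * b P * (\<integral>\<^sup>+A. \<integral>\<^sup>+s. ennreal (cond_kernel q N (S P) s A) * h s A \<partial>pos_lborel \<partial>Gplus_lebesgue q)"
        by (intro nn_integral_shape_scale_cmult borel_measurable_times_ennreal measurable_compose[OF _ measurable_ennreal])
    qed
    finally show ?thesis .
  qed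
  \<comment> \<open>A null vector of the transposed matricization is null for the scatter matrix at
    every value of the other shapes, so every conditional mass absorbs
    \<open>\<top>\<close>.\<close>
  have inj: "v = 0\<^sub>v (p k)" if v: "v \<in> carrier_vec (p k)" "transpose_mat (matricize (data_dims K p n) k X) *\<^sub>v v = 0\<^sub>v (other_dim K p n k)" for v
  proof (rule ccontr)
    assume ne: "v \<noteq> 0\<^sub>v (p k)"
    have one: "(\<lambda>x. (1::ennreal)) \<in> borel_measurable R" for R :: "'z measure" by simp
    have sing: "(\<integral>\<^sup>+A. \<integral>\<^sup>+s. ennreal (cond_kernel q N (S P) s A) * 1 \<partial>pos_lborel \<partial>Gplus_lebesgue q) =
      \<top> * (\<integral>\<^sup>+A. \<integral>\<^sup>+s. ennreal (cond_kernel q N (S P) s A) * 1 \<partial>pos_lborel \<partial>Gplus_lebesgue q)" if P: "P \<in> space ?G" for P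
      unfolding mult_1_right S_def
      by (rule nn_integral_cond_kernel_singular[OF q _ _ _ _ _ N])
        (use row_scatter_carrier[OF k spaceG[OF P]] row_scatter_null[OF k spaceG[OF P] v] v(1) ne in \<open>simp_all add: q_def\<close>)
    have "(\<integral>\<^sup>+\<omega>. 1 * b \<partial>M) = (\<integral>\<^sup>+P. ennreal (c * other_weight K p k P) * b * (\<integral>\<^sup>+A. \<integral>\<^sup>+s. ennreal (cond_kernel q N (S P) s A) * 1 \<partial>pos_lborel \<partial>Gplus_lebesgue q) \<partial>?G)" for b :: ennreal
      using M_int[of "\<lambda>x. 1 * b"] param_int[of "\<lambda>_ _. 1" "\<lambda>_. b"] by simp
    note total = this
    \<comment> \<open>The constants \<open>\<top>\<close> and 1 are taken for \<open>b\<close>.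
      Their integrals agree because the conditional masses absorb \<open>\<top>\<close>, yet under a
      probability measure they are \<open>\<top>\<close> and 1.\<close>
    have "(\<integral>\<^sup>+\<omega>. 1 * \<top> \<partial>M) = (\<integral>\<^sup>+\<omega>. 1 * 1 \<partial>M)"
      unfolding total
    proof (rule nn_integral_cong)
      fix P assume P: "P \<in> space ?G"
      have gen: "a * \<top> * I = a * 1 * I" if "I = \<top> * I" for a I :: ennreal
      proof -
        have "a * \<top> * I = a * (\<top> * I)" by (rule mult.assoc)
        then show ?thesis by (simp only: that[symmetric] mult_1_right)
      qed
      show "ennreal (c * other_weight K p k P) * \<top> * (\<integral>\<^sup>+A. \<integral>\<^sup>+s. ennreal (cond_kernel q N (S P) s A) * 1 \<partial>pos_lborel \<partial>Gplus_lebesgue q) =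
        ennreal (c * other_weight K p k P) * 1 * (\<integral>\<^sup>+A. \<integral>\<^sup>+s. ennreal (cond_kernel q N (S P) s A) * 1 \<partial>pos_lborel \<partial>Gplus_lebesgue q)"
        by (rule gen[OF sing[OF P]])
    qed
    then show False by (simp add: M.emeasure_space_1)
  qed
  \<comment> \<open>With fewer columns than rows, the matricization would have a transpose with a
    nonzero null vector, contrary to \<open>inj\<close>.\<close>
  have "q \<le> r"
  proof (rule ccontr)
    assume "\<not> q \<le> r"
    then obtain v where "v \<in> carrier_vec q" "v \<noteq> 0\<^sub>v q" "transpose_mat (matricize (data_dims K p n) k X) *\<^sub>v v = 0\<^sub>v r"
      using wide_matrix_kernel[of "transpose_mat (matricize (data_dims K p n) k X)" r q] matricize_carrier[OF k, of p n X]
      unfolding q_def r_def by auto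
    then show False using inj unfolding q_def r_def by blast
  qed
  then have \<nu>: "\<nu> > real q - 1" unfolding \<nu>r by linarith
  have pd: "S P \<in> pos_def_mats q" if "\<forall>j\<in>?I. P j \<in> Gplus (p j)" for P
    unfolding S_def q_def by (rule row_scatter_pos_def[OF k that inj])
  have \<kappa>: "\<kappa> \<in> measurable ?L (prob_algebra (pd_borel q))"
    unfolding \<kappa>_def[abs_def]
    by (rule mirror_wishart_kernel[OF \<nu>]) (use mat_meas_row_scatter[OF k, of p n X] pd space_others in \<open>auto simp: S_def q_def\<close>)
  have fst_m: "fst \<in> borel_measurable (param_lebesgue K p)"
    unfolding measurable_cong_sets[OF sets_param refl]
    by (rule measurable_compose[OF measurable_fst]) (intro measurable_restrict_space1, simp)
  have comp_m: "(\<lambda>x. snd x k) \<in> measurable (param_lebesgue K p) (Gplus_borel q)"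
    unfolding measurable_cong_sets[OF sets_param refl] q_def
    by (rule measurable_compose[OF measurable_snd measurable_component_singleton]) (use k in simp)
  have others_m: "(\<lambda>x. restrict (snd x) ?I) \<in> measurable (param_lebesgue K p) ?L"
    unfolding measurable_cong_sets[OF sets_param refl]
    by (rule measurable_compose[OF measurable_snd measurable_restrict_subset]) auto
  have pos: "fst x > 0" if "x \<in> space (param_lebesgue K p)" for x
    using that by (auto simp: param_lebesgue_def space_pair_measure space_restrict_space)
  have Z_m: "(\<lambda>x. ?Z (fst x) (snd x k)) \<in> measurable (param_lebesgue K p) (pd_borel q)"
    by (rule precision_measurable[OF fst_m pos comp_m])
  have Z_m': "(\<lambda>x. ?Z (snd x) (fst x)) \<in> measurable (Gplus_borel q \<Otimes>\<^sub>M pos_lborel) (pd_borel q)"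
    by (rule precision_measurable[OF snd_pos_lborel_measurable _ measurable_fst]) (auto simp: space_pair_measure space_restrict_space)
  have Y_eq: "restrict (snd (?T \<omega>)) ?I = (\<lambda>j\<in>?I. \<Psi> j \<omega>)" for \<omega> by auto
  have Z_eq: "?Z (fst (?T \<omega>)) (snd (?T \<omega>) k) = ?Z (\<sigma> \<omega>) (\<Psi> k \<omega>)" for \<omega> using k by simp
  have Z: "(\<lambda>\<omega>. ?Z (\<sigma> \<omega>) (\<Psi> k \<omega>)) \<in> measurable M (pd_borel q)"
    using measurable_compose[OF T Z_m] unfolding Z_eq .
  have Y: "(\<lambda>\<omega>. \<lambda>j\<in>?I. \<Psi> j \<omega>) \<in> measurable M ?L"
    using measurable_compose[OF T others_m] unfolding Y_eq .
  have main: "emeasure M {\<omega> \<in> space M. ?Z (\<sigma> \<omega>) (\<Psi> k \<omega>) \<in> A \<and> (\<lambda>j\<in>?I. \<Psi> j \<omega>) \<in> B} =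
      (\<integral>\<^sup>+\<omega>. emeasure (\<kappa> (\<lambda>j\<in>?I. \<Psi> j \<omega>)) A * indicator B (\<lambda>j\<in>?I. \<Psi> j \<omega>) \<partial>M)"
    if A: "A \<in> sets (pd_borel q)" and B: "B \<in> sets ?L" for A B
  proof -
    have one_meas: "(\<lambda>x. 1) \<in> borel_measurable (Gplus_borel q \<Otimes>\<^sub>M pos_lborel)" by simp
    have hA: "(\<lambda>x. indicator A (?Z (snd x) (fst x)) :: ennreal) \<in> borel_measurable (Gplus_borel q \<Otimes>\<^sub>M pos_lborel)"
      by (rule measurable_compose[OF Z_m' borel_measurable_indicator[OF A]])
    have gA: "(\<lambda>x. (indicator A (?Z (fst x) (snd x k)) :: ennreal) * indicator B (restrict (snd x) ?I)) \<in> borel_measurable (param_lebesgue K p)"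
      by (rule borel_measurable_times_ennreal[OF measurable_compose[OF Z_m borel_measurable_indicator[OF A]] measurable_compose[OF others_m borel_measurable_indicator[OF B]]])
    have em: "(\<lambda>P. emeasure (\<kappa> P) A) \<in> borel_measurable ?L"
      by (rule measurable_emeasure_kernel[OF measurable_prob_algebraD[OF \<kappa>] A])
    have g1: "(\<lambda>x. 1 * (emeasure (\<kappa> (restrict (snd x) ?I)) A * indicator B (restrict (snd x) ?I))) \<in> borel_measurable (param_lebesgue K p)"
      by (intro borel_measurable_times_ennreal borel_measurable_const measurable_compose[OF others_m em] measurable_compose[OF others_m borel_measurable_indicator[OF B]])
    have ms: "{\<omega> \<in> space M. ?Z (\<sigma> \<omega>) (\<Psi> k \<omega>) \<in> A \<and> (\<lambda>j\<in>?I. \<Psi> j \<omega>) \<in> B} \<in> sets M"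
    proof -
      have "{\<omega> \<in> space M. ?Z (\<sigma> \<omega>) (\<Psi> k \<omega>) \<in> A \<and> (\<lambda>j\<in>?I. \<Psi> j \<omega>) \<in> B} =
        ((\<lambda>\<omega>. ?Z (\<sigma> \<omega>) (\<Psi> k \<omega>)) -` A \<inter> space M) \<inter> ((\<lambda>\<omega>. \<lambda>j\<in>?I. \<Psi> j \<omega>) -` B \<inter> space M)" by auto
      then show ?thesis using measurable_sets[OF Z A] measurable_sets[OF Y B] by (simp only: sets.Int)
    qed
    have "emeasure M {\<omega> \<in> space M. ?Z (\<sigma> \<omega>) (\<Psi> k \<omega>) \<in> A \<and> (\<lambda>j\<in>?I. \<Psi> j \<omega>) \<in> B} =
       (\<integral>\<^sup>+\<omega>. indicator {\<omega> \<in> space M. ?Z (\<sigma> \<omega>) (\<Psi> k \<omega>) \<in> A \<and> (\<lambda>j\<in>?I. \<Psi> j \<omega>) \<in> B} \<omega> \<partial>M)"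
      by (rule nn_integral_indicator[OF ms, symmetric])
    also have "\<dots> = (\<integral>\<^sup>+\<omega>. (\<lambda>x. indicator A (?Z (fst x) (snd x k)) * indicator B (restrict (snd x) ?I)) (?T \<omega>) \<partial>M)"
      unfolding Z_eq Y_eq by (rule nn_integral_cong) (simp add: indicator_def)
    also have "\<dots> = (\<integral>\<^sup>+P. ennreal (c * other_weight K p k P) * indicator B P * (\<integral>\<^sup>+A'. \<integral>\<^sup>+s. ennreal (cond_kernel q N (S P) s A') * indicator A (?Z s A') \<partial>pos_lborel \<partial>Gplus_lebesgue q) \<partial>?G)"
      unfolding M_int[OF gA] by (rule param_int[OF hA gA])
    \<comment> \<open>For each value of the other shapes the conditional integral is replaced by the
      mass of \<kappa> times the total conditional mass.\<close>
    also have "\<dots> = (\<integral>\<^sup>+P. ennreal (c * other_weight K p k P) * (emeasure (\<kappa> P) A * indicator B P) * (\<integral>\<^sup>+A'. \<integral>\<^sup>+s. ennreal (cond_kernel q N (S P) s A') * 1 \<partial>pos_lborel \<partial>Gplus_lebesgue q) \<partial>?G)"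
    proof (rule nn_integral_cong)
      fix P assume P: "P \<in> space ?G"
      have "P \<in> space ?L" using P by (auto simp: space_PiM space_Gplus_lebesgue space_Gplus_borel)
      from measurable_space[OF \<kappa> this] have "prob_space (\<kappa> P)" "sets (\<kappa> P) = sets (pd_borel q)" by (auto simp: space_prob_algebra)
      then have \<kappa>1: "emeasure (\<kappa> P) (space (pd_borel q)) = 1" by (metis prob_space.emeasure_space_1 sets_eq_imp_space_eq)
      \<comment> \<open>\<open>C\<close> depends on \<open>P\<close>, but as \<kappa> has total mass
        1 it equals the integral of the kernel itself, so its value never has to be
        computed.\<close>
      obtain C where C: "\<And>A. A \<in> sets (pd_borel q) \<Longrightarrow>
        (\<integral>\<^sup>+A'. \<integral>\<^sup>+s. ennreal (cond_kernel q N (S P) s A') * indicator A (?Z s A') \<partial>pos_lborel \<partial>Gplus_lebesgue q) = ennreal C * emeasure (\<kappa> P) A"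
        using nn_integral_cond_kernel[OF q pd[OF spaceG[OF P]] \<nu> N] unfolding \<kappa>_def by blast
      have "(\<integral>\<^sup>+A'. \<integral>\<^sup>+s. ennreal (cond_kernel q N (S P) s A') * 1 \<partial>pos_lborel \<partial>Gplus_lebesgue q) =
        (\<integral>\<^sup>+A'. \<integral>\<^sup>+s. ennreal (cond_kernel q N (S P) s A') * indicator (space (pd_borel q)) (?Z s A') \<partial>pos_lborel \<partial>Gplus_lebesgue q)"
      proof (rule nn_integral_Gplus_cong)
        fix A' and s :: real assume "A' \<in> Gplus q" "s > 0"
        then have "?Z s A' \<in> pos_def_mats q" by (intro mat_inv_scaled_gram_pos_def(1)) (auto simp: Gplus_def)
        then show "ennreal (cond_kernel q N (S P) s A') * 1 = ennreal (cond_kernel q N (S P) s A') * indicator (space (pd_borel q)) (?Z s A')"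
          by (simp add: space_pd_borel)
      qed
      also have "\<dots> = ennreal C" unfolding C[OF sets.top] \<kappa>1 by (rule mult_1_right)
      finally have C1: "(\<integral>\<^sup>+A'. \<integral>\<^sup>+s. ennreal (cond_kernel q N (S P) s A') * 1 \<partial>pos_lborel \<partial>Gplus_lebesgue q) = ennreal C" .
      show "ennreal (c * other_weight K p k P) * indicator B P * (\<integral>\<^sup>+A'. \<integral>\<^sup>+s. ennreal (cond_kernel q N (S P) s A') * indicator A (?Z s A') \<partial>pos_lborel \<partial>Gplus_lebesgue q) =
        ennreal (c * other_weight K p k P) * (emeasure (\<kappa> P) A * indicator B P) * (\<integral>\<^sup>+A'. \<integral>\<^sup>+s. ennreal (cond_kernel q N (S P) s A') * 1 \<partial>pos_lborel \<partial>Gplus_lebesgue q)"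
        unfolding C1 C[OF A] by (simp only: mult_ac)
    qed
    \<comment> \<open>\<open>param_int\<close> read backwards, with the mass of \<kappa> counted as
      part of the function of the other shapes, returns to an expectation under
      \<open>M\<close>.\<close>
    also have "\<dots> = (\<integral>\<^sup>+x. ?f x * (1 * (emeasure (\<kappa> (restrict (snd x) ?I)) A * indicator B (restrict (snd x) ?I))) \<partial>param_lebesgue K p)"
      by (rule param_int[of "\<lambda>_ _. 1" "\<lambda>P. emeasure (\<kappa> P) A * indicator B P", OF one_meas g1, symmetric])
    also have "\<dots> = (\<integral>\<^sup>+\<omega>. 1 * (emeasure (\<kappa> (restrict (snd (?T \<omega>)) ?I)) A * indicator B (restrict (snd (?T \<omega>)) ?I)) \<partial>M)"
      by (rule M_int[OF g1, symmetric])
    finally show ?thesis unfolding Y_eq mult_1 .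
  qed
  show ?thesis
    unfolding has_conditional_distribution_def row_scatter_def[symmetric]
    using Z Y \<kappa> main unfolding q_def \<nu>_def N_def \<kappa>_def[abs_def] S_def by blast
qed

end
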